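(* Let $\omega$ be any holomorphic contact form on $\mathbb{C}P^3$. For three points and a line in general position in $\mathbb{C}P^3$, the number of rational cubic curves that are Legendrian (contact) with respect to $\omega$, pass through the three points and meet the line is equal to three.
   Context: Let $(x:y:z:w)$ be homogeneous coordinates on $\mathbb{C}P^3$. A holomorphic contact form on $\mathbb{C}P^3$ is given locally by holomorphic $1$-forms $\omega_i$ on charts $A_i$ covering $\mathbb{C}P^3$, with $f_{ij}\omega_i=\omega_j$ on $A_i\cap A_j$ for nowhere-zero transition functions $f_{ij}$, such that $\omega_i\wedge d\omega_i$ is nowhere zero on $A_i$. By a theorem of Kobayashi, each such form is, in homogeneous coordinates, $$(py-qz+aw)\,dx+(-px+rz+bw)\,dy+(qx-ry+cw)\,dz+(-ax-by-cz)\,dw$$ with constants $a,b,c,p,q,r\in\mathbb{C}$, $pc+qb+ra\neq 0$. A curve $C\subset\mathbb{C}P^3$ is Legendrian (or contact, or tangent to $\omega$) if $\omega$ vanishes on the tangent vectors of $C$ at its smooth points. A rational cubic is an irreducible rational curve of degree $3$ in $\mathbb{C}P^3$. "In general position" means that the triple of points and the line are taken from a suitable nonempty Zariski open subset of the parameter space of all triples of points and lines. *)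

theory Defs
  imports "HOL-Analysis.Analysis"
begin

section \<open>Projective spaces over the complex numbers\<close>

text \<open>A point of a projective space is a one-dimensional complex linear subspace, a line of
  \<open>CP\<^sup>3\<close> a two-dimensional one; incidence is inclusion. (\<open>vec.span\<close>, \<open>vec.dim\<close> are taken over
  the complex field.)\<close>

definition CP :: "(complex^'n) set set"
  where "CP = {P. vec.subspace P \<and> vec.dim P = 1}"

definition proj_pt :: "complex^'n \<Rightarrow> (complex^'n) set"
  where "proj_pt x = vec.span {x}"

definition proj_lines :: "(complex^4) set set"
  where "proj_lines = {L. vec.subspace L \<and> vec.dim L = 2}"

text \<open>The preimage of \<open>S\<close> under the projection from the punctured vector space.\<close>

definition cone :: "(complex^'n) set set \<Rightarrow> (complex^'n) set"
  where "cone S = {x. x \<noteq> 0 \<and> proj_pt x \<in> S}"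

text \<open>Bilinear, without conjugation: the value of the covector \<open>a\<close> on the vector \<open>v\<close>.\<close>

definition pairing :: "complex^'n \<Rightarrow> complex^'n \<Rightarrow> complex"
  where "pairing a v = (\<Sum>i\<in>UNIV. a $ i * v $ i)"

definition plane :: "complex^4 \<Rightarrow> (complex^4) set set"
  where "plane h = {P \<in> CP. \<forall>x\<in>P. pairing h x = 0}"


section \<open>Zariski open sets\<close>

text \<open>The algebra of functions generated by the coordinate functions in \<open>X\<close>.\<close>

inductive_set poly_funs :: "('a \<Rightarrow> complex) set \<Rightarrow> ('a \<Rightarrow> complex) set"
  for X :: "('a \<Rightarrow> complex) set" where
  coord: "f \<in> X \<Longrightarrow> f \<in> poly_funs X"
| const: "(\<lambda>_. c) \<in> poly_funs X"
| add: "f \<in> poly_funs X \<Longrightarrow> g \<in> poly_funs X \<Longrightarrow> (\<lambda>x. f x + g x) \<in> poly_funs X"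
| mult: "f \<in> poly_funs X \<Longrightarrow> g \<in> poly_funs X \<Longrightarrow> (\<lambda>x. f x * g x) \<in> poly_funs X"

definition vec_polys :: "(complex^4 \<Rightarrow> complex) set"
  where "vec_polys = poly_funs {\<lambda>x. x $ i | i. True}"

text \<open>The polynomials in \<open>F\<close> are not required to be homogeneous: as \<open>U\<close> is a set of points of
  projective space, the common zero set of \<open>F\<close> is invariant under scaling, hence is also the
  common zero set of the homogeneous components. The same applies to multihomogeneity below.\<close>

definition zariski_open :: "(complex^4) set set \<Rightarrow> bool"
  where "zariski_open U \<longleftrightarrow> U \<subseteq> CP \<and>
    (\<exists>F \<subseteq> vec_polys. \<forall>x. x \<noteq> 0 \<longrightarrow> (proj_pt x \<in> U \<longleftrightarrow> (\<exists>f\<in>F. f x \<noteq> 0)))"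

text \<open>The Pluecker coordinates of the line spanned by \<open>u\<close> and \<open>v\<close>, as an alternating matrix.\<close>

definition pluecker :: "complex^4 \<Rightarrow> complex^4 \<Rightarrow> complex^4^4"
  where "pluecker u v = (\<chi> i j. u $ i * v $ j - u $ j * v $ i)"

definition param_polys :: "((complex^4) \<times> (complex^4) \<times> (complex^4) \<times> (complex^4^4) \<Rightarrow> complex) set"
  where "param_polys = poly_funs
    ({\<lambda>(x, y, z, m). x $ i | i. True} \<union> {\<lambda>(x, y, z, m). y $ i | i. True} \<union>
     {\<lambda>(x, y, z, m). z $ i | i. True} \<union> {\<lambda>(x, y, z, m). m $ i $ j | i j. True})"

text \<open>Zariski open subsets of the parameter space of three points and a line, the Grassmannian of
  lines carrying the topology induced by the Pluecker embedding.\<close>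

definition zariski_open_param ::
  "((complex^4) set \<times> (complex^4) set \<times> (complex^4) set \<times> (complex^4) set) set \<Rightarrow> bool"
  where "zariski_open_param U \<longleftrightarrow> U \<subseteq> CP \<times> CP \<times> CP \<times> proj_lines \<and>
    (\<exists>F \<subseteq> param_polys. \<forall>x y z u v.
       x \<noteq> 0 \<longrightarrow> y \<noteq> 0 \<longrightarrow> z \<noteq> 0 \<longrightarrow> vec.span {u, v} \<in> proj_lines \<longrightarrow>
       ((proj_pt x, proj_pt y, proj_pt z, vec.span {u, v}) \<in> U \<longleftrightarrow>
        (\<exists>f\<in>F. f (x, y, z, pluecker u v) \<noteq> 0)))"


section \<open>Holomorphic contact forms\<close>

definition hol_on :: "(complex^'n \<Rightarrow> complex) \<Rightarrow> (complex^'n) set \<Rightarrow> bool"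
  where "hol_on f U \<longleftrightarrow>
    (\<forall>x\<in>U. \<exists>D. (f has_derivative D) (at x) \<and> (\<forall>c v. D (c *s v) = c * D v))"

text \<open>A holomorphic 1-form on an open \<open>S \<subseteq> CP\<^sup>3\<close> is encoded by its pullback
  \<open>\<alpha>\<^sub>1 dx + \<alpha>\<^sub>2 dy + \<alpha>\<^sub>3 dz + \<alpha>\<^sub>4 dw\<close> to \<open>cone S\<close>. The forms on \<open>cone S\<close> arising in this way are those
  which annihilate the Euler field, \<open>\<alpha>\<^sub>x(x) = 0\<close>, and are invariant under the maps \<open>x \<mapsto> c x\<close>,
  \<open>\<alpha>\<^bsub>c x\<^esub>(c v) = \<alpha>\<^sub>x(v)\<close>.\<close>

definition hol_1form_on :: "(complex^4 \<Rightarrow> complex^4) \<Rightarrow> (complex^4) set set \<Rightarrow> bool"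
  where "hol_1form_on \<alpha> S \<longleftrightarrow>
    (\<forall>k. hol_on (\<lambda>x. \<alpha> x $ k) (cone S)) \<and>
    (\<forall>x\<in>cone S. pairing (\<alpha> x) x = 0) \<and>
    (\<forall>x\<in>cone S. \<forall>c. c \<noteq> 0 \<longrightarrow> c *s \<alpha> (c *s x) = \<alpha> x)"

definition ext_deriv :: "(complex^4 \<Rightarrow> complex^4) \<Rightarrow> complex^4 \<Rightarrow> complex^4 \<Rightarrow> complex^4 \<Rightarrow> complex"
  where "ext_deriv \<alpha> x u v =
    pairing (frechet_derivative \<alpha> (at x) u) v - pairing (frechet_derivative \<alpha> (at x) v) u"

definition wedge_deriv ::
  "(complex^4 \<Rightarrow> complex^4) \<Rightarrow> complex^4 \<Rightarrow> complex^4 \<Rightarrow> complex^4 \<Rightarrow> complex^4 \<Rightarrow> complex"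
  where "wedge_deriv \<alpha> x u v w =
    pairing (\<alpha> x) u * ext_deriv \<alpha> x v w + pairing (\<alpha> x) v * ext_deriv \<alpha> x w u +
    pairing (\<alpha> x) w * ext_deriv \<alpha> x u v"

text \<open>Since pulling back along the submersion \<open>cone S \<rightarrow> S\<close> commutes with the exterior derivative and
  is pointwise injective, \<open>\<omega>\<^sub>i \<and> d\<omega>\<^sub>i\<close> may be tested for zeros on the cone.\<close>

definition contact_form ::
  "'i set \<Rightarrow> ('i \<Rightarrow> (complex^4) set set) \<Rightarrow> ('i \<Rightarrow> complex^4 \<Rightarrow> complex^4) \<Rightarrow> bool"
  where "contact_form I A \<omega> \<longleftrightarrow>
    (\<Union>i\<in>I. A i) = CP \<and>
    (\<forall>i\<in>I. open (cone (A i)) \<and> hol_1form_on (\<omega> i) (A i)) \<and>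
    (\<exists>f. \<forall>i\<in>I. \<forall>j\<in>I.
       hol_on (\<lambda>x. f i j (proj_pt x)) (cone (A i \<inter> A j)) \<and>
       (\<forall>x\<in>cone (A i \<inter> A j).
          f i j (proj_pt x) \<noteq> 0 \<and> f i j (proj_pt x) *s \<omega> i x = \<omega> j x)) \<and>
    (\<forall>i\<in>I. \<forall>x\<in>cone (A i). \<exists>u v w. wedge_deriv (\<omega> i) x u v w \<noteq> 0)"


section \<open>Rational curves and Legendrian curves\<close>

definition form_map :: "nat \<Rightarrow> (nat \<Rightarrow> complex^4) \<Rightarrow> complex^2 \<Rightarrow> complex^4"
  where "form_map m a w = (\<Sum>k\<le>m. (w $ 1 ^ k * w $ 2 ^ (m - k)) *s a k)"

text \<open>The image of a morphism from \<open>CP\<^sup>1\<close> that is birational onto its image, that is (in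
  characteristic 0), injective outside finitely many points. Such an image is closed,
  irreducible and one-dimensional.\<close>

definition rational_curve :: "(complex^4) set set \<Rightarrow> bool"
  where "rational_curve C \<longleftrightarrow> (\<exists>m a.
    (\<forall>w. w \<noteq> 0 \<longrightarrow> form_map m a w \<noteq> 0) \<and>
    C = {proj_pt (form_map m a w) | w. w \<noteq> 0} \<and>
    (\<exists>E. finite E \<and> (\<forall>w w'. w \<noteq> 0 \<longrightarrow> w' \<noteq> 0 \<longrightarrow> proj_pt w \<notin> E \<longrightarrow> proj_pt w' \<notin> E \<longrightarrow>
       proj_pt (form_map m a w) = proj_pt (form_map m a w') \<longrightarrow> proj_pt w = proj_pt w')))"

text \<open>The degree of a curve is the number of its points on a general plane, planes being
  parametrized by the dual projective space.\<close>

definition curve_degree :: "(complex^4) set set \<Rightarrow> nat \<Rightarrow> bool"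
  where "curve_degree C d \<longleftrightarrow> (\<exists>W. zariski_open W \<and> W \<noteq> {} \<and>
    (\<forall>h. h \<noteq> 0 \<longrightarrow> proj_pt h \<in> W \<longrightarrow> finite (C \<inter> plane h) \<and> card (C \<inter> plane h) = d))"

definition rational_cubic :: "(complex^4) set set \<Rightarrow> bool"
  where "rational_cubic C \<longleftrightarrow> rational_curve C \<and> curve_degree C 3"

text \<open>The Zariski tangent space at \<open>x\<close> of the affine cone over \<open>C\<close>. It contains \<open>x\<close>, and its
  quotient by the line through \<open>x\<close> is the tangent space of \<open>C\<close> at the point \<open>proj_pt x\<close>. So a
  point of a curve is smooth iff the dimension upstairs is 2.\<close>

definition cone_tangent :: "(complex^4) set set \<Rightarrow> complex^4 \<Rightarrow> (complex^4) set"
  where "cone_tangent C x =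
    {v. \<forall>f\<in>vec_polys. (\<forall>y\<in>cone C. f y = 0) \<longrightarrow> deriv (\<lambda>t. f (x + t *s v)) 0 = 0}"

definition smooth_point :: "(complex^4) set set \<Rightarrow> complex^4 \<Rightarrow> bool"
  where "smooth_point C x \<longleftrightarrow> x \<in> cone C \<and> vec.dim (cone_tangent C x) = 2"

definition legendrian ::
  "'i set \<Rightarrow> ('i \<Rightarrow> (complex^4) set set) \<Rightarrow> ('i \<Rightarrow> complex^4 \<Rightarrow> complex^4) \<Rightarrow> (complex^4) set set \<Rightarrow> bool"
  where "legendrian I A \<omega> C \<longleftrightarrow>
    (\<forall>i\<in>I. \<forall>x\<in>cone (A i). smooth_point C x \<longrightarrow>
       (\<forall>v\<in>cone_tangent C x. pairing (\<omega> i x) v = 0))"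

end

theory Submission
  imports Defs "HOL-Complex_Analysis.Complex_Analysis"
    "HOL-Computational_Algebra.Fundamental_Theorem_Algebra"
begin

text \<open>The proof has two parts: a contact form is the same as a symplectic form \<open>B\<close> on \<open>\<complex>\<^sup>4\<close>
  (Kobayashi), and the Legendrian cubics through three general points form an explicit pencil, so
  that the condition to meet a line becomes a cubic equation in one unknown.

  \<^emph>\<open>Contact forms.\<close> Let \<open>\<alpha>\<close> be the pullback of a local contact form to the cone. Then
  \<open>\<alpha> \<and> d\<alpha>\<close> is annihilated by the Euler field, so it is the contraction of the standard volume
  form with \<open>g(x) x\<close> for a nowhere zero function \<open>g\<close>, homogeneous of degree \<open>-4\<close>. A
  change of chart multiplies \<open>\<alpha>\<close> by some \<open>f\<close> and \<open>g\<close> by \<open>f\<^sup>2\<close>. Hence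
  \<open>\<gamma>\<^sub>x(v) = \<alpha>\<^sub>x(v)\<^sup>2 / g(x)\<close> is defined on the whole punctured space, is quadratic in \<open>v\<close> and
  homogeneous of degree \<open>2\<close> in \<open>x\<close>. The function \<open>t \<mapsto> \<gamma>\<^bsub>x + ty\<^esub>(y)\<close> is entire and tends
  to \<open>\<gamma>\<^sub>y(x)\<close> at infinity, so it is constant, and \<open>\<gamma>\<^sub>x(y) = \<gamma>\<^sub>y(x)\<close>. A symmetric expression that
  is the square of a linear form in each argument is the square of a bilinear form \<open>B\<close>
  (\<open>symmetric_squares_bilinear\<close>); \<open>B\<close> is alternating and nondegenerate, and the kernel of
  \<open>\<alpha>\<^sub>x\<close> is that of \<open>B(x, -)\<close> (\<open>contact_form_symplectic\<close>).

  \<^emph>\<open>Rational cubics.\<close> A curve parametrized birationally by forms of degree \<open>m\<close> has \<open>m\<close>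
  points on a general plane (\<open>degree_of_parametrized_curve\<close>), so a rational cubic is the image of
  a binary cubic form \<open>F\<close> with coefficients \<open>a\<^sub>k\<close> in \<open>\<complex>\<^sup>4\<close>. A cubic not contained in a line is
  smooth outside a finite set, and being Legendrian amounts to \<open>B(F, F') = 0\<close>, that is, to five
  bilinear equations between the \<open>a\<^sub>k\<close>.

  \<^emph>\<open>The pencil.\<close> Place the three points at \<open>t = 0, \<infinity>, 1\<close>, so that \<open>F = X + a\<^sub>1 t + a\<^sub>2 t\<^sup>2 + Y t\<^sup>3\<close>.
  The equations say that \<open>a\<^sub>1\<close> and \<open>a\<^sub>2\<close> are orthogonal to \<open>X\<close> and \<open>Y\<close> and that
  \<open>B(a\<^sub>1, a\<^sub>2) = - 3 B(X, Y)\<close>, while the third point prescribes \<open>N = a\<^sub>1 + a\<^sub>2\<close>. In the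
  plane orthogonal to \<open>X\<close> and \<open>Y\<close> this leaves \<open>a\<^sub>1 = Z + s N\<close> with a fixed vector \<open>Z\<close> and a free
  parameter \<open>s\<close>. The members of the pencil
  \<open>F\<^sub>s = X + (Z + s N) t + (N - Z - s N) t\<^sup>2 + Y t\<^sup>3\<close> agree modulo \<open>N\<close>, so a point \<open>F\<^sub>s(t)\<close> of a
  line \<open>L\<close> has to satisfy the condition, independent of \<open>s\<close>, that it lies in the plane spanned by \<open>L\<close>
  and \<open>N\<close>. This is a cubic equation in \<open>t\<close>; each of its roots determines \<open>s\<close>, and for a general
  configuration the three values of \<open>s\<close> are distinct (\<open>three_legendrian_cubics\<close>).
  All conditions of generality are expressed by one multihomogeneous polynomial in the points and the
  Pluecker coordinates, which does not vanish at an explicit configuration.\<close>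

no_notation fps_nth (infixl "$" 75)

section \<open>Linear algebra and polynomial functions\<close>

lemma pairing_add_right: "pairing a (v + w) = pairing a v + pairing a w"
  by (simp add: pairing_def sum.distrib algebra_simps)

lemma pairing_add_left: "pairing (a + b) v = pairing a v + pairing b v"
  by (simp add: pairing_def sum.distrib algebra_simps)

lemma pairing_scale_right: "pairing a (c *s v) = c * pairing a v"
  by (simp add: pairing_def sum_distrib_left algebra_simps)

lemma pairing_scale_left: "pairing (c *s a) v = c * pairing a v"
  by (simp add: pairing_def sum_distrib_left algebra_simps)

lemma pairing_zero [simp]: "pairing a 0 = 0" "pairing 0 v = 0"
  by (simp_all add: pairing_def)

lemma pairing_commute: "pairing a v = pairing v a"
  by (simp add: pairing_def mult.commute)

lemma pairing_diff_right: "pairing a (v - w) = pairing a v - pairing a w"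
  by (simp add: pairing_def sum_subtractf algebra_simps)

lemma pairing_diff_left: "pairing (a - b) v = pairing a v - pairing b v"
  by (simp add: pairing_def sum_subtractf algebra_simps)

lemma pairing_sum_right: "pairing a (\<Sum>i\<in>S. f i) = (\<Sum>i\<in>S. pairing a (f i))"
  by (induction S rule: infinite_finite_induct) (auto simp: pairing_add_right)

lemma pairing_axis: "pairing a (axis i 1) = a $ i"
  by (simp add: pairing_def axis_def if_distrib cong: if_cong)

lemma pairing_eq_0_imp: "(\<And>v. pairing a v = 0) \<Longrightarrow> a = 0"
  by (metis pairing_axis vec_eq_iff zero_index)

lemma pairing_eq_0_imp': "(\<And>a. pairing a v = 0) \<Longrightarrow> v = 0"
  by (metis pairing_commute pairing_eq_0_imp)

lemmas pairing_simps = pairing_add_left pairing_add_right pairing_scale_left pairing_scale_right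
  pairing_diff_left pairing_diff_right

lemma proj_pt_eq: "proj_pt x = {c *s x | c. True}"
  by (auto simp: proj_pt_def vec.span_singleton)

lemma proj_pt_self: "x \<in> proj_pt x"
  by (auto simp: proj_pt_def vec.span_base)

lemma proj_pt_in_CP: "x \<noteq> 0 \<Longrightarrow> proj_pt x \<in> CP"
  by (simp add: CP_def proj_pt_def)

lemma CP_E:
  assumes "P \<in> CP"
  obtains x where "x \<noteq> 0" "P = proj_pt x"
proof -
  obtain B where B: "B \<subseteq> P" "vec.independent B" "P \<subseteq> vec.span B" "card B = vec.dim P"
    using vec.basis_exists by blast
  from assms have "card B = 1" and sub: "vec.subspace P" using B by (auto simp: CP_def)
  then obtain x where x: "B = {x}" using card_1_singletonE by blast
  have "x \<noteq> 0" using B x vec.dependent_zero by blast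
  moreover have "P = proj_pt x"
    using B x sub by (simp add: proj_pt_def vec.span_minimal subset_antisym)
  ultimately show ?thesis using that by blast
qed

lemma proj_pt_eq_iff:
  assumes "x \<noteq> 0" "y \<noteq> 0"
  shows "proj_pt x = proj_pt y \<longleftrightarrow> (\<exists>c. c \<noteq> 0 \<and> y = c *s x)"
proof
  assume "proj_pt x = proj_pt y"
  hence "y \<in> proj_pt x" using proj_pt_self by blast
  then show "\<exists>c. c \<noteq> 0 \<and> y = c *s x" using assms by (auto simp: proj_pt_eq)
next
  assume "\<exists>c. c \<noteq> 0 \<and> y = c *s x"
  then obtain c where c: "c \<noteq> 0" "y = c *s x" by blast
  have "proj_pt (c *s x) = proj_pt x"
  proof (intro equalityI subsetI)
    fix z assume "z \<in> proj_pt x"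
    then obtain d where d: "z = d *s x" by (auto simp: proj_pt_eq)
    have "z = (d / c) *s (c *s x)" using c d by simp
    then show "z \<in> proj_pt (c *s x)" unfolding proj_pt_eq by blast
  qed (auto simp: proj_pt_eq)
  with c show "proj_pt x = proj_pt y" by simp
qed

lemma proj_pt_scale: "c \<noteq> 0 \<Longrightarrow> proj_pt (c *s x) = proj_pt x"
  by (metis proj_pt_eq_iff vector_mul_eq_0)

lemma poly_funs_sum: "(\<And>i. i \<in> S \<Longrightarrow> f i \<in> poly_funs X) \<Longrightarrow> (\<lambda>x. \<Sum>i\<in>S. f i x) \<in> poly_funs X"
  by (induction S rule: infinite_finite_induct) (auto intro: poly_funs.intros)

lemma poly_funs_uminus: "f \<in> poly_funs X \<Longrightarrow> (\<lambda>x. - f x) \<in> poly_funs X"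
  using poly_funs.mult[OF poly_funs.const[of "-1" X], of f] by simp

lemma poly_funs_diff: "f \<in> poly_funs X \<Longrightarrow> g \<in> poly_funs X \<Longrightarrow> (\<lambda>x. f x - g x) \<in> poly_funs X"
  using poly_funs.add[OF _ poly_funs_uminus, of f X g] by simp

lemma poly_funs_power: "f \<in> poly_funs X \<Longrightarrow> (\<lambda>x. f x ^ k) \<in> poly_funs X"
  by (induction k) (auto intro: poly_funs.intros)

lemmas poly_funs_intros = poly_funs.const poly_funs.add poly_funs.mult poly_funs_sum
  poly_funs_uminus poly_funs_diff poly_funs_power

lemma vec_polys_coord: "(\<lambda>x. x $ i) \<in> vec_polys"
  unfolding vec_polys_def by (rule poly_funs.coord) auto

lemma vec_polys_pairing: "pairing a \<in> vec_polys"
  using vec_polys_coord unfolding pairing_def[abs_def] vec_polys_def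
  by (intro poly_funs_intros) auto

lemma vec_polys_on_line:
  assumes "f \<in> vec_polys"
  shows "\<exists>p. \<forall>t. f (x + t *s v) = poly p t"
  using assms unfolding vec_polys_def
proof induction
  case (coord f)
  then obtain i where "f = (\<lambda>x. x $ i)" by auto
  then show ?case by (intro exI[of _ "[:x $ i, v $ i:]"]) auto
next
  case (const c)
  then show ?case by (intro exI[of _ "[:c:]"]) auto
next
  case (add f g)
  then show ?case by (metis poly_add)
next
  case (mult f g)
  then show ?case by (metis poly_mult)
qed

lemma finite_zeros_on_line:
  assumes "f \<in> vec_polys" "f x \<noteq> 0"
  shows "finite {t. f (x + t *s v) = 0}"
proof -
  obtain p where p: "\<And>t. f (x + t *s v) = poly p t" using vec_polys_on_line[OF assms(1)] by blast
  have "p \<noteq> 0" using p[of 0] assms(2) by auto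
  then show ?thesis using p poly_roots_finite by simp
qed

text \<open>The ring of polynomial functions is a domain, because the zeros of each factor on the line
  joining a point where one factor does not vanish to one where the other does not are finite in
  number.\<close>

lemma vec_polys_common_nonzero:
  assumes "f \<in> vec_polys" "g \<in> vec_polys" "f x \<noteq> 0" "g y \<noteq> 0"
  shows "\<exists>z. f z \<noteq> 0 \<and> g z \<noteq> 0"
proof -
  have "finite {t. f (x + t *s (y - x)) = 0}" by (rule finite_zeros_on_line) fact+
  moreover have "finite {t. g (y + t *s (x - y)) = 0}" by (rule finite_zeros_on_line) fact+
  hence "finite ((\<lambda>t. 1 - t) ` {t. g (y + t *s (x - y)) = 0})" by blast
  moreover have "{t. g (x + t *s (y - x)) = 0} \<subseteq> (\<lambda>t. 1 - t) ` {t. g (y + t *s (x - y)) = 0}"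
  proof
    fix t assume "t \<in> {t. g (x + t *s (y - x)) = 0}"
    moreover have "x + t *s (y - x) = y + (1 - t) *s (x - y)"
      by (simp add: vec_eq_iff algebra_simps)
    ultimately have "1 - t \<in> {t. g (y + t *s (x - y)) = 0}" by simp
    then show "t \<in> (\<lambda>t. 1 - t) ` {t. g (y + t *s (x - y)) = 0}"
      by (rule rev_image_eqI) simp
  qed
  ultimately have "finite ({t. f (x + t *s (y - x)) = 0} \<union> {t. g (x + t *s (y - x)) = 0})"
    by (meson finite_UnI finite_subset)
  then obtain t where "t \<notin> {t. f (x + t *s (y - x)) = 0} \<union> {t. g (x + t *s (y - x)) = 0}"
    using ex_new_if_finite[OF infinite_UNIV_char_0] by blast
  then show ?thesis by blast
qed

lemma vec_polys_mult_eq_0: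
  assumes "f \<in> vec_polys" "g \<in> vec_polys" "\<And>x. f x * g x = 0"
  shows "(\<forall>x. f x = 0) \<or> (\<forall>x. g x = 0)"
  using vec_polys_common_nonzero[OF assms(1,2)] assms(3) by (metis mult_eq_0_iff)

text \<open>The argument \<open>J\<close> is the matrix of the bilinear form, transposed: the entry in row \<open>i\<close> and
  column \<open>j\<close> is the value at the pair of the \<open>j\<close>-th and the \<open>i\<close>-th basis vector.\<close>

definition bil :: "complex^4^4 \<Rightarrow> complex^4 \<Rightarrow> complex^4 \<Rightarrow> complex"
  where "bil J x y = pairing (J *v x) y"

lemma bil_add_left: "bil J (x + x') y = bil J x y + bil J x' y"
  by (simp add: bil_def pairing_simps matrix_vector_right_distrib)
lemma bil_add_right: "bil J x (y + y') = bil J x y + bil J x y'"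
  by (simp add: bil_def pairing_simps)
lemma bil_diff_left: "bil J (x - x') y = bil J x y - bil J x' y"
  by (simp add: bil_def pairing_simps matrix_vector_mult_diff_distrib)
lemma bil_diff_right: "bil J x (y - y') = bil J x y - bil J x y'"
  by (simp add: bil_def pairing_simps)
lemma bil_scale_left: "bil J (c *s x) y = c * bil J x y"
  by (simp add: bil_def pairing_simps vector_scalar_commute)
lemma bil_scale_right: "bil J x (c *s y) = c * bil J x y"
  by (simp add: bil_def pairing_simps)
lemma bil_zero [simp]: "bil J 0 y = 0" "bil J x 0 = 0"
  by (simp_all add: bil_def)
lemmas bil_simps = bil_add_left bil_add_right bil_diff_left bil_diff_right bil_scale_left
  bil_scale_right

definition symplectic :: "complex^4^4 \<Rightarrow> bool"
  where "symplectic J \<longleftrightarrow> (\<forall>x. bil J x x = 0) \<and> (\<forall>x. x \<noteq> 0 \<longrightarrow> (\<exists>y. bil J x y \<noteq> 0))"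

lemma symplectic_self: "symplectic J \<Longrightarrow> bil J x x = 0"
  by (simp add: symplectic_def)

lemma symplectic_swap:
  assumes "symplectic J" shows "bil J x y = - bil J y x"
proof -
  have "bil J (x + y) (x + y) = 0" using assms by (simp only: symplectic_def)
  then show ?thesis using assms
    by (simp add: symplectic_self bil_add_left bil_add_right eq_neg_iff_add_eq_0 add.commute)
qed

section \<open>Kobayashi's theorem on contact forms\<close>

text \<open>Taylor's formula with Cauchy's estimate for the second derivative. What matters is that the
  constant depends on \<open>h\<close> only through its bound \<open>M\<close>.\<close>

lemma second_order_bound:
  fixes h :: "complex \<Rightarrow> complex"
  assumes "h holomorphic_on ball 0 R" "R > 0" "\<And>s. s \<in> ball 0 R \<Longrightarrow> norm (h s) \<le> M" "norm s \<le> R / 3"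
  shows "norm (h s - h 0 - deriv h 0 * s) \<le> (2 * M / (R/3)^2) * norm s ^ 2"
proof -
  let ?S = "cball 0 (R/3) :: complex set"
  have sub: "?S \<subseteq> ball 0 R" using assms(2) by auto
  have "norm ((deriv ^^ 0) h s - (\<Sum>i\<le>1. (deriv ^^ i) h 0 * (s - 0) ^ i / fact i))
      \<le> (2 * M / (R/3)^2) * norm (s - 0) ^ (Suc 1) / fact 1"
  proof (rule complex_Taylor[where S = ?S])
    fix i x assume "x \<in> ?S" "i \<le> (1::nat)"
    have "(deriv ^^ i) h holomorphic_on ball 0 R" by (rule holomorphic_higher_deriv) (use assms in auto)
    moreover have "x \<in> ball 0 R" using sub \<open>x \<in> ?S\<close> by blast
    ultimately have "((deriv ^^ i) h has_field_derivative (deriv ^^ Suc i) h x) (at x)"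
      using holomorphic_derivI open_ball by fastforce
    then show "((deriv ^^ i) h has_field_derivative (deriv ^^ Suc i) h x) (at x within ?S)"
      by (rule has_field_derivative_at_within)
  next
    fix x assume x: "x \<in> ?S"
    have sub2: "cball x (R/3) \<subseteq> ball 0 R"
    proof
      fix y assume "y \<in> cball x (R/3)"
      hence "norm y \<le> R/3 + R/3" using x norm_triangle_ineq[of x "y - x"] by (auto simp: dist_norm norm_minus_commute)
      then show "y \<in> ball 0 R" using assms(2) by simp
    qed
    have "norm ((deriv ^^ 2) h x) \<le> fact 2 * M / (R/3)^2"
    proof (rule Cauchy_inequality)
      show "h holomorphic_on ball x (R/3)" using sub2 assms(1) ball_subset_cball holomorphic_on_subset by blast
      show "continuous_on (cball x (R/3)) h"
        using sub2 assms(1) holomorphic_on_imp_continuous_on holomorphic_on_subset by blast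
      show "norm (h y) \<le> M" if "norm (x - y) = R/3" for y
        using sub2 assms(3) that by (metis dist_norm in_mono mem_cball order_refl)
    qed (use assms in auto)
    then show "norm ((deriv ^^ Suc 1) h x) \<le> 2 * M / (R/3)^2" by (simp add: numeral_2_eq_2)
  qed (use assms in auto)
  then show ?thesis by (simp add: diff_diff_eq power2_eq_square)
qed

lemma hol_on_frechet:
  assumes "hol_on \<phi> S" "x \<in> S"
  shows "(\<phi> has_derivative frechet_derivative \<phi> (at x)) (at x)"
    and "frechet_derivative \<phi> (at x) (c *s v) = c * frechet_derivative \<phi> (at x) v"
  using assms unfolding hol_on_def by (metis frechet_derivative_at)+

lemma has_derivative_affine_line:
  "((\<lambda>t::complex. x + t *s y) has_derivative (\<lambda>h. h *s (y :: complex^'n))) (at t)"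
proof -
  have "linear (\<lambda>h::complex. h *s y)"
    by (rule linearI) (auto simp: vec_eq_iff algebra_simps)
  hence "((\<lambda>h::complex. h *s y) has_derivative (\<lambda>h. h *s y)) (at t)"
    by (simp add: bounded_linear_imp_has_derivative linear_linear)
  then show ?thesis by (auto intro!: derivative_eq_intros)
qed

lemma continuous_affine_line: "continuous_on T (\<lambda>t::complex. x + t *s (y :: complex^'n))"
  by (intro continuous_at_imp_continuous_on ballI)
    (rule has_derivative_continuous[OF has_derivative_affine_line])

lemma open_line_preimage: "open S \<Longrightarrow> open {t::complex. x + t *s (y :: complex^'n) \<in> S}"
  using continuous_affine_line[of UNIV x y] by (auto simp: continuous_on_open_vimage vimage_def)

lemma hol_on_line_derivative:
  assumes "hol_on \<phi> S" "x + t *s y \<in> S"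
  shows "((\<lambda>t. \<phi> (x + t *s y)) has_field_derivative frechet_derivative \<phi> (at (x + t *s y)) y) (at t)"
proof -
  have "(\<phi> \<circ> (\<lambda>t. x + t *s y) has_derivative
      frechet_derivative \<phi> (at (x + t *s y)) \<circ> (\<lambda>h. h *s y)) (at t)"
    by (rule diff_chain_at) (use assms hol_on_frechet has_derivative_affine_line in auto)
  moreover have "frechet_derivative \<phi> (at (x + t *s y)) \<circ> (\<lambda>h. h *s y) =
      (*) (frechet_derivative \<phi> (at (x + t *s y)) y)"
    using hol_on_frechet(2)[OF assms] by (auto simp: mult.commute)
  ultimately show ?thesis by (simp add: has_field_derivative_def o_def)
qed

lemma hol_on_line_holomorphic:
  assumes "hol_on \<phi> S" 
  shows "(\<lambda>t. \<phi> (x + t *s y)) holomorphic_on {t. x + t *s y \<in> S}"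
  unfolding holomorphic_on_def field_differentiable_def
  using hol_on_line_derivative[OF assms] has_field_derivative_at_within by blast

lemma hol_on_continuous: "hol_on \<phi> S \<Longrightarrow> continuous_on S \<phi>"
  by (meson continuous_at_imp_continuous_on has_derivative_continuous hol_on_frechet(1))

text \<open>Cauchy's estimate in the direction \<open>v\<close> makes the difference quotients in this direction
  converge uniformly along a line, so their limit is again holomorphic there.\<close>

lemma hol_on_partial_line_holomorphic:
  assumes "open S" "hol_on \<phi> S"
  shows "(\<lambda>t. frechet_derivative \<phi> (at (x + t *s y)) v) holomorphic_on {t. x + t *s y \<in> S}"
proof -
  let ?D = "\<lambda>t. frechet_derivative \<phi> (at (x + t *s y)) v"
  let ?T = "{t. x + t *s y \<in> S}"
  have "?D analytic_on {t0}" if t0: "t0 \<in> ?T" for t0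
  proof -
    define \<Phi> where "\<Phi> = (\<lambda>p::complex \<times> complex. (x + fst p *s y) + snd p *s v)"
    have cont: "continuous_on UNIV \<Phi>"
    proof -
      have "continuous_on UNIV (\<lambda>p::complex \<times> complex. x + fst p *s y)"
        by (rule continuous_on_compose2[OF continuous_affine_line[of UNIV]]) (auto intro: continuous_intros)
      moreover have "continuous_on UNIV (\<lambda>p::complex \<times> complex. 0 + snd p *s v)"
        by (rule continuous_on_compose2[OF continuous_affine_line[of UNIV]]) (auto intro: continuous_intros)
      ultimately show ?thesis unfolding \<Phi>_def by (simp add: continuous_on_add)
    qed
    hence "open (\<Phi> -` S)" using assms(1) continuous_open_vimage by (metis continuous_on_eq_continuous_at open_UNIV continuous_on_open_vimage Int_UNIV_right)
    moreover have "(t0, 0) \<in> \<Phi> -` S" using t0 by (simp add: \<Phi>_def)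
    ultimately obtain A B where AB: "open A" "open B" "(t0, 0) \<in> A \<times> B" "A \<times> B \<subseteq> \<Phi> -` S"
      by (rule open_prod_elim)
    obtain r1 where r1: "r1 > 0" "cball t0 r1 \<subseteq> A" using AB open_contains_cball by (metis mem_Sigma_iff)
    obtain R where R: "R > 0" "cball 0 R \<subseteq> B" using AB open_contains_cball by (metis mem_Sigma_iff)
    define K where "K = cball t0 r1 \<times> cball (0::complex) R"
    have KS: "\<Phi> ` K \<subseteq> S" using r1 R AB unfolding K_def by blast
    have "compact K" unfolding K_def by (intro compact_Times compact_cball)
    hence "compact (\<Phi> ` K)" using cont continuous_on_subset compact_continuous_image by blast
    hence "compact (\<phi> ` \<Phi> ` K)"
      using KS hol_on_continuous[OF assms(2)] continuous_on_subset compact_continuous_image by blast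
    then obtain M where M: "\<forall>p\<in>K. norm (\<phi> (\<Phi> p)) \<le> M"
      by (auto dest!: compact_imp_bounded simp: bounded_iff)
    define s where "s = (\<lambda>n. complex_of_real (R / real (n + 3)))"
    have s: "s n \<noteq> 0" "norm (s n) \<le> R / 3" for n
    proof -
      have "norm (s n) = R / real (n + 3)" using R unfolding s_def norm_of_real by simp
      moreover have "R / real (n + 3) \<le> R / 3" by (rule divide_left_mono) (use R in auto)
      moreover have "R / real (n + 3) \<noteq> 0" using R by simp
      ultimately show "s n \<noteq> 0" "norm (s n) \<le> R / 3" by auto
    qed
    define C where "C = 2 * M / (R/3)^2"
    have est: "norm ((\<phi> (\<Phi> (t, s n)) - \<phi> (\<Phi> (t, 0))) / s n - ?D t) \<le> C * norm (s n)"
      if t: "t \<in> cball t0 r1" for t n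
    proof -
      define h where "h = (\<lambda>s. \<phi> ((x + t *s y) + s *s v))"
      have inS: "(x + t *s y) + s *s v \<in> S" if "s \<in> ball 0 R" for s
      proof -
        have "(t, s) \<in> K" using t that by (auto simp: K_def)
        then show ?thesis using KS by (auto simp: \<Phi>_def)
      qed
      have hol: "h holomorphic_on ball 0 R"
        unfolding h_def using hol_on_line_holomorphic[OF assms(2)] inS holomorphic_on_subset by blast
      have "(h has_field_derivative frechet_derivative \<phi> (at ((x + t *s y) + 0 *s v)) v) (at 0)"
        unfolding h_def using hol_on_line_derivative[OF assms(2), of "x + t *s y" 0 v] inS[of 0] R by simp
      hence d: "deriv h 0 = ?D t" by (simp add: DERIV_imp_deriv)
      have "norm (h (s n) - h 0 - deriv h 0 * s n) \<le> C * norm (s n) ^ 2"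
        unfolding C_def
      proof (rule second_order_bound[OF hol])
        show "norm (h s) \<le> M" if "s \<in> ball 0 R" for s
          using M[rule_format, of "(t, s)"] that t by (auto simp: K_def \<Phi>_def h_def)
      qed (use R s in auto)
      moreover have "(\<phi> (\<Phi> (t, s n)) - \<phi> (\<Phi> (t, 0))) / s n - ?D t = (h (s n) - h 0 - deriv h 0 * s n) / s n"
        using s[of n] unfolding d[symmetric] by (simp add: h_def \<Phi>_def diff_divide_distrib)
      ultimately show ?thesis
        using s[of n] by (simp add: norm_divide divide_le_eq power2_eq_square mult.assoc)
    qed
    have slim: "(\<lambda>n. C * norm (s n)) \<longlonglongrightarrow> 0"
    proof -
      have "(\<lambda>n. R / real (n + 3)) \<longlonglongrightarrow> 0"
        by (rule LIMSEQ_ignore_initial_segment[OF lim_const_over_n])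
      hence "(\<lambda>n. norm (s n)) \<longlonglongrightarrow> 0" using R unfolding s_def norm_of_real by simp
      then show ?thesis by (rule tendsto_mult_right_zero)
    qed
    have "?D holomorphic_on ball t0 r1"
    proof (rule holomorphic_uniform_sequence[where f = "\<lambda>n t. (\<phi> (\<Phi> (t, s n)) - \<phi> (\<Phi> (t, 0))) / s n"])
      fix n
      have inS: "\<Phi> (t, s') \<in> S" if "t \<in> ball t0 r1" "norm s' \<le> R" for t s'
        using KS that by (auto simp: K_def)
      have *: "(\<lambda>t. \<phi> (\<Phi> (t, s'))) holomorphic_on ball t0 r1" if "norm s' \<le> R" for s'
      proof -
        have "(\<lambda>t. \<phi> ((x + s' *s v) + t *s y)) holomorphic_on {t. (x + s' *s v) + t *s y \<in> S}"
          by (rule hol_on_line_holomorphic[OF assms(2)])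
        moreover have "\<Phi> (t, s') = (x + s' *s v) + t *s y" for t by (simp add: \<Phi>_def algebra_simps)
        ultimately show ?thesis using inS[OF _ that] by (auto elim: holomorphic_on_subset)
      qed
      have "norm (s n) \<le> R" using s(2)[of n] R by simp
      then show "(\<lambda>t. (\<phi> (\<Phi> (t, s n)) - \<phi> (\<Phi> (t, 0))) / s n) holomorphic_on ball t0 r1"
        using * R by (intro holomorphic_intros) (auto simp: s)
    next
      fix t assume "t \<in> ball t0 r1"
      then obtain d where d: "d > 0" "cball t d \<subseteq> ball t0 r1" using open_contains_cball open_ball by metis
      have "uniform_limit (cball t d) (\<lambda>n t. (\<phi> (\<Phi> (t, s n)) - \<phi> (\<Phi> (t, 0))) / s n) ?D sequentially"
      proof (rule uniform_limitI)
        fix e :: real assume "e > 0"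
        hence "eventually (\<lambda>n. C * norm (s n) < e) sequentially" using slim order_tendstoD(2) by blast
        then show "\<forall>\<^sub>F n in sequentially. \<forall>t\<in>cball t d. dist ((\<phi> (\<Phi> (t, s n)) - \<phi> (\<Phi> (t, 0))) / s n) (?D t) < e"
        proof eventually_elim
          case (elim n)
          then show ?case using est d(2) unfolding dist_norm
            by (meson ball_subset_cball in_mono order_le_less_trans)
        qed
      qed
      with d show "\<exists>d>0. cball t d \<subseteq> ball t0 r1 \<and>
          uniform_limit (cball t d) (\<lambda>n t. (\<phi> (\<Phi> (t, s n)) - \<phi> (\<Phi> (t, 0))) / s n) ?D sequentially" by blast
    qed auto
    then show ?thesis using r1 analytic_at by (meson centre_in_ball open_ball)
  qed
  hence "?D analytic_on ?T" using analytic_on_analytic_at by blast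
  then show ?thesis by (rule analytic_imp_holomorphic)
qed

text \<open>The entry in row \<open>k\<close>, column \<open>j\<close> is the complex partial derivative of the \<open>k\<close>-th component in
  the \<open>j\<close>-th coordinate.\<close>

definition jacobian :: "(complex^4 \<Rightarrow> complex^4) \<Rightarrow> complex^4 \<Rightarrow> complex^4^4"
  where "jacobian \<alpha> x = (\<chi> k j. frechet_derivative (\<lambda>x. \<alpha> x $ k) (at x) (axis j 1))"

lemma hol_on_frechet_axis:
  fixes \<phi> :: "complex^'n \<Rightarrow> complex"
  assumes "hol_on \<phi> S" "x \<in> S"
  shows "frechet_derivative \<phi> (at x) v = (\<Sum>j\<in>UNIV. frechet_derivative \<phi> (at x) (axis j 1) * v $ j)"
proof -
  let ?L = "frechet_derivative \<phi> (at x)"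
  have lin: "linear ?L" using hol_on_frechet(1)[OF assms] has_derivative_linear by blast
  have "?L v = ?L (\<Sum>j\<in>UNIV. v $ j *s axis j 1)" by (simp add: basis_expansion)
  also have "\<dots> = (\<Sum>j\<in>UNIV. ?L (v $ j *s axis j 1))" using lin by (rule linear_sum)
  finally show ?thesis by (simp add: hol_on_frechet(2)[OF assms] mult.commute)
qed

lemma frechet_eq_jac:
  fixes \<alpha> :: "complex^4 \<Rightarrow> complex^4"
  assumes "\<And>k. hol_on (\<lambda>x. \<alpha> x $ k) S" "x \<in> S"
  shows "frechet_derivative (\<lambda>x. \<alpha> x $ k) (at x) v = (jacobian \<alpha> x *v v) $ k"
  using hol_on_frechet_axis[OF assms(1) assms(2), of k v]
  by (simp add: jacobian_def matrix_vector_mult_def)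

lemma has_derivative_jac:
  fixes \<alpha> :: "complex^4 \<Rightarrow> complex^4"
  assumes "\<And>k. hol_on (\<lambda>x. \<alpha> x $ k) S" "x \<in> S"
  shows "(\<alpha> has_derivative (\<lambda>v. jacobian \<alpha> x *v v)) (at x)"
proof -
  have "((\<lambda>x. \<Sum>k\<in>UNIV. 0 + \<alpha> x $ k *s axis k 1) has_derivative
      (\<lambda>v. \<Sum>k\<in>UNIV. (jacobian \<alpha> x *v v) $ k *s axis k 1)) (at x)"
  proof (rule has_derivative_sum)
    fix k :: 4
    have "((\<lambda>x. \<alpha> x $ k) has_derivative (\<lambda>v. (jacobian \<alpha> x *v v) $ k)) (at x)"
      using hol_on_frechet(1)[OF assms(1) assms(2), of k]
      unfolding frechet_eq_jac[OF assms, of k, THEN ext[of "frechet_derivative _ _"]] .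
    from diff_chain_at[OF this has_derivative_affine_line[of 0 "axis k 1"]]
    show "((\<lambda>x. 0 + \<alpha> x $ k *s axis k 1) has_derivative (\<lambda>v. (jacobian \<alpha> x *v v) $ k *s axis k 1)) (at x)"
      by (simp add: o_def)
  qed
  then show ?thesis by (simp add: basis_expansion)
qed

lemma ext_deriv_jac:
  fixes \<alpha> :: "complex^4 \<Rightarrow> complex^4"
  assumes "\<And>k. hol_on (\<lambda>x. \<alpha> x $ k) S" "x \<in> S"
  shows "ext_deriv \<alpha> x u v = pairing (jacobian \<alpha> x *v u) v - pairing (jacobian \<alpha> x *v v) u"
  using has_derivative_jac[OF assms] unfolding ext_deriv_def by (metis frechet_derivative_at)

lemma cone_scale: "x \<in> cone S \<Longrightarrow> c \<noteq> 0 \<Longrightarrow> c *s x \<in> cone S"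
  by (simp add: cone_def proj_pt_scale)

lemma hol_1form_on_scale:
  assumes "hol_1form_on \<alpha> S" "x \<in> cone S" "c \<noteq> 0"
  shows "\<alpha> (c *s x) = inverse c *s \<alpha> x"
proof -
  have "inverse c *s (c *s \<alpha> (c *s x)) = inverse c *s \<alpha> x" using assms by (simp add: hol_1form_on_def)
  then show ?thesis using assms(3) by simp
qed

text \<open>Identities for the Jacobian are obtained by computing a derivative along a line from another
  expression for the form on a neighbourhood of the point.\<close>

lemma line_deriv_unique:
  fixes \<alpha> :: "complex^4 \<Rightarrow> complex^4"
  assumes "\<And>k. hol_on (\<lambda>x. \<alpha> x $ k) S" "x \<in> S" "open T" "0 \<in> T"
    and "(f has_field_derivative d) (at 0)" "\<And>t. t \<in> T \<Longrightarrow> \<alpha> (x + t *s v) $ k = f t"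
  shows "(jacobian \<alpha> x *v v) $ k = d"
proof -
  have "((\<lambda>t. \<alpha> (x + t *s v) $ k) has_field_derivative (jacobian \<alpha> x *v v) $ k) (at 0)"
    using hol_on_line_derivative[OF assms(1), of x 0 v k] assms(2) by (simp add: frechet_eq_jac[OF assms(1)])
  moreover have "((\<lambda>t. \<alpha> (x + t *s v) $ k) has_field_derivative d) (at 0)"
    by (rule has_field_derivative_transform_within_open[OF assms(5,3,4)]) (simp add: assms(6))
  ultimately show ?thesis by (rule DERIV_unique)
qed

text \<open>Euler's identity, as the components of a pulled back 1-form are homogeneous of degree \<open>-1\<close>.\<close>

lemma jacobian_euler:
  assumes "hol_1form_on \<alpha> S" "x \<in> cone S"
  shows "(jacobian \<alpha> x *v x) $ k = - \<alpha> x $ k"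
proof (rule line_deriv_unique)
  show "hol_on (\<lambda>x. \<alpha> x $ k) (cone S)" for k using assms by (simp add: hol_1form_on_def)
  show "open (- {-1 :: complex})" "(0::complex) \<in> - {-1}" by auto
  show "((\<lambda>t. \<alpha> x $ k / (1 + t)) has_field_derivative - \<alpha> x $ k) (at 0)"
    by (auto intro!: derivative_eq_intros)
  fix t :: complex assume t: "t \<in> - {-1}"
  have "x + t *s x = (1 + t) *s x" by (simp add: vec_eq_iff algebra_simps)
  moreover have "1 + t \<noteq> 0" using t by (metis ComplD add.commute add_eq_0_iff singletonI)
  ultimately have "\<alpha> (x + t *s x) = inverse (1 + t) *s \<alpha> x"
    using hol_1form_on_scale[OF assms, of "1 + t"] by metis
  then show "\<alpha> (x + t *s x) $ k = \<alpha> x $ k / (1 + t)"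
    by (simp only: vector_smult_component divide_inverse mult.commute)
qed fact

text \<open>Differentiate the identity \<open>\<alpha>\<^sub>x(x) = 0\<close>.\<close>

lemma jacobian_euler_transposed:
  assumes "open (cone S)" "hol_1form_on \<alpha> S" "x \<in> cone S"
  shows "pairing (jacobian \<alpha> x *v v) x = - pairing (\<alpha> x) v"
proof -
  have hol: "\<And>k. hol_on (\<lambda>x. \<alpha> x $ k) (cone S)" using assms by (simp add: hol_1form_on_def)
  let ?T = "{t. x + t *s v \<in> cone S}"
  have T: "open ?T" "0 \<in> ?T" using open_line_preimage[OF assms(1)] assms(3) by auto
  have "((\<lambda>t. \<Sum>k\<in>UNIV. \<alpha> (x + t *s v) $ k * (x $ k + t * v $ k)) has_field_derivative
      (\<Sum>k\<in>UNIV. (jacobian \<alpha> x *v v) $ k * x $ k + v $ k * \<alpha> x $ k)) (at 0)"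
  proof (rule DERIV_sum)
    fix k :: 4
    have "((\<lambda>t. \<alpha> (x + t *s v) $ k) has_field_derivative (jacobian \<alpha> x *v v) $ k) (at 0)"
      using hol_on_line_derivative[OF hol, of x 0 v k] assms(3) by (simp add: frechet_eq_jac[OF hol])
    moreover have "((\<lambda>t. x $ k + t * v $ k) has_field_derivative v $ k) (at 0)"
      by (auto intro!: derivative_eq_intros)
    ultimately show "((\<lambda>t. \<alpha> (x + t *s v) $ k * (x $ k + t * v $ k)) has_field_derivative
      (jacobian \<alpha> x *v v) $ k * x $ k + v $ k * \<alpha> x $ k) (at 0)"
      using DERIV_mult by fastforce
  qed
  moreover have "((\<lambda>t. \<Sum>k\<in>UNIV. \<alpha> (x + t *s v) $ k * (x $ k + t * v $ k)) has_field_derivative 0) (at 0)"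
  proof (rule has_field_derivative_transform_within_open[OF _ T])
    show "((\<lambda>t. 0) has_field_derivative 0) (at (0::complex))" by simp
    fix t assume "t \<in> ?T"
    hence "pairing (\<alpha> (x + t *s v)) (x + t *s v) = 0" using assms(2) by (simp add: hol_1form_on_def)
    then show "0 = (\<Sum>k\<in>UNIV. \<alpha> (x + t *s v) $ k * (x $ k + t * v $ k))" by (simp add: pairing_def)
  qed
  ultimately have "(\<Sum>k\<in>UNIV. (jacobian \<alpha> x *v v) $ k * x $ k + v $ k * \<alpha> x $ k) = 0"
    by (rule DERIV_unique)
  then show ?thesis by (simp add: pairing_def sum.distrib eq_neg_iff_add_eq_0 mult.commute)
qed

lemma jacobian_scale:
  assumes "open (cone S)" "hol_1form_on \<alpha> S" "x \<in> cone S" "c \<noteq> 0"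
  shows "jacobian \<alpha> (c *s x) $ k $ j = jacobian \<alpha> x $ k $ j / c\<^sup>2"
proof -
  let ?v = "axis j 1 :: complex^4"
  have hol: "\<And>k. hol_on (\<lambda>x. \<alpha> x $ k) (cone S)" using assms by (simp add: hol_1form_on_def)
  let ?T = "{t. c *s x + t *s ?v \<in> cone S}"
  have "(jacobian \<alpha> (c *s x) *v ?v) $ k = (jacobian \<alpha> x *v ?v) $ k / c\<^sup>2"
  proof (rule line_deriv_unique[OF hol])
    show "c *s x \<in> cone S" using assms cone_scale by blast
    then show "open ?T" "0 \<in> ?T" using open_line_preimage[OF assms(1)] by auto
    have "((\<lambda>t. \<alpha> (x + t *s ?v) $ k) has_field_derivative (jacobian \<alpha> x *v ?v) $ k) (at (0 / c))"
      using hol_on_line_derivative[OF hol, of x 0 ?v k] assms(3) by (simp add: frechet_eq_jac[OF hol])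
    moreover have "((\<lambda>t. t / c) has_field_derivative 1 / c) (at 0)"
      by (rule DERIV_cdivide[OF DERIV_ident])
    ultimately have "((\<lambda>t. \<alpha> (x + (t / c) *s ?v) $ k) has_field_derivative (jacobian \<alpha> x *v ?v) $ k * (1 / c)) (at 0)"
      by (rule DERIV_chain2)
    from DERIV_cmult[OF this, of "inverse c"]
    show "((\<lambda>t. inverse c * \<alpha> (x + (t / c) *s ?v) $ k) has_field_derivative (jacobian \<alpha> x *v ?v) $ k / c\<^sup>2) (at 0)"
      by (simp add: power2_eq_square field_simps)
    fix t assume t: "t \<in> ?T"
    have eq: "c *s x + t *s ?v = c *s (x + (t / c) *s ?v)" "x + (t / c) *s ?v = inverse c *s (c *s x + t *s ?v)"
      using assms(4) by (auto simp: vec_eq_iff field_simps)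
    hence "x + (t / c) *s ?v \<in> cone S" using t assms(4) cone_scale by (metis inverse_nonzero_iff_nonzero mem_Collect_eq)
    then show "\<alpha> (c *s x + t *s ?v) $ k = inverse c * \<alpha> (x + (t / c) *s ?v) $ k"
      using hol_1form_on_scale[OF assms(2) _ assms(4)] by (metis eq(1) vector_smult_component)
  qed
  then show ?thesis by (simp add: matrix_vector_mult_def axis_def if_distrib cong: if_cong)
qed

definition curl :: "(complex^4 \<Rightarrow> complex^4) \<Rightarrow> complex^4 \<Rightarrow> complex^4^4"
  where "curl \<alpha> x = (\<chi> j k. jacobian \<alpha> x $ k $ j - jacobian \<alpha> x $ j $ k)"

definition wedge_coeff :: "complex^4 \<Rightarrow> complex^4^4 \<Rightarrow> 4 \<Rightarrow> 4 \<Rightarrow> 4 \<Rightarrow> complex"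
  where "wedge_coeff a \<Omega> i j k = a $ i * \<Omega> $ j $ k + a $ j * \<Omega> $ k $ i + a $ k * \<Omega> $ i $ j"

text \<open>A 3-form on a four-dimensional space is the contraction of the volume form with a vector. For the
  3-form \<open>a \<and> \<Omega>\<close> this is that vector; its entries are, up to sign, the coefficients of the 3-form.\<close>

definition wedge_vec :: "complex^4 \<Rightarrow> complex^4^4 \<Rightarrow> complex^4"
  where "wedge_vec a \<Omega> = (\<chi> i. if i = 1 then wedge_coeff a \<Omega> 2 3 4 else if i = 2 then - wedge_coeff a \<Omega> 1 3 4
    else if i = 3 then wedge_coeff a \<Omega> 1 2 4 else - wedge_coeff a \<Omega> 1 2 3)"

lemma wedge_vec_simps:
  "wedge_vec a \<Omega> $ 1 = wedge_coeff a \<Omega> 2 3 4" "wedge_vec a \<Omega> $ 2 = - wedge_coeff a \<Omega> 1 3 4"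
  "wedge_vec a \<Omega> $ 3 = wedge_coeff a \<Omega> 1 2 4" "wedge_vec a \<Omega> $ 4 = - wedge_coeff a \<Omega> 1 2 3"
  by (simp_all add: wedge_vec_def)

text \<open>If \<open>x\<close> annihilates both \<open>a\<close> and \<open>\<Omega>\<close>, it annihilates \<open>a \<and> \<Omega>\<close>, so it is proportional to the
  vector representing this 3-form.\<close>

lemma wedge_vec_parallel:
  fixes a x :: "complex^4" and \<Omega> :: "complex^4^4"
  assumes "\<And>j k. \<Omega> $ j $ k = - (\<Omega> $ k $ j)" "pairing a x = 0" "\<And>k. (\<Sum>j\<in>UNIV. x $ j * \<Omega> $ j $ k) = 0"
  shows "wedge_vec a \<Omega> $ i * x $ l = wedge_vec a \<Omega> $ l * x $ i"
proof -
  have 0: "\<Omega> $ i $ i = 0" for i using assms(1)[of i i] by simp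
  note eqs = assms(3)[of 1] assms(3)[of 2] assms(3)[of 3] assms(3)[of 4] assms(2)
  note skew = assms(1)[of 2 1] assms(1)[of 3 1] assms(1)[of 3 2] assms(1)[of 4 1] assms(1)[of 4 2] assms(1)[of 4 3]
  have "\<forall>i l. wedge_vec a \<Omega> $ i * x $ l = wedge_vec a \<Omega> $ l * x $ i"
    unfolding forall_4 wedge_vec_simps wedge_coeff_def
    using eqs unfolding sum_4 pairing_def skew 0
    by (intro conjI) (simp | algebra)+
  then show ?thesis by blast
qed

lemma wedge_eq_0_if_wedge_vec_eq_0:
  fixes a :: "complex^4" and \<Omega> :: "complex^4^4"
  assumes "\<And>j k. \<Omega> $ j $ k = - (\<Omega> $ k $ j)" "wedge_vec a \<Omega> = 0"
  defines "B \<equiv> \<lambda>u v. \<Sum>j\<in>UNIV. \<Sum>k\<in>UNIV. \<Omega> $ j $ k * u $ j * v $ k"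
  shows "pairing a u * B v w + pairing a v * B w u + pairing a w * B u v = 0"
proof -
  have 0: "\<Omega> $ i $ i = 0" for i using assms(1)[of i i] by simp
  note skew = assms(1)[of 2 1] assms(1)[of 3 1] assms(1)[of 3 2] assms(1)[of 4 1] assms(1)[of 4 2] assms(1)[of 4 3]
  have "wedge_vec a \<Omega> $ 1 = 0" "wedge_vec a \<Omega> $ 2 = 0" "wedge_vec a \<Omega> $ 3 = 0" "wedge_vec a \<Omega> $ 4 = 0"
    using assms(2) by simp_all
  then show ?thesis unfolding B_def wedge_vec_simps wedge_coeff_def sum_4 pairing_def skew 0
    by algebra
qed

lemma jacobian_line_holomorphic:
  assumes "open S" "\<And>k. hol_on (\<lambda>x. \<alpha> x $ k) S"
  shows "(\<lambda>t. jacobian \<alpha> (x + t *s y) $ k $ j) holomorphic_on {t. x + t *s y \<in> S}"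
  unfolding jacobian_def using hol_on_partial_line_holomorphic[OF assms(1) assms(2)[of k]] by simp

definition contact_vec :: "(complex^4 \<Rightarrow> complex^4) \<Rightarrow> complex^4 \<Rightarrow> complex^4"
  where "contact_vec \<alpha> x = wedge_vec (\<alpha> x) (curl \<alpha> x)"

text \<open>The factor \<open>g\<close> in \<open>contact_vec \<alpha> x = g(x) x\<close>, read off with the linear form given by the
  conjugate of \<open>x\<close>, because this form does not vanish at \<open>x\<close>.\<close>

definition contact_density :: "(complex^4 \<Rightarrow> complex^4) \<Rightarrow> complex^4 \<Rightarrow> complex"
  where "contact_density \<alpha> x = pairing (\<chi> k. cnj (x $ k)) (contact_vec \<alpha> x) / pairing (\<chi> k. cnj (x $ k)) x"

definition contact_square :: "(complex^4 \<Rightarrow> complex^4) \<Rightarrow> complex^4 \<Rightarrow> complex^4 \<Rightarrow> complex"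
  where "contact_square \<alpha> x v = (pairing (\<alpha> x) v)\<^sup>2 / contact_density \<alpha> x"

lemma pairing_cnj_nonzero:
  fixes x :: "complex^4"
  assumes "x \<noteq> 0" shows "pairing (\<chi> k. cnj (x $ k)) x \<noteq> 0"
proof
  assume *: "pairing (\<chi> k. cnj (x $ k)) x = 0"
  have "pairing (\<chi> k. cnj (x $ k)) x = of_real (\<Sum>k\<in>UNIV. (cmod (x $ k))\<^sup>2)"
    by (simp add: pairing_def complex_norm_square mult.commute del: of_real_power)
  with * have "(\<Sum>k\<in>UNIV. (cmod (x $ k))\<^sup>2) = 0" by (metis of_real_eq_0_iff)
  hence "x = 0" by (simp add: sum_nonneg_eq_0_iff vec_eq_iff)
  with assms show False by simp
qed

context
  fixes \<alpha> S
  assumes op: "open (cone S)" and form: "hol_1form_on \<alpha> S"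
begin

lemma hol_component: "hol_on (\<lambda>x. \<alpha> x $ k) (cone S)"
  using form by (simp add: hol_1form_on_def)

text \<open>The Lie derivative of a form invariant under scaling, along the Euler field, is zero, and so is
  its contraction with this field. By Cartan's formula the contraction of \<open>d\<alpha>\<close> is then zero.\<close>

lemma curl_contract:
  assumes "x \<in> cone S"
  shows "(\<Sum>j\<in>UNIV. x $ j * curl \<alpha> x $ j $ k) = 0"
proof -
  have "(\<Sum>j\<in>UNIV. x $ j * curl \<alpha> x $ j $ k) = (jacobian \<alpha> x *v x) $ k - pairing (jacobian \<alpha> x *v axis k 1) x"
    by (simp add: curl_def matrix_vector_mult_def pairing_def axis_def algebra_simps sum_subtractf
        if_distrib cong: if_cong)
  then show ?thesis
    using jacobian_euler[OF form assms] jacobian_euler_transposed[OF op form assms] by (simp add: pairing_axis)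
qed

lemma contact_vec_parallel:
  assumes "x \<in> cone S"
  shows "contact_vec \<alpha> x $ i * x $ l = contact_vec \<alpha> x $ l * x $ i"
  unfolding contact_vec_def
proof (rule wedge_vec_parallel)
  show "pairing (\<alpha> x) x = 0" using form assms by (simp add: hol_1form_on_def)
qed (use curl_contract[OF assms] in \<open>auto simp: curl_def\<close>)

lemma contact_vec_density:
  assumes "x \<in> cone S"
  shows "contact_vec \<alpha> x = contact_density \<alpha> x *s x"
proof -
  have x: "x \<noteq> 0" using assms by (simp add: cone_def)
  have "pairing (\<chi> k. cnj (x $ k)) (contact_vec \<alpha> x) * x $ l = contact_vec \<alpha> x $ l * pairing (\<chi> k. cnj (x $ k)) x" for l
    unfolding pairing_def sum_distrib_left sum_distrib_right
    using contact_vec_parallel[OF assms] by (auto intro!: sum.cong simp: mult.assoc mult.left_commute)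
  then show ?thesis using pairing_cnj_nonzero[OF x] by (simp add: contact_density_def vec_eq_iff field_simps)
qed

lemma contact_density_nonzero:
  assumes "x \<in> cone S" "\<exists>u v w. wedge_deriv \<alpha> x u v w \<noteq> 0"
  shows "contact_density \<alpha> x \<noteq> 0"
proof
  assume "contact_density \<alpha> x = 0"
  hence 0: "wedge_vec (\<alpha> x) (curl \<alpha> x) = 0" using contact_vec_density[OF assms(1)] by (simp add: contact_vec_def)
  have ext: "ext_deriv \<alpha> x u v = (\<Sum>j\<in>UNIV. \<Sum>k\<in>UNIV. curl \<alpha> x $ j $ k * u $ j * v $ k)" for u v
  proof -
    have "ext_deriv \<alpha> x u v = pairing (jacobian \<alpha> x *v u) v - pairing (jacobian \<alpha> x *v v) u"
      by (rule ext_deriv_jac[OF hol_component assms(1)])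
    then show ?thesis
      by (simp add: pairing_def matrix_vector_mult_def sum_4 curl_def algebra_simps)
  qed
  have "wedge_deriv \<alpha> x u v w = 0" for u v w
    unfolding wedge_deriv_def ext
    by (rule wedge_eq_0_if_wedge_vec_eq_0[OF _ 0]) (simp add: curl_def)
  with assms(2) show False by blast
qed

text \<open>Here \<open>\<alpha>\<close> contributes degree \<open>-1\<close>, its derivatives degree \<open>-2\<close>, and the division by the
  vector \<open>x\<close> degree \<open>-1\<close>.\<close>

lemma contact_density_scale:
  assumes "x \<in> cone S" "c \<noteq> 0"
  shows "contact_density \<alpha> (c *s x) = contact_density \<alpha> x / c ^ 4"
proof -
  have cx: "c *s x \<in> cone S" using assms cone_scale by blast
  have "curl \<alpha> (c *s x) $ j $ k = curl \<alpha> x $ j $ k / c\<^sup>2" for j k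
    using jacobian_scale[OF op form assms] by (simp add: curl_def diff_divide_distrib)
  moreover have "\<alpha> (c *s x) $ k = \<alpha> x $ k / c" for k
    using hol_1form_on_scale[OF form assms] by (simp add: field_simps)
  ultimately have "wedge_coeff (\<alpha> (c *s x)) (curl \<alpha> (c *s x)) i j k = wedge_coeff (\<alpha> x) (curl \<alpha> x) i j k / c ^ 3" for i j k
    by (simp add: wedge_coeff_def power2_eq_square power3_eq_cube add_divide_distrib mult.assoc)
  hence "contact_vec \<alpha> (c *s x) $ k = contact_vec \<alpha> x $ k / c ^ 3" for k
    by (simp add: contact_vec_def wedge_vec_def)
  hence eq: "contact_density \<alpha> (c *s x) * (c * x $ k) = contact_density \<alpha> x * x $ k / c ^ 3" for k
    using contact_vec_density[OF cx] contact_vec_density[OF assms(1)] by (metis vector_smult_component)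
  obtain k where "x $ k \<noteq> 0" using assms(1) by (auto simp: cone_def vec_eq_iff)
  then show ?thesis using assms(2) eq[of k] by (simp add: field_simps power_Suc eval_nat_numeral)
qed

lemma contact_square_scale:
  assumes "x \<in> cone S" "c \<noteq> 0"
  shows "contact_square \<alpha> (c *s x) v = c\<^sup>2 * contact_square \<alpha> x v"
proof -
  have "(p / c)\<^sup>2 / (d / c ^ 4) = c\<^sup>2 * (p\<^sup>2 / d)" for p d
    using assms(2) by (cases "d = 0") (simp_all add: field_simps eval_nat_numeral)
  moreover have "pairing (\<alpha> (c *s x)) v = pairing (\<alpha> x) v / c"
    using hol_1form_on_scale[OF form assms] by (simp add: pairing_simps divide_inverse mult.commute)
  ultimately show ?thesis unfolding contact_square_def contact_density_scale[OF assms] by metis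
qed

lemma contact_square_shift:
  assumes "x \<in> cone S"
  shows "contact_square \<alpha> x (v + c *s x) = contact_square \<alpha> x v"
  using form assms by (simp add: contact_square_def pairing_simps hol_1form_on_def)

text \<open>The definition of the density involves conjugates; near a given point it is replaced by the
  quotient of two coordinates, which is holomorphic.\<close>

lemma contact_square_analytic:
  assumes "\<And>x. x \<in> cone S \<Longrightarrow> contact_density \<alpha> x \<noteq> 0" "x + t0 *s y \<in> cone S"
  shows "(\<lambda>t. contact_square \<alpha> (x + t *s y) v) analytic_on {t0}"
proof -
  obtain k where k: "(x + t0 *s y) $ k \<noteq> 0" using assms(2) by (auto simp: cone_def vec_eq_iff)
  define T where "T = {t. x + t *s y \<in> cone S} \<inter> {t. x $ k + t * y $ k \<noteq> 0}"
  have "open {t. x $ k + t * y $ k \<noteq> 0}"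
    by (intro open_Collect_neq continuous_intros)
  hence T: "open T" "t0 \<in> T" unfolding T_def using open_line_preimage[OF op] assms(2) k by auto
  have dens: "contact_vec \<alpha> (x + t *s y) $ k / (x $ k + t * y $ k) = contact_density \<alpha> (x + t *s y)" if "t \<in> T" for t
  proof -
    have "contact_vec \<alpha> (x + t *s y) $ k = contact_density \<alpha> (x + t *s y) * (x $ k + t * y $ k)"
      using that contact_vec_density[of "x + t *s y"]
      by (metis (mono_tags, lifting) IntD1 T_def mem_Collect_eq vector_add_component vector_smult_component)
    then show ?thesis using that by (simp add: T_def)
  qed
  have "(\<lambda>t. (\<Sum>k\<in>UNIV. \<alpha> (x + t *s y) $ k * v $ k)\<^sup>2 / (contact_vec \<alpha> (x + t *s y) $ k / (x $ k + t * y $ k))) holomorphic_on T"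
  proof (intro holomorphic_intros)
    have a: "(\<lambda>t. \<alpha> (x + t *s y) $ k) holomorphic_on T" for k
      using hol_on_line_holomorphic[OF hol_component] by (rule holomorphic_on_subset) (auto simp: T_def)
    then show "(\<lambda>t. \<alpha> (x + t *s y) $ k) holomorphic_on T" for k .
    have j: "(\<lambda>t. jacobian \<alpha> (x + t *s y) $ k $ j) holomorphic_on T" for k j
      using jacobian_line_holomorphic[OF op hol_component] by (rule holomorphic_on_subset) (auto simp: T_def)
    have "(\<lambda>t. wedge_coeff (\<alpha> (x + t *s y)) (curl \<alpha> (x + t *s y)) i j k) holomorphic_on T" for i j k
      unfolding wedge_coeff_def curl_def by (simp, intro holomorphic_intros a j)
    then show "(\<lambda>t. contact_vec \<alpha> (x + t *s y) $ k) holomorphic_on T"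
      unfolding contact_vec_def wedge_vec_def
      by (cases "k = 1"; cases "k = 2"; cases "k = 3") (auto intro: holomorphic_on_minus)
  next
    fix t assume "t \<in> T"
    then show "contact_vec \<alpha> (x + t *s y) $ k / (x $ k + t * y $ k) \<noteq> 0"
      using dens assms(1) by (simp add: T_def)
  qed (auto simp: T_def)
  hence "(\<lambda>t. contact_square \<alpha> (x + t *s y) v) holomorphic_on T"
    using dens by (simp add: contact_square_def pairing_def cong: holomorphic_cong)
  then show ?thesis using T analytic_at by blast
qed

end

lemma cone_Int: "cone (S \<inter> T) = cone S \<inter> cone T"
  by (auto simp: cone_def)

text \<open>In \<open>d(\<phi> \<alpha>) = d\<phi> \<and> \<alpha> + \<phi> d\<alpha>\<close> the first term dies in the product with \<open>\<phi> \<alpha>\<close>, so both the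
  3-form \<open>\<alpha> \<and> d\<alpha>\<close> and the square of \<open>\<alpha>\<close> are multiplied by \<open>\<phi>\<^sup>2\<close>.\<close>

lemma contact_square_transition:
  assumes "open (cone S)" "hol_1form_on \<alpha> S" "open (cone T)" "hol_1form_on \<beta> T"
    and x: "x \<in> cone (S \<inter> T)" and \<phi>: "hol_on \<phi> (cone (S \<inter> T))"
    and eq: "\<And>x. x \<in> cone (S \<inter> T) \<Longrightarrow> \<phi> x \<noteq> 0 \<and> \<phi> x *s \<alpha> x = \<beta> x"
  shows "contact_square \<beta> x v = contact_square \<alpha> x v"
proof -
  have op: "open (cone (S \<inter> T))" using assms(1,3) by (simp add: cone_Int open_Int)
  have xS: "x \<in> cone S" "x \<in> cone T" using x by (auto simp: cone_Int)
  have hol\<alpha>: "\<And>k. hol_on (\<lambda>x. \<alpha> x $ k) (cone S)" and hol\<beta>: "\<And>k. hol_on (\<lambda>x. \<beta> x $ k) (cone T)"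
    using assms by (auto simp: hol_1form_on_def)
  define d where "d = (\<lambda>j. frechet_derivative \<phi> (at x) (axis j 1))"
  have jacobian: "jacobian \<beta> x $ k $ j = d j * \<alpha> x $ k + jacobian \<alpha> x $ k $ j * \<phi> x" for k j
  proof -
    let ?v = "axis j 1 :: complex^4"
    let ?T = "{t. x + t *s ?v \<in> cone (S \<inter> T)}"
    have "(jacobian \<beta> x *v ?v) $ k = d j * \<alpha> x $ k + (jacobian \<alpha> x *v ?v) $ k * \<phi> x"
    proof (rule line_deriv_unique[OF hol\<beta> xS(2)])
      show "open ?T" "0 \<in> ?T" using open_line_preimage[OF op] x by auto
      have "((\<lambda>t. \<phi> (x + t *s ?v)) has_field_derivative d j) (at 0)"
        using hol_on_line_derivative[OF \<phi>, of x 0 ?v] x by (simp add: d_def)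
      moreover have "((\<lambda>t. \<alpha> (x + t *s ?v) $ k) has_field_derivative (jacobian \<alpha> x *v ?v) $ k) (at 0)"
        using hol_on_line_derivative[OF hol\<alpha>, of x 0 ?v k] xS by (simp add: frechet_eq_jac[OF hol\<alpha>])
      ultimately show "((\<lambda>t. \<phi> (x + t *s ?v) * \<alpha> (x + t *s ?v) $ k) has_field_derivative
          d j * \<alpha> x $ k + (jacobian \<alpha> x *v ?v) $ k * \<phi> x) (at 0)"
        using DERIV_mult by fastforce
      show "\<beta> (x + t *s ?v) $ k = \<phi> (x + t *s ?v) * \<alpha> (x + t *s ?v) $ k" if "t \<in> ?T" for t
        using eq that by (metis mem_Collect_eq vector_smult_component)
    qed
    then show ?thesis by (simp add: matrix_vector_mult_def axis_def if_distrib cong: if_cong)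
  qed
  have \<beta>: "\<beta> x $ k = \<phi> x * \<alpha> x $ k" for k using eq[OF x] by (metis vector_smult_component)
  have "wedge_coeff (\<beta> x) (curl \<beta> x) i j k = (\<phi> x)\<^sup>2 * wedge_coeff (\<alpha> x) (curl \<alpha> x) i j k" for i j k
    by (simp add: wedge_coeff_def curl_def jacobian \<beta> power2_eq_square algebra_simps)
  hence "contact_vec \<beta> x = (\<phi> x)\<^sup>2 *s contact_vec \<alpha> x"
    by (simp add: contact_vec_def wedge_vec_def vec_eq_iff)
  hence "contact_density \<beta> x = (\<phi> x)\<^sup>2 * contact_density \<alpha> x"
    by (simp add: contact_density_def pairing_simps)
  moreover have "pairing (\<beta> x) v = \<phi> x * pairing (\<alpha> x) v"
    using eq[OF x] by (metis pairing_scale_left)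
  ultimately show ?thesis using eq[OF x] by (simp add: contact_square_def power_mult_distrib)
qed

text \<open>Fix \<open>e\<close>. Polarization in the second argument turns \<open>ell(x)(e) ell(x)(y)\<close> into a combination of three
  values of the square; by symmetry these are quadratic forms in \<open>x\<close>. Its square is the product of the
  squares of two linear forms in \<open>x\<close>, so it is \<open>\<plusminus>\<close> the product of these linear forms, as the polynomial
  functions form a domain. Choosing the sign for each \<open>y\<close> gives \<open>\<mu>(y)\<close>, with
  \<open>ell(x)(e) ell(x)(y) = ell(e)(x) \<mu>(y)(x)\<close>. The left-hand side is linear in \<open>y\<close>, so \<open>\<mu>\<close> is
  linear after cancelling \<open>ell(e)\<close>.\<close>

lemma symmetric_squares_bilinear:
  fixes ell :: "complex^4 \<Rightarrow> complex^4"
  assumes sym: "\<And>x y. (pairing (ell x) y)\<^sup>2 = (pairing (ell y) x)\<^sup>2" and e: "ell e \<noteq> 0"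
  shows "\<exists>J. \<forall>x y. (pairing (ell x) y)\<^sup>2 = (bil J x y)\<^sup>2"
proof -
  define Q where "Q = (\<lambda>y x. pairing (ell x) e * pairing (ell x) y)"
  define l where "l = (\<lambda>y. pairing (ell y))"
  have Q_eq: "Q y = (\<lambda>x. (1/2) * ((l (e + y) x)\<^sup>2 - (l e x)\<^sup>2 - (l y x)\<^sup>2))" for y
  proof
    fix x
    have "2 * Q y x = (pairing (ell x) (e + y))\<^sup>2 - (pairing (ell x) e)\<^sup>2 - (pairing (ell x) y)\<^sup>2"
      by (simp add: Q_def pairing_simps power2_eq_square algebra_simps)
    then show "Q y x = (1/2) * ((l (e + y) x)\<^sup>2 - (l e x)\<^sup>2 - (l y x)\<^sup>2)"
      unfolding l_def sym[of "e + y" x] sym[of e x] sym[of y x] by (simp add: field_simps)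
  qed
  have l: "l y \<in> vec_polys" for y unfolding l_def by (rule vec_polys_pairing)
  have Q: "Q y \<in> vec_polys" for y
    unfolding Q_eq using l unfolding vec_polys_def by (intro poly_funs_intros) auto
  have Q2: "(Q y x)\<^sup>2 = (l e x * l y x)\<^sup>2" for x y
    unfolding Q_def l_def power_mult_distrib using sym by metis
  have l_ne: "\<not> (\<forall>x. l e x = 0)" using e pairing_eq_0_imp unfolding l_def by blast
  have "\<exists>m. (\<forall>x. Q y x = l e x * pairing m x) \<and> (\<forall>x. (pairing m x)\<^sup>2 = (l y x)\<^sup>2)" for y
  proof -
    have "(\<forall>x. Q y x - l e x * l y x = 0) \<or> (\<forall>x. Q y x + l e x * l y x = 0)"
    proof (rule vec_polys_mult_eq_0)
      show "(\<lambda>x. Q y x - l e x * l y x) \<in> vec_polys" "(\<lambda>x. Q y x + l e x * l y x) \<in> vec_polys"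
        using Q l unfolding vec_polys_def by (auto intro!: poly_funs_intros)
      show "(Q y x - l e x * l y x) * (Q y x + l e x * l y x) = 0" for x
        using Q2[of y x] by (simp add: algebra_simps power2_eq_square)
    qed
    then show ?thesis
    proof
      assume "\<forall>x. Q y x - l e x * l y x = 0"
      then show ?thesis by (intro exI[of _ "ell y"]) (simp add: l_def)
    next
      assume "\<forall>x. Q y x + l e x * l y x = 0"
      then show ?thesis
        by (intro exI[of _ "(-1) *s ell y"]) (simp only: l_def pairing_scale_left, simp add: eq_neg_iff_add_eq_0)
    qed
  qed
  then obtain \<mu> where \<mu>: "\<And>y x. Q y x = l e x * pairing (\<mu> y) x" "\<And>y x. (pairing (\<mu> y) x)\<^sup>2 = (l y x)\<^sup>2"
    by metis
  have cancel: "m = m'" if "\<And>x. l e x * pairing m x = l e x * pairing m' x" for m m'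
  proof -
    have "(\<forall>x. l e x = 0) \<or> (\<forall>x. pairing (m - m') x = 0)"
      by (rule vec_polys_mult_eq_0[OF l vec_polys_pairing]) (use that in \<open>simp add: pairing_simps algebra_simps\<close>)
    then show ?thesis using l_ne pairing_eq_0_imp[of "m - m'"] by auto
  qed
  have add: "\<mu> (y + y') = \<mu> y + \<mu> y'" for y y'
    by (rule cancel) (simp only: \<mu>(1)[symmetric] pairing_add_left distrib_left, simp add: Q_def pairing_simps algebra_simps)
  have scale: "\<mu> (c *s y) = c *s \<mu> y" for c y
  proof (rule cancel)
    fix x
    have "Q (c *s y) x = c * Q y x" by (simp add: Q_def pairing_simps)
    then show "l e x * pairing (\<mu> (c *s y)) x = l e x * pairing (c *s \<mu> y) x"
      by (simp add: \<mu>(1) pairing_simps)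
  qed
  define J where "J = transpose (matrix \<mu>)"
  have lin: "Vector_Spaces.linear (*s) (*s) \<mu>"
    by unfold_locales (auto simp: add scale vec.scale_right_distrib vec.scale_left_distrib)
  have "bil J x y = pairing (\<mu> y) x" for x y
  proof -
    have "bil J x y = (\<Sum>i\<in>UNIV. \<Sum>j\<in>UNIV. matrix \<mu> $ j $ i * x $ j * y $ i)"
      by (simp add: bil_def J_def pairing_def matrix_vector_mult_def transpose_def sum_distrib_right)
    also have "\<dots> = pairing (matrix \<mu> *v y) x"
      by (subst sum.swap) (simp add: pairing_def matrix_vector_mult_def sum_distrib_left sum_distrib_right algebra_simps)
    also have "matrix \<mu> *v y = \<mu> y" using matrix_works[OF lin] .
    finally show ?thesis .
  qed
  then show ?thesis using \<mu>(2) sym unfolding l_def by metis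
qed

text \<open>Kobayashi's theorem, as a statement on the contact distribution. The local forms are tied together
  by the function \<open>G\<close>, the square of the contact form divided by the density, which is the same in all
  charts; its symmetry follows from Liouville's theorem.\<close>

theorem contact_form_symplectic:
  assumes cf: "contact_form I A \<omega>"
  shows "\<exists>J. symplectic J \<and> (\<forall>i\<in>I. \<forall>x\<in>cone (A i). \<forall>v. pairing (\<omega> i x) v = 0 \<longleftrightarrow> bil J x v = 0)"
proof -
  have cov: "(\<Union>i\<in>I. A i) = CP" and op: "\<And>i. i \<in> I \<Longrightarrow> open (cone (A i))"
    and form: "\<And>i. i \<in> I \<Longrightarrow> hol_1form_on (\<omega> i) (A i)"
    and wedge: "\<And>i x. i \<in> I \<Longrightarrow> x \<in> cone (A i) \<Longrightarrow> \<exists>u v w. wedge_deriv (\<omega> i) x u v w \<noteq> 0"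
    using cf unfolding contact_form_def by auto
  obtain f where f: "\<And>i j. i \<in> I \<Longrightarrow> j \<in> I \<Longrightarrow> hol_on (\<lambda>x. f i j (proj_pt x)) (cone (A i \<inter> A j))"
    "\<And>i j x. i \<in> I \<Longrightarrow> j \<in> I \<Longrightarrow> x \<in> cone (A i \<inter> A j) \<Longrightarrow>
      f i j (proj_pt x) \<noteq> 0 \<and> f i j (proj_pt x) *s \<omega> i x = \<omega> j x"
    using cf unfolding contact_form_def by blast
  have dens: "contact_density (\<omega> i) x \<noteq> 0" if "i \<in> I" "x \<in> cone (A i)" for i x
    using contact_density_nonzero op form wedge that by blast
  have "\<exists>i. i \<in> I \<and> x \<in> cone (A i)" if "x \<noteq> 0" for x
    using that cov proj_pt_in_CP[OF that] by (auto simp: cone_def)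
  then obtain ix where ix: "\<And>x. x \<noteq> 0 \<Longrightarrow> ix x \<in> I" "\<And>x. x \<noteq> 0 \<Longrightarrow> x \<in> cone (A (ix x))"
    by metis
  define G where "G = (\<lambda>x. contact_square (\<omega> (ix x)) x)"
  have G: "G x v = contact_square (\<omega> i) x v" if "i \<in> I" "x \<in> cone (A i)" for i x v
  proof -
    have x: "x \<noteq> 0" using that by (simp add: cone_def)
    show ?thesis unfolding G_def
    proof (rule contact_square_transition)
      show "x \<in> cone (A i \<inter> A (ix x))" using that ix[OF x] by (simp add: cone_Int)
      show "hol_on (\<lambda>y. f i (ix x) (proj_pt y)) (cone (A i \<inter> A (ix x)))" by (rule f(1)[OF that(1) ix(1)[OF x]])
      show "f i (ix x) (proj_pt y) \<noteq> 0 \<and> f i (ix x) (proj_pt y) *s \<omega> i y = \<omega> (ix x) y"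
        if "y \<in> cone (A i \<inter> A (ix x))" for y
        using f(2)[OF \<open>i \<in> I\<close> ix(1)[OF x] that] .
    qed (use op form that ix(1)[OF x] in auto)
  qed
  have analytic: "(\<lambda>t. G (x + t *s y) v) analytic_on {t0}" if "x + t0 *s y \<noteq> 0" for x y v t0
  proof -
    let ?i = "ix (x + t0 *s y)"
    have i: "?i \<in> I" "x + t0 *s y \<in> cone (A ?i)" using ix that by auto
    have "(\<lambda>t. contact_square (\<omega> ?i) (x + t *s y) v) analytic_on {t0}"
      by (rule contact_square_analytic) (use i op form dens in auto)
    then obtain T where T: "open T" "t0 \<in> T" "(\<lambda>t. contact_square (\<omega> ?i) (x + t *s y) v) holomorphic_on T"
      using analytic_at by blast
    define T' where "T' = T \<inter> {t. x + t *s y \<in> cone (A ?i)}"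
    have "(\<lambda>t. G (x + t *s y) v) holomorphic_on T'"
    proof (rule holomorphic_transform)
      show "(\<lambda>t. contact_square (\<omega> ?i) (x + t *s y) v) holomorphic_on T'"
        using T(3) by (rule holomorphic_on_subset) (simp add: T'_def)
    qed (simp add: T'_def G[OF i(1)])
    moreover have "open T'" "t0 \<in> T'"
      unfolding T'_def using T i open_line_preimage[OF op[OF i(1)]] by auto
    ultimately show ?thesis using analytic_at by blast
  qed
  have Gself: "G x (c *s x) = 0" if "x \<noteq> 0" for x c
    using form[OF ix(1)[OF that]] ix(2)[OF that] by (simp add: G_def contact_square_def pairing_simps hol_1form_on_def)
  \<comment> \<open>Along the line through \<open>x\<close> and \<open>y\<close> the function \<open>q\<close> below is entire. In the other affine
    chart of this line it becomes \<open>r\<close>, which is finite at the point \<open>y\<close>, that is, at \<open>t = \<infinity>\<close>.\<close>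
  have Gsym: "G x y = G y x" if "x \<noteq> 0" "y \<noteq> 0" for x y
  proof (cases "\<exists>c. y = c *s x")
    case True
    then obtain c where c: "y = c *s x" by blast
    with that have "x = inverse c *s y" by auto
    then show ?thesis using c Gself that by metis
  next
    case False
    have ne1: "x + t *s y \<noteq> 0" for t
    proof
      assume *: "x + t *s y = 0"
      with that have "t \<noteq> 0" by auto
      have "y = (- inverse t) *s x"
      proof -
        have "inverse t *s (x + t *s y) = 0" using * by simp
        hence "inverse t *s x + y = 0" using \<open>t \<noteq> 0\<close> by (simp add: vec.scale_right_distrib)
        then show ?thesis by (simp add: add_eq_0_iff2 minus_unique)
      qed
      with False show False by blast
    qed
    have ne2: "y + s *s x \<noteq> 0" for s
    proof
      assume "y + s *s x = 0"
      hence "y = (- s) *s x" by (simp add: add_eq_0_iff2)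
      with False show False by blast
    qed
    let ?q = "\<lambda>t. G (x + t *s y) y" and ?r = "\<lambda>s. G (y + s *s x) x"
    have qr: "?q t = ?r (inverse t)" if "t \<noteq> 0" for t
    proof -
      let ?z = "y + inverse t *s x"
      have z: "?z \<noteq> 0" by (rule ne2)
      let ?i = "ix ?z"
      have i: "?i \<in> I" "?z \<in> cone (A ?i)" using ix z by auto
      have tz: "x + t *s y = t *s ?z" using that by (simp add: vec.scale_right_distrib add.commute)
      hence "x + t *s y \<in> cone (A ?i)" using i cone_scale that by metis
      hence "?q t = contact_square (\<omega> ?i) (t *s ?z) y" using G i tz by metis
      also have "\<dots> = t\<^sup>2 * contact_square (\<omega> ?i) ?z y"
        using contact_square_scale op form i that by blast
      also have "contact_square (\<omega> ?i) ?z y = contact_square (\<omega> ?i) ?z ((- inverse t) *s x + 1 *s ?z)"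
        by (simp add: vec.scale_right_distrib)
      also have "\<dots> = contact_square (\<omega> ?i) ?z ((- inverse t) *s x)"
        by (rule contact_square_shift) (use op form i in auto)
      also have "t\<^sup>2 * \<dots> = contact_square (\<omega> ?i) ?z x"
      proof -
        have "t\<^sup>2 * ((- inverse t)\<^sup>2 * a / d) = a / d" for a d
          using that by (simp add: field_simps)
        then show ?thesis unfolding contact_square_def pairing_scale_right power_mult_distrib .
      qed
      also have "\<dots> = ?r (inverse t)" using G i by metis
      finally show ?thesis .
    qed
    have "?q holomorphic_on UNIV"
      using analytic[OF ne1] analytic_on_analytic_at analytic_imp_holomorphic by blast
    moreover have "(?q \<longlongrightarrow> ?r 0) at_infinity"
    proof (rule Lim_transform_eventually)
      have "?r analytic_on {0}" by (rule analytic[OF ne2])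
      hence "isCont ?r 0" using analytic_at_imp_isCont by blast
      then show "((\<lambda>t. ?r (inverse t)) \<longlongrightarrow> ?r 0) at_infinity"
        by (rule isCont_tendsto_compose) (rule tendsto_inverse_0)
      have "eventually (\<lambda>t::complex. t \<noteq> 0) at_infinity"
        unfolding eventually_at_infinity by (rule exI[of _ 1]) auto
      then show "\<forall>\<^sub>F t in at_infinity. ?r (inverse t) = ?q t"
        by eventually_elim (use qr in simp)
    qed
    ultimately have "?q 0 = ?r 0" by (rule Liouville_weak)
    then show ?thesis by simp
  qed
  \<comment> \<open>The root of the density is chosen at each point separately.\<close>
  define ell where "ell = (\<lambda>x. if x = 0 then 0 else inverse (csqrt (contact_density (\<omega> (ix x)) x)) *s \<omega> (ix x) x)"
  have ell_G: "(pairing (ell x) v)\<^sup>2 = G x v" if "x \<noteq> 0" for x v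
    using that by (simp add: ell_def G_def contact_square_def pairing_simps power_mult_distrib power_inverse divide_inverse mult.commute)
  have ell_iff: "pairing (ell x) v = 0 \<longleftrightarrow> pairing (\<omega> i x) v = 0" if "i \<in> I" "x \<in> cone (A i)" for i x v
  proof -
    have "x \<noteq> 0" using that by (simp add: cone_def)
    have "pairing (ell x) v = 0 \<longleftrightarrow> contact_square (\<omega> i) x v = 0"
      using ell_G[OF \<open>x \<noteq> 0\<close>] G[OF that] by (metis zero_eq_power2)
    then show ?thesis using dens[OF that] by (simp add: contact_square_def)
  qed
  have ell_nz: "\<exists>v. pairing (ell x) v \<noteq> 0" if "x \<noteq> 0" for x
  proof (rule ccontr)
    assume "\<not> ?thesis"
    hence "\<And>v. pairing (\<omega> (ix x) x) v = 0" using ell_iff ix[OF that] by blast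
    hence "\<not> (\<exists>u v w. wedge_deriv (\<omega> (ix x)) x u v w \<noteq> 0)" by (simp add: wedge_deriv_def)
    then show False using wedge ix[OF that] by blast
  qed
  have "\<exists>J. \<forall>x y. (pairing (ell x) y)\<^sup>2 = (bil J x y)\<^sup>2"
  proof (rule symmetric_squares_bilinear)
    show "(pairing (ell x) y)\<^sup>2 = (pairing (ell y) x)\<^sup>2" for x y
    proof (cases "x = 0 \<or> y = 0")
      case True
      then show ?thesis by (auto simp: ell_def)
    next
      case False
      then show ?thesis using ell_G Gsym by simp
    qed
    have "axis 1 1 \<noteq> (0 :: complex^4)" by (simp add: axis_eq_0_iff)
    then show "ell (axis 1 1) \<noteq> 0" using ell_nz by (metis pairing_zero(2))
  qed
  then obtain J where J: "\<And>x y. (pairing (ell x) y)\<^sup>2 = (bil J x y)\<^sup>2" by blast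
  have J0: "pairing (ell x) y = 0 \<longleftrightarrow> bil J x y = 0" for x y using J by (metis zero_eq_power2)
  have "symplectic J" unfolding symplectic_def
  proof (intro conjI allI impI)
    show "bil J x x = 0" for x
      using ell_G[of x x] Gself[of x 1] J[of x x] by (cases "x = 0") auto
    show "\<exists>y. bil J x y \<noteq> 0" if "x \<noteq> 0" for x using ell_nz[OF that] J0 by blast
  qed
  then show ?thesis using ell_iff J0 by blast
qed

section \<open>The degree of a parametrized curve\<close>

text \<open>The affine coordinate on the projective line, with the point \<open>\<infinity>\<close> represented by \<open>(1, 0)\<close>.\<close>

definition aff :: "complex \<Rightarrow> complex^2"
  where "aff t = vector [t, 1]"

lemma aff_simps [simp]: "aff t $ 1 = t" "aff t $ 2 = 1" "aff t \<noteq> 0"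
  by (auto simp: aff_def vec_eq_iff forall_2)

lemma form_map_scale: "form_map m a (c *s w) = c ^ m *s form_map m a w"
proof -
  have "(c *s w) $ 1 ^ k * (c *s w) $ 2 ^ (m - k) = c ^ m * (w $ 1 ^ k * w $ 2 ^ (m - k))" if "k \<le> m" for k
    using that by (simp add: power_mult_distrib power_add[symmetric] mult.left_commute flip: mult.assoc)
  then show ?thesis unfolding form_map_def vec.scale_sum_right
    by (intro sum.cong) (auto simp: vector_smult_assoc)
qed

lemma form_map_infinity: "w $ 2 = 0 \<Longrightarrow> form_map m a w = w $ 1 ^ m *s a m"
proof -
  assume "w $ 2 = 0"
  hence "form_map m a w = (\<Sum>k\<le>m. if k = m then w $ 1 ^ m *s a m else 0)"
    unfolding form_map_def by (intro sum.cong) auto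
  then show ?thesis by simp
qed

lemma scale_aff: "w $ 2 \<noteq> 0 \<Longrightarrow> w = w $ 2 *s aff (w $ 1 / w $ 2)"
  by (simp add: vec_eq_iff forall_2)

lemma proj_pt_aff_inj: "proj_pt (aff s) = proj_pt (aff t) \<Longrightarrow> s = t"
  by (subst (asm) proj_pt_eq_iff) (auto simp: vec_eq_iff forall_2)

lemma in_plane_iff: "x \<noteq> 0 \<Longrightarrow> proj_pt x \<in> plane h \<longleftrightarrow> pairing h x = 0"
  using proj_pt_in_CP[of x] proj_pt_self[of x] unfolding plane_def
  by (auto simp: proj_pt_eq pairing_simps)

definition plane_section_poly :: "nat \<Rightarrow> (nat \<Rightarrow> complex^4) \<Rightarrow> complex^4 \<Rightarrow> complex poly"
  where "plane_section_poly m a h = (\<Sum>k\<le>m. monom (pairing h (a k)) k)"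

lemma poly_plane_section_poly: "poly (plane_section_poly m a h) t = pairing h (form_map m a (aff t))"
  by (simp add: plane_section_poly_def form_map_def poly_sum poly_monom pairing_sum_right pairing_simps mult.commute)

lemma plane_section_poly_line: "plane_section_poly m a (h + s *s h') = plane_section_poly m a h + smult s (plane_section_poly m a h')"
  by (intro poly_eqI)
    (simp add: plane_section_poly_def coeff_sum pairing_simps sum_distrib_left if_distrib sum.distrib cong: if_cong)

lemma coeff_slice_poly: "coeff (plane_section_poly m a h) m = pairing h (a m)"
  by (simp add: plane_section_poly_def coeff_sum)

lemma degree_slice_poly: "pairing h (a m) \<noteq> 0 \<Longrightarrow> degree (plane_section_poly m a h) = m"
proof (rule antisym)
  show "degree (plane_section_poly m a h) \<le> m"
    unfolding plane_section_poly_def by (intro degree_sum_le) (auto intro: order.trans[OF degree_monom_le])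
  show "m \<le> degree (plane_section_poly m a h)" if "pairing h (a m) \<noteq> 0"
    using that by (intro le_degree) (simp add: coeff_slice_poly)
qed

lemma card_roots_rsquarefree:
  fixes p :: "complex poly"
  assumes "rsquarefree p"
  shows "card {z. poly p z = 0} = degree p"
proof -
  have nz: "p \<noteq> 0" using assms by (auto simp: rsquarefree_def)
  have "degree p = degree (smult (lead_coeff p) (\<Prod>z | poly p z = 0. [:-z, 1:]))"
    using complex_poly_decompose_rsquarefree[OF assms] by simp
  also have "\<dots> = (\<Sum>z | poly p z = 0. degree [:-z, 1:])"
    using nz by (simp add: degree_prod_eq_sum_degree)
  finally show ?thesis by simp
qed

lemma avoid_finitely_many:
  assumes "finite V" "0 \<notin> V"
  shows "\<exists>h::complex^4. \<forall>v\<in>V. pairing h v \<noteq> 0"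
proof -
  have "(\<lambda>h. \<Prod>v\<in>V. pairing v h) \<in> vec_polys \<and> (\<exists>h. (\<Prod>v\<in>V. pairing v h) \<noteq> 0)"
    using assms
  proof (induction V)
    case empty
    then show ?case using poly_funs.const unfolding vec_polys_def by auto
  next
    case (insert v V)
    have "v \<noteq> 0" using insert by auto
    then obtain y where y: "pairing v y \<noteq> 0" using pairing_eq_0_imp by blast
    obtain x where x: "(\<Prod>v\<in>V. pairing v x) \<noteq> 0" "(\<lambda>h. \<Prod>v\<in>V. pairing v h) \<in> vec_polys" using insert by auto
    from vec_polys_common_nonzero[OF vec_polys_pairing x(2) y x(1)]
    obtain z where "pairing v z \<noteq> 0" "(\<Prod>v\<in>V. pairing v z) \<noteq> 0" by blast
    moreover have "(\<lambda>h. pairing v h * (\<Prod>v\<in>V. pairing v h)) \<in> vec_polys"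
      using vec_polys_pairing x(2) unfolding vec_polys_def by (intro poly_funs.mult)
    ultimately show ?case using insert by auto
  qed
  then obtain h where "(\<Prod>v\<in>V. pairing v h) \<noteq> 0" by blast
  then have "\<forall>v\<in>V. pairing v h \<noteq> 0" using assms(1) by auto
  then show ?thesis by (metis pairing_commute)
qed

text \<open>At a root of \<open>P\<close>, the order of \<open>P' Q\<close> is one less than that of \<open>P\<close>, whereas the order of \<open>P Q'\<close> is
  at least that of \<open>P\<close>.\<close>

lemma wronskian_nonzero:
  fixes P Q :: "complex poly"
  assumes "degree P \<noteq> 0" "\<And>t. poly P t = 0 \<Longrightarrow> poly Q t \<noteq> 0"
  shows "P * pderiv Q - pderiv P * Q \<noteq> 0"
proof
  assume eq: "P * pderiv Q - pderiv P * Q = 0"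
  obtain t where t: "poly P t = 0"
    using assms(1) fundamental_theorem_of_algebra_alt[of P] by (metis degree_pCons_0)
  have P: "P \<noteq> 0" "pderiv P \<noteq> 0" and Q: "poly Q t \<noteq> 0" using assms t by (auto simp: pderiv_eq_0_iff)
  have "Q \<noteq> 0" "order t Q = 0" using Q by (auto simp: order_root)
  have k: "order t P = Suc (order t (pderiv P))"
    using P t by (intro order_pderiv)
  have PQ: "pderiv P * Q \<noteq> 0" using P \<open>Q \<noteq> 0\<close> by simp
  have "order t (pderiv P * Q) = order t (pderiv P)"
    using order_mult[OF PQ] \<open>order t Q = 0\<close> by simp
  moreover have "order t (P * pderiv Q) \<ge> order t P"
    using PQ eq by (subst order_mult) auto
  ultimately show False using eq k by simp
qed

text \<open>Take a pencil of planes whose axis does not meet the curve and whose general member lies in the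
  given open set. The planes of the pencil cut out the zeros of \<open>P + s Q\<close>, and this polynomial has a
  double root only if \<open>s = - P(t) / Q(t)\<close> for a zero \<open>t\<close> of the Wronskian of \<open>P\<close> and \<open>Q\<close>. So for
  almost every \<open>s\<close> there are \<open>m\<close> distinct roots, and they avoid the finite set where the
  parametrization may fail to be injective.\<close>

theorem degree_of_parametrized_curve:
  assumes nz: "\<And>w. w \<noteq> 0 \<Longrightarrow> form_map m a w \<noteq> 0"
    and C: "C = {proj_pt (form_map m a w) | w. w \<noteq> 0}"
    and E: "finite E"
    and inj: "\<And>w w'. w \<noteq> 0 \<Longrightarrow> w' \<noteq> 0 \<Longrightarrow> proj_pt w \<notin> E \<Longrightarrow> proj_pt w' \<notin> E \<Longrightarrow>
       proj_pt (form_map m a w) = proj_pt (form_map m a w') \<Longrightarrow> proj_pt w = proj_pt w'"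
    and deg: "curve_degree C d"
  shows "d = m"
proof -
  obtain W where W: "zariski_open W" "W \<noteq> {}"
    "\<And>h. h \<noteq> 0 \<Longrightarrow> proj_pt h \<in> W \<Longrightarrow> card (C \<inter> plane h) = d"
    using deg unfolding curve_degree_def by blast
  obtain F where F: "F \<subseteq> vec_polys" "\<And>x. x \<noteq> 0 \<Longrightarrow> proj_pt x \<in> W \<longleftrightarrow> (\<exists>f\<in>F. f x \<noteq> 0)"
    using W(1) unfolding zariski_open_def by blast
  obtain x where "x \<noteq> 0" "proj_pt x \<in> W"
    using W(1,2) CP_E unfolding zariski_open_def by (metis equals0I subsetD)
  then obtain f where f: "f \<in> F" "f x \<noteq> 0" using F(2) by blast
  have am: "a m \<noteq> 0"
    using nz[of "vector [1, 0]"] form_map_infinity[of "vector [1, 0]" m a]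
    by (auto simp: vec_eq_iff forall_2)
  then obtain y where y: "pairing (a m) y \<noteq> 0" using pairing_eq_0_imp by blast
  obtain h0 where h0: "f h0 \<noteq> 0" "pairing h0 (a m) \<noteq> 0"
    using vec_polys_common_nonzero[of f "pairing (a m)" x y] vec_polys_pairing f F(1) y
    by (auto simp: pairing_commute)
  define P where "P = plane_section_poly m a h0"
  have P: "P \<noteq> 0" "degree P = m"
    using h0(2) degree_slice_poly coeff_slice_poly[of m a h0] by (auto simp: P_def)
  have "finite ((\<lambda>t. form_map m a (aff t)) ` {t. poly P t = 0})" using P poly_roots_finite by blast
  moreover have "0 \<notin> (\<lambda>t. form_map m a (aff t)) ` {t. poly P t = 0}" using nz[OF aff_simps(3)] by force
  ultimately obtain h1 where "\<forall>v\<in>(\<lambda>t. form_map m a (aff t)) ` {t. poly P t = 0}. pairing h1 v \<noteq> 0"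
    using avoid_finitely_many by blast
  hence h1: "pairing h1 (form_map m a (aff t)) \<noteq> 0" if "poly P t = 0" for t using that by blast
  define Q where "Q = plane_section_poly m a h1"
  have PQ: "poly Q t \<noteq> 0" if "poly P t = 0" for t using h1[OF that] by (simp add: Q_def poly_plane_section_poly)
  have fin: "finite {s. poly P t + s * poly Q t = 0}" for t
  proof -
    have "[:poly P t, poly Q t:] \<noteq> 0" using PQ by auto
    from poly_roots_finite[OF this] show ?thesis by simp
  qed
  define Wr where "Wr = P * pderiv Q - pderiv P * Q"
  \<comment> \<open>Excluded in turn: planes outside the open set, planes through the point at \<open>t = \<infinity>\<close>, tangent
    planes, planes through a point of \<open>E\<close>.\<close>
  define bad where "bad = {s. f (h0 + s *s h1) = 0} \<union> {s. pairing (a m) (h0 + s *s h1) = 0}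
    \<union> (\<Union>t\<in>{t. m \<noteq> 0 \<and> poly Wr t = 0}. {s. poly P t + s * poly Q t = 0})
    \<union> (\<Union>t\<in>{t. proj_pt (aff t) \<in> E}. {s. poly P t + s * poly Q t = 0})"
  have "finite bad" unfolding bad_def
  proof (intro finite_UnI finite_UN_I fin)
    show "finite {s. f (h0 + s *s h1) = 0}" using finite_zeros_on_line f(1) F(1) h0(1) by blast
    show "finite {s. pairing (a m) (h0 + s *s h1) = 0}"
      by (rule finite_zeros_on_line[OF vec_polys_pairing]) (use h0 in \<open>simp add: pairing_commute\<close>)
    show "finite {t. m \<noteq> 0 \<and> poly Wr t = 0}"
    proof (cases "m = 0")
      case False
      then have "Wr \<noteq> 0" unfolding Wr_def using wronskian_nonzero P PQ by simp
      then show ?thesis using poly_roots_finite[of Wr] by (auto elim: rev_finite_subset)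
    qed auto
    have "inj (\<lambda>t. proj_pt (aff t))" by (rule injI) (rule proj_pt_aff_inj)
    from finite_vimageI[OF E this] show "finite {t. proj_pt (aff t) \<in> E}" by (simp add: vimage_def)
  qed
  then obtain s where s: "s \<notin> bad" using ex_new_if_finite[OF infinite_UNIV_char_0] by blast
  define h where "h = h0 + s *s h1"
  define R where "R = plane_section_poly m a h"
  have R: "R = P + smult s Q" by (simp add: R_def P_def Q_def h_def plane_section_poly_line)
  have hm: "pairing h (a m) \<noteq> 0" "h \<noteq> 0" and fh: "f h \<noteq> 0"
    using s by (auto simp: bad_def h_def pairing_commute)
  have dR: "degree R = m" unfolding R_def by (rule degree_slice_poly) (rule hm(1))
  have "rsquarefree R" unfolding rsquarefree_roots
  proof (intro allI notI, elim conjE)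
    fix t assume t: "poly R t = 0" "poly (pderiv R) t = 0"
    have "m \<noteq> 0"
    proof
      assume "m = 0"
      with dR obtain c where "R = [:c:]" using degree_eq_zeroE by blast
      moreover have "R \<noteq> 0" using hm coeff_slice_poly[of m a h] by (auto simp: R_def)
      ultimately show False using t by auto
    qed
    have e1: "poly P t + s * poly Q t = 0" using t(1) by (simp add: R)
    have e2: "poly (pderiv P) t + s * poly (pderiv Q) t = 0"
      using t(2) by (simp add: R pderiv_add pderiv_smult)
    have "poly Wr t = 0" unfolding Wr_def poly_diff poly_mult using e1 e2 by algebra
    with e1 \<open>m \<noteq> 0\<close> s show False by (auto simp: bad_def)
  qed
  hence card: "card {t. poly R t = 0} = m" using card_roots_rsquarefree dR by simp
  have "C \<inter> plane h = (\<lambda>t. proj_pt (form_map m a (aff t))) ` {t. poly R t = 0}" (is "_ = ?f ` _")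
  proof (intro equalityI subsetI)
    fix p assume p: "p \<in> C \<inter> plane h"
    then obtain w where w: "w \<noteq> 0" "p = proj_pt (form_map m a w)" using C by blast
    have z: "pairing h (form_map m a w) = 0" using p w nz in_plane_iff by blast
    have w2: "w $ 2 \<noteq> 0"
    proof
      assume "w $ 2 = 0"
      moreover from this have "w $ 1 \<noteq> 0" using w by (auto simp: vec_eq_iff forall_2)
      ultimately show False using z hm form_map_infinity by (simp add: pairing_simps)
    qed
    define t where "t = w $ 1 / w $ 2"
    have eq: "form_map m a w = w $ 2 ^ m *s form_map m a (aff t)"
      using scale_aff[OF w2] form_map_scale by (metis t_def)
    have "poly R t = 0" using z w2 unfolding eq R_def poly_plane_section_poly by (simp add: pairing_simps)
    moreover have "p = ?f t" using w w2 by (simp add: eq proj_pt_scale)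
    ultimately show "p \<in> ?f ` {t. poly R t = 0}" by blast
  next
    fix p assume "p \<in> ?f ` {t. poly R t = 0}"
    then obtain t where t: "p = ?f t" "poly R t = 0" by blast
    then show "p \<in> C \<inter> plane h"
      using C nz[OF aff_simps(3)] by (auto simp: in_plane_iff R_def poly_plane_section_poly intro!: exI[of _ "aff t"])
  qed
  moreover have "inj_on ?f {t. poly R t = 0}"
  proof (rule inj_onI)
    fix t t' assume t: "t \<in> {t. poly R t = 0}" "t' \<in> {t. poly R t = 0}" "?f t = ?f t'"
    have "proj_pt (aff t) \<notin> E" "proj_pt (aff t') \<notin> E" using t s by (auto simp: R bad_def)
    then have "proj_pt (aff t) = proj_pt (aff t')" using t(3) by (intro inj) simp_all
    then show "t = t'" by (rule proj_pt_aff_inj)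
  qed
  ultimately have "card (C \<inter> plane h) = m" using card by (simp add: card_image)
  moreover have "proj_pt h \<in> W" using F(2) hm f fh by blast
  ultimately show ?thesis using W(3) hm by blast
qed

section \<open>Legendrian cubics and their tangent spaces\<close>

text \<open>Every polynomial function has a gradient, with the chain rule for arbitrary differentiable curves.\<close>

lemma vec_polys_gradient:
  assumes "f \<in> vec_polys"
  shows "\<exists>g. \<forall>\<gamma> \<gamma>'. \<gamma> 0 = x \<longrightarrow> (\<forall>i. ((\<lambda>t. \<gamma> t $ i) has_field_derivative \<gamma>' $ i) (at 0)) \<longrightarrow>
    ((\<lambda>t. f (\<gamma> t)) has_field_derivative pairing g \<gamma>') (at 0)"
  using assms unfolding vec_polys_def
proof induction
  case (coord f)
  then obtain i where "f = (\<lambda>x. x $ i)" by auto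
  then show ?case by (intro exI[of _ "axis i 1"]) (simp add: pairing_commute[of "axis i 1"] pairing_axis)
next
  case (const c)
  then show ?case by (intro exI[of _ 0]) auto
next
  case (add f1 f2)
  then obtain g1 g2 where
    "\<forall>\<gamma> \<gamma>'. \<gamma> 0 = x \<longrightarrow> (\<forall>i. ((\<lambda>t. \<gamma> t $ i) has_field_derivative \<gamma>' $ i) (at 0)) \<longrightarrow>
      ((\<lambda>t. f1 (\<gamma> t)) has_field_derivative pairing g1 \<gamma>') (at 0)"
    "\<forall>\<gamma> \<gamma>'. \<gamma> 0 = x \<longrightarrow> (\<forall>i. ((\<lambda>t. \<gamma> t $ i) has_field_derivative \<gamma>' $ i) (at 0)) \<longrightarrow>
      ((\<lambda>t. f2 (\<gamma> t)) has_field_derivative pairing g2 \<gamma>') (at 0)" by blast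
  then show ?case
    by (intro exI[of _ "g1 + g2"]) (auto simp: pairing_simps intro!: derivative_intros)
next
  case (mult f1 f2)
  then obtain g1 g2 where
    "\<forall>\<gamma> \<gamma>'. \<gamma> 0 = x \<longrightarrow> (\<forall>i. ((\<lambda>t. \<gamma> t $ i) has_field_derivative \<gamma>' $ i) (at 0)) \<longrightarrow>
      ((\<lambda>t. f1 (\<gamma> t)) has_field_derivative pairing g1 \<gamma>') (at 0)"
    "\<forall>\<gamma> \<gamma>'. \<gamma> 0 = x \<longrightarrow> (\<forall>i. ((\<lambda>t. \<gamma> t $ i) has_field_derivative \<gamma>' $ i) (at 0)) \<longrightarrow>
      ((\<lambda>t. f2 (\<gamma> t)) has_field_derivative pairing g2 \<gamma>') (at 0)" by blast
  then show ?case
    by (intro exI[of _ "f2 x *s g1 + f1 x *s g2"])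
      (auto simp: pairing_simps mult.commute intro!: derivative_eq_intros)
qed

lemma line_has_field_derivative:
  "((\<lambda>t. (x + t *s v) $ i) has_field_derivative v $ i) (at 0)"
  by (auto intro!: derivative_eq_intros)

lemma subspace_cone_tangent: "vec.subspace (cone_tangent C x)"
proof -
  have "\<exists>g. \<forall>v. deriv (\<lambda>t. f (x + t *s v)) 0 = pairing g v" if f: "f \<in> vec_polys" for f
  proof -
    obtain g where "\<forall>\<gamma> \<gamma>'. \<gamma> 0 = x \<longrightarrow> (\<forall>i. ((\<lambda>t. \<gamma> t $ i) has_field_derivative \<gamma>' $ i) (at 0)) \<longrightarrow>
      ((\<lambda>t. f (\<gamma> t)) has_field_derivative pairing g \<gamma>') (at 0)" using vec_polys_gradient[OF f] by blast
    then have "((\<lambda>t. f (x + t *s v)) has_field_derivative pairing g v) (at 0)" for v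
      using line_has_field_derivative[of x v] by (auto dest!: spec[of _ "\<lambda>t. x + t *s v"])
    then show ?thesis using DERIV_imp_deriv by blast
  qed
  then obtain g where g: "\<And>f v. f \<in> vec_polys \<Longrightarrow> deriv (\<lambda>t. f (x + t *s v)) 0 = pairing (g f) v" by metis
  show ?thesis
    by (rule vec.subspaceI) (auto simp: cone_tangent_def g pairing_simps)
qed

lemma velocity_in_cone_tangent:
  assumes "\<gamma> 0 = x" "\<And>i. ((\<lambda>t. \<gamma> t $ i) has_field_derivative v $ i) (at 0)"
    and "open T" "0 \<in> T" "\<And>t. t \<in> T \<Longrightarrow> \<gamma> t \<in> cone C"
  shows "v \<in> cone_tangent C x"
  unfolding cone_tangent_def
proof (intro CollectI ballI impI)
  fix f assume f: "f \<in> vec_polys" "\<forall>y\<in>cone C. f y = 0"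
  obtain g where g: "\<And>\<gamma> \<gamma>'. \<gamma> 0 = x \<Longrightarrow> (\<forall>i. ((\<lambda>t. \<gamma> t $ i) has_field_derivative \<gamma>' $ i) (at 0)) \<Longrightarrow>
      ((\<lambda>t. f (\<gamma> t)) has_field_derivative pairing g \<gamma>') (at 0)" using vec_polys_gradient[OF f(1)] by metis
  have "((\<lambda>t. f (\<gamma> t)) has_field_derivative pairing g v) (at 0)" using g assms(1,2) by blast
  moreover have "((\<lambda>t. f (\<gamma> t)) has_field_derivative 0) (at 0)"
    by (rule has_field_derivative_transform_within_open[OF _ assms(3,4)]) (use f(2) assms(5) in auto)
  ultimately have "pairing g v = 0" by (rule DERIV_unique)
  moreover have "((\<lambda>t. f (x + t *s v)) has_field_derivative pairing g v) (at 0)"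
    by (rule g) (simp, use line_has_field_derivative in blast)
  ultimately show "deriv (\<lambda>t. f (x + t *s v)) 0 = 0" by (simp add: DERIV_imp_deriv)
qed

abbreviation cubic :: "(nat \<Rightarrow> complex^4) \<Rightarrow> complex^2 \<Rightarrow> complex^4"
  where "cubic \<equiv> form_map 3"

lemma cubic_expand: "cubic a w =
  w $ 2 ^ 3 *s a 0 + (w $ 1 * w $ 2 ^ 2) *s a 1 + (w $ 1 ^ 2 * w $ 2) *s a 2 + w $ 1 ^ 3 *s a 3"
  by (simp add: form_map_def eval_nat_numeral)

definition cubic_d1 :: "(nat \<Rightarrow> complex^4) \<Rightarrow> complex^2 \<Rightarrow> complex^4"
  where "cubic_d1 a w = (w $ 2 ^ 2) *s a 1 + (2 * w $ 1 * w $ 2) *s a 2 + (3 * w $ 1 ^ 2) *s a 3"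

definition cubic_d2 :: "(nat \<Rightarrow> complex^4) \<Rightarrow> complex^2 \<Rightarrow> complex^4"
  where "cubic_d2 a w = (3 * w $ 2 ^ 2) *s a 0 + (2 * w $ 1 * w $ 2) *s a 1 + (w $ 1 ^ 2) *s a 2"

definition image_curve :: "(nat \<Rightarrow> complex^4) \<Rightarrow> (complex^4) set set"
  where "image_curve a = {proj_pt (cubic a w) | w. w \<noteq> 0}"

text \<open>The factor between two representatives of a point is absorbed in \<open>w\<close> by a cube root.\<close>

lemma cone_image_curve:
  assumes "\<And>w. w \<noteq> 0 \<Longrightarrow> cubic a w \<noteq> 0" "x \<in> cone (image_curve a)"
  obtains w where "w \<noteq> 0" "x = cubic a w"
proof -
  obtain w where w: "w \<noteq> 0" "x \<noteq> 0" "proj_pt x = proj_pt (cubic a w)"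
    using assms(2) by (auto simp: cone_def image_curve_def)
  then obtain c where c: "c \<noteq> 0" "x = c *s cubic a w" using proj_pt_eq_iff assms(1) by metis
  obtain r where r: "r ^ 3 = c"
  proof
    show "(c powr (1/3)) ^ 3 = c" using c(1)
      by (simp add: powr_def power3_eq_cube mult_exp_exp flip: exp_of_nat_mult)
  qed
  then have "x = cubic a (r *s w)" using c by (simp add: form_map_scale)
  moreover have "r *s w \<noteq> 0" using r c w by auto
  ultimately show ?thesis using that by blast
qed

lemma partials_in_cone_tangent:
  assumes nz: "\<And>w. w \<noteq> 0 \<Longrightarrow> cubic a w \<noteq> 0" and w: "w \<noteq> 0"
  shows "cubic_d1 a w \<in> cone_tangent (image_curve a) (cubic a w)"
    and "cubic_d2 a w \<in> cone_tangent (image_curve a) (cubic a w)"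
proof -
  have *: "e $ 1 *s cubic_d1 a w + e $ 2 *s cubic_d2 a w \<in> cone_tangent (image_curve a) (cubic a w)" for e :: "complex^2"
  proof -
    obtain i where i: "w $ i \<noteq> 0" using w by (auto simp: vec_eq_iff)
    let ?T = "{t. w $ i + t * e $ i \<noteq> 0}"
    show ?thesis
    proof (rule velocity_in_cone_tangent[where T = ?T and \<gamma> = "\<lambda>t. cubic a (w + t *s e)"])
      show "open ?T" by (intro open_Collect_neq continuous_intros)
      show "((\<lambda>t. cubic a (w + t *s e) $ j) has_field_derivative
          (e $ 1 *s cubic_d1 a w + e $ 2 *s cubic_d2 a w) $ j) (at 0)" for j
        unfolding cubic_expand cubic_d1_def cubic_d2_def
        by (auto intro!: derivative_eq_intros simp: power2_eq_square power3_eq_cube) (simp add: algebra_simps)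
      fix t assume "t \<in> ?T"
      hence "w + t *s e \<noteq> 0" by (auto simp: vec_eq_iff)
      then show "cubic a (w + t *s e) \<in> cone (image_curve a)"
        using nz by (auto simp: cone_def image_curve_def)
    qed (use i in auto)
  qed
  from *[of "vector [1, 0]"] *[of "vector [0, 1]"]
  show "cubic_d1 a w \<in> cone_tangent (image_curve a) (cubic a w)"
    "cubic_d2 a w \<in> cone_tangent (image_curve a) (cubic a w)" by simp_all
qed

lemma independent_pair:
  fixes x y :: "complex^4"
  assumes "\<And>c d. c *s x + d *s y = 0 \<Longrightarrow> c = 0 \<and> d = 0"
  shows "vec.independent {x, y}" "card {x, y} = 2"
proof -
  have ne: "x \<noteq> y" using assms[of 1 "-1"] by auto
  then show "card {x, y} = 2" by simp
  have y: "y \<noteq> 0" using assms[of 0 1] by auto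
  have "x \<notin> vec.span {y}"
  proof
    assume "x \<in> vec.span {y}"
    then obtain k where "x = k *s y" by (auto simp: vec.span_singleton)
    then show False using assms[of 1 "- k"] by simp
  qed
  then show "vec.independent {x, y}" using y ne by (simp add: vec.independent_insert)
qed

lemma vec2_nonzero_iff: "(w :: complex^2) \<noteq> 0 \<longleftrightarrow> w $ 1 \<noteq> 0 \<or> w $ 2 \<noteq> (0::complex)"
  by (auto simp: vec_eq_iff forall_2)

text \<open>Suppose that some linear coordinates \<open>Y\<close> and \<open>Z\<close> of the curve are \<open>w\<^sub>1 q\<close> and \<open>w\<^sub>2 q\<close> with a common
  quadratic factor \<open>q\<close>; this is a projection from the node if the curve is plane. If another linear
  coordinate \<open>h\<close> is the binary form \<open>f\<close>, then \<open>h q(Y, Z) = f(Y, Z)\<close> on the curve, because both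
  sides are \<open>f q\<^sup>3\<close>. In a direction with \<open>Y = Z = 0\<close> the derivative of this equation is
  \<open>q\<^sup>3\<close> times the change of \<open>h\<close>. So where \<open>q \<noteq> 0\<close> the Zariski tangent space embeds into the plane of the
  coordinates \<open>Y\<close> and \<open>Z\<close>, and the two partial derivatives of \<open>F\<close> already fill this plane.\<close>

lemma smooth_point_away_from_node:
  fixes a :: "nat \<Rightarrow> complex^4"
  assumes nz: "\<And>w. w \<noteq> 0 \<Longrightarrow> cubic a w \<noteq> 0"
    and hZ: "pairing hZ (a 0) = q0" "pairing hZ (a 1) = q1" "pairing hZ (a 2) = q2" "pairing hZ (a 3) = 0"
    and hY: "pairing hY (a 0) = 0" "pairing hY (a 1) = q0" "pairing hY (a 2) = q1" "pairing hY (a 3) = q2"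
    and w: "w \<noteq> 0" "q0 * w $ 2 ^ 2 + q1 * w $ 1 * w $ 2 + q2 * w $ 1 ^ 2 \<noteq> 0"
  shows "smooth_point (image_curve a) (cubic a w)"
proof -
  define q where "q = (\<lambda>w::complex^2. q0 * w $ 2 ^ 2 + q1 * w $ 1 * w $ 2 + q2 * w $ 1 ^ 2)"
  let ?T = "cone_tangent (image_curve a) (cubic a w)"
  have Z: "pairing hZ (cubic a w) = w $ 2 * q w" and Y: "pairing hY (cubic a w) = w $ 1 * q w" for w
    unfolding cubic_expand pairing_simps hZ hY q_def by (simp_all add: power2_eq_square power3_eq_cube algebra_simps)
  have K: "q0 * (w $ 2 * q w) ^ 2 + q1 * (w $ 1 * q w) * (w $ 2 * q w) + q2 * (w $ 1 * q w) ^ 2 = q w ^ 3" for w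
  proof -
    have "q0 * (t * r) ^ 2 + q1 * (s * r) * (t * r) + q2 * (s * r) ^ 2 = r ^ 3"
      if "r = q0 * t ^ 2 + q1 * s * t + q2 * s ^ 2" for s t r
    proof -
      have "q0 * (t * r) ^ 2 + q1 * (s * r) * (t * r) + q2 * (s * r) ^ 2
        = r ^ 2 * (q0 * t ^ 2 + q1 * s * t + q2 * s ^ 2)" by algebra
      then show ?thesis unfolding that[symmetric] by (simp add: power2_eq_square power3_eq_cube)
    qed
    then show ?thesis by (simp add: q_def)
  qed
  have kill: "v = 0" if v: "v \<in> ?T" "pairing hY v = 0" "pairing hZ v = 0" for v
  proof (rule pairing_eq_0_imp')
    fix h
    define G where "G = (\<lambda>x. pairing h x * (q0 * pairing hZ x ^ 2 + q1 * pairing hY x * pairing hZ x + q2 * pairing hY x ^ 2)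
      - (pairing h (a 0) * pairing hZ x ^ 3 + pairing h (a 1) * pairing hY x * pairing hZ x ^ 2
        + pairing h (a 2) * pairing hY x ^ 2 * pairing hZ x + pairing h (a 3) * pairing hY x ^ 3))"
    have "G \<in> vec_polys"
      unfolding G_def using vec_polys_pairing unfolding vec_polys_def by (intro poly_funs_intros) auto
    moreover have "\<forall>y\<in>cone (image_curve a). G y = 0"
    proof
      fix y assume "y \<in> cone (image_curve a)"
      then obtain w where y: "y = cubic a w" using cone_image_curve nz by metis
      then show "G y = 0"
        unfolding y G_def Z Y K by (simp add: cubic_expand pairing_simps algebra_simps power2_eq_square power3_eq_cube)
    qed
    ultimately have "deriv (\<lambda>t. G (cubic a w + t *s v)) 0 = 0" using v(1) by (auto simp: cone_tangent_def)
    moreover have "((\<lambda>t. G (cubic a w + t *s v)) has_field_derivative pairing h v * q w ^ 3) (at 0)"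
      unfolding G_def pairing_add_right pairing_scale_right v Z Y mult_zero_right add_0_right K
      by (auto intro!: derivative_eq_intros)
    ultimately show "pairing h v = 0" using w(2) by (simp add: DERIV_imp_deriv q_def)
  qed
  define Y1 Y2 Z1 Z2 where "Y1 = pairing hY (cubic_d1 a w)" "Y2 = pairing hY (cubic_d2 a w)"
    "Z1 = pairing hZ (cubic_d1 a w)" "Z2 = pairing hZ (cubic_d2 a w)"
  have jacobian: "Y1 * Z2 - Y2 * Z1 = 3 * q w ^ 2"
    unfolding Y1_Y2_Z1_Z2_def cubic_d1_def cubic_d2_def pairing_simps hZ hY q_def by algebra
  have J: "Y1 * Z2 - Y2 * Z1 \<noteq> 0" unfolding jacobian using w(2) by (simp add: q_def)
  have ind: "c = 0 \<and> d = 0" if "c *s cubic_d1 a w + d *s cubic_d2 a w = 0" for c d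
  proof -
    have "c * Y1 + d * Y2 = 0" "c * Z1 + d * Z2 = 0"
      using arg_cong[OF that, of "pairing hY"] arg_cong[OF that, of "pairing hZ"]
      by (simp_all add: pairing_simps Y1_Y2_Z1_Z2_def)
    hence "c * (Y1 * Z2 - Y2 * Z1) = 0" "d * (Y1 * Z2 - Y2 * Z1) = 0" by algebra+
    then show ?thesis using J by simp
  qed
  note part = partials_in_cone_tangent[OF nz w(1)]
  have "?T \<subseteq> vec.span {cubic_d1 a w, cubic_d2 a w}"
  proof
    fix v assume v: "v \<in> ?T"
    define D where "D = Y1 * Z2 - Y2 * Z1"
    define c where "c = (pairing hY v * Z2 - pairing hZ v * Y2) / D"
    define d where "d = (Y1 * pairing hZ v - Z1 * pairing hY v) / D"
    have D: "D \<noteq> 0" using J by (simp add: D_def)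
    have "v - (c *s cubic_d1 a w + d *s cubic_d2 a w) = 0"
    proof (rule kill)
      show "v - (c *s cubic_d1 a w + d *s cubic_d2 a w) \<in> ?T"
        using v part subspace_cone_tangent[of "image_curve a" "cubic a w"]
        by (intro vec.subspace_diff vec.subspace_add vec.subspace_scale) auto
      have "c * D = pairing hY v * Z2 - pairing hZ v * Y2" "d * D = Y1 * pairing hZ v - Z1 * pairing hY v"
        using D by (simp_all add: c_def d_def)
      hence "D * (pairing hY v - (c * Y1 + d * Y2)) = 0" "D * (pairing hZ v - (c * Z1 + d * Z2)) = 0"
        unfolding D_def by algebra+
      then show "pairing hY (v - (c *s cubic_d1 a w + d *s cubic_d2 a w)) = 0"
        "pairing hZ (v - (c *s cubic_d1 a w + d *s cubic_d2 a w)) = 0"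
        using D by (simp_all add: pairing_simps Y1_Y2_Z1_Z2_def)
    qed
    then have "v = c *s cubic_d1 a w + d *s cubic_d2 a w" by (rule eq_iff_diff_eq_0[THEN iffD2])
    then show "v \<in> vec.span {cubic_d1 a w, cubic_d2 a w}"
      by (metis insertI1 insertI2 vec.span_add vec.span_base vec.span_scale)
  qed
  hence "vec.dim ?T = card {cubic_d1 a w, cubic_d2 a w}"
    using part independent_pair(1)[OF ind] by (intro vec.dim_unique[symmetric, symmetric]) auto
  moreover have "cubic a w \<in> cone (image_curve a)"
    using nz[OF w(1)] w(1) by (auto simp: cone_def image_curve_def)
  ultimately show ?thesis using independent_pair(2)[OF ind] by (simp add: smooth_point_def)
qed

definition sympl_legendrian :: "complex^4^4 \<Rightarrow> (complex^4) set set \<Rightarrow> bool"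
  where "sympl_legendrian J C \<longleftrightarrow> (\<forall>x v. smooth_point C x \<longrightarrow> v \<in> cone_tangent C x \<longrightarrow> bil J x v = 0)"

lemma legendrian_iff_sympl:
  assumes "(\<Union>i\<in>I. A i) = CP"
    and "\<forall>i\<in>I. \<forall>x\<in>cone (A i). \<forall>v. pairing (\<omega> i x) v = 0 \<longleftrightarrow> bil J x v = 0"
  shows "legendrian I A \<omega> C \<longleftrightarrow> sympl_legendrian J C"
proof -
  have "\<exists>i\<in>I. x \<in> cone (A i)" if "smooth_point C x" for x
  proof -
    have "x \<noteq> 0" using that by (simp add: smooth_point_def cone_def)
    then show ?thesis using assms(1) proj_pt_in_CP[of x] by (auto simp: cone_def)
  qed
  then show ?thesis using assms(2) unfolding legendrian_def sympl_legendrian_def by blast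
qed

text \<open>These equations say that the polynomial \<open>B(F(t), F'(t))\<close> vanishes, where \<open>F(t)\<close> is the
  sum of the \<open>a\<^sub>k t\<^sup>k\<close>; its coefficients are
  \<open>B(a\<^sub>0, a\<^sub>1)\<close>, \<open>2 B(a\<^sub>0, a\<^sub>2)\<close>, \<open>3 B(a\<^sub>0, a\<^sub>3) + B(a\<^sub>1, a\<^sub>2)\<close>, \<open>2 B(a\<^sub>1, a\<^sub>3)\<close> and \<open>B(a\<^sub>2, a\<^sub>3)\<close>.\<close>

definition legendrian_coeffs :: "complex^4^4 \<Rightarrow> (nat \<Rightarrow> complex^4) \<Rightarrow> bool"
  where "legendrian_coeffs J a \<longleftrightarrow> bil J (a 0) (a 1) = 0 \<and> bil J (a 0) (a 2) = 0 \<and>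
    bil J (a 1) (a 2) = - 3 * bil J (a 0) (a 3) \<and> bil J (a 1) (a 3) = 0 \<and> bil J (a 2) (a 3) = 0"

text \<open>The polynomial \<open>B(F, F')\<close> vanishes wherever \<open>q\<close> does not, so its product with \<open>q\<close> is zero.\<close>

lemma legendrian_coeffs_necessary:
  fixes a :: "nat \<Rightarrow> complex^4"
  assumes J: "symplectic J" and leg: "sympl_legendrian J (image_curve a)"
    and nz: "\<And>w. w \<noteq> 0 \<Longrightarrow> cubic a w \<noteq> 0"
    and hZ: "pairing hZ (a 0) = q0" "pairing hZ (a 1) = q1" "pairing hZ (a 2) = q2" "pairing hZ (a 3) = 0"
    and hY: "pairing hY (a 0) = 0" "pairing hY (a 1) = q0" "pairing hY (a 2) = q1" "pairing hY (a 3) = q2"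
    and q: "q0 \<noteq> 0 \<or> q1 \<noteq> 0 \<or> q2 \<noteq> 0"
  shows "legendrian_coeffs J a"
proof -
  let ?B = "\<lambda>i j. bil J (a i) (a j)"
  define P where "P = [:?B 0 1, 2 * ?B 0 2, 3 * ?B 0 3 + ?B 1 2, 2 * ?B 1 3, ?B 2 3:]"
  have "poly (P * [:q0, q1, q2:]) t = 0" for t
  proof (cases "q0 + q1 * t + q2 * t ^ 2 = 0")
    case True
    then have "poly [:q0, q1, q2:] t = 0" by (simp add: power2_eq_square algebra_simps)
    then show ?thesis by (simp only: poly_mult mult_zero_right)
  next
    case False
    have "smooth_point (image_curve a) (cubic a (aff t))"
      by (rule smooth_point_away_from_node[OF nz hZ hY]) (use False in simp_all)
    moreover have "cubic_d1 a (aff t) \<in> cone_tangent (image_curve a) (cubic a (aff t))"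
      by (rule partials_in_cone_tangent[OF nz]) simp_all
    ultimately have "bil J (cubic a (aff t)) (cubic_d1 a (aff t)) = 0"
      using leg unfolding sympl_legendrian_def by blast
    then have "poly P t = 0"
      unfolding cubic_expand cubic_d1_def bil_simps symplectic_self[OF J] P_def
        symplectic_swap[OF J, of "a 2" "a 1"] symplectic_swap[OF J, of "a 3" "a 1"] symplectic_swap[OF J, of "a 3" "a 2"]
      by (simp add: algebra_simps power2_eq_square power3_eq_cube)
    then show ?thesis by simp
  qed
  hence "P * [:q0, q1, q2:] = 0" using poly_all_0_iff_0 by blast
  hence "P = 0" using q by (auto simp del: mult_pCons_right)
  then show ?thesis unfolding P_def legendrian_coeffs_def by (auto simp: add_eq_0_iff2)
qed

text \<open>Linear independence of the four coefficients, in the dual form in which it is used: the coordinates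
  of the curve with respect to linear forms are arbitrary binary cubics.\<close>

definition free_coeffs :: "(nat \<Rightarrow> complex^4) \<Rightarrow> bool"
  where "free_coeffs a \<longleftrightarrow> (\<forall>d0 d1 d2 d3. \<exists>h. pairing h (a 0) = d0 \<and> pairing h (a 1) = d1 \<and>
    pairing h (a 2) = d2 \<and> pairing h (a 3) = d3)"

lemma free_coeffs_eq:
  assumes "free_coeffs a"
    and "c0 *s a 0 + c1 *s a 1 + c2 *s a 2 + c3 *s a 3 = d0 *s a 0 + d1 *s a 1 + d2 *s a 2 + d3 *s a 3"
  shows "c0 = d0" "c1 = d1" "c2 = d2" "c3 = d3"
proof -
  have *: "c0 * e0 + c1 * e1 + c2 * e2 + c3 * e3 = d0 * e0 + d1 * e1 + d2 * e2 + d3 * e3" for e0 e1 e2 e3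
  proof -
    obtain h where "pairing h (a 0) = e0" "pairing h (a 1) = e1" "pairing h (a 2) = e2" "pairing h (a 3) = e3"
      using assms(1) unfolding free_coeffs_def by blast
    then show ?thesis using arg_cong[OF assms(2), of "pairing h"] by (simp add: pairing_simps)
  qed
  from *[of 1 0 0 0] *[of 0 1 0 0] *[of 0 0 1 0] *[of 0 0 0 1]
  show "c0 = d0" "c1 = d1" "c2 = d2" "c3 = d3" by simp_all
qed

lemma cubic_nonzero:
  assumes "free_coeffs a" "w \<noteq> 0" shows "cubic a w \<noteq> 0"
proof
  assume "cubic a w = 0"
  hence "w $ 2 ^ 3 *s a 0 + (w $ 1 * w $ 2 ^ 2) *s a 1 + (w $ 1 ^ 2 * w $ 2) *s a 2 + w $ 1 ^ 3 *s a 3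
    = 0 *s a 0 + 0 *s a 1 + 0 *s a 2 + 0 *s a 3" by (simp add: cubic_expand)
  from free_coeffs_eq[OF assms(1) this] assms(2) show False by (simp add: vec2_nonzero_iff)
qed

lemma cubic_inj:
  assumes free: "free_coeffs a" and w: "w \<noteq> 0" "w' \<noteq> 0"
    and "proj_pt (cubic a w) = proj_pt (cubic a w')"
  shows "proj_pt w = proj_pt w'"
proof -
  obtain c where c: "c \<noteq> 0" "cubic a w' = c *s cubic a w"
    using assms proj_pt_eq_iff cubic_nonzero by metis
  have "w' $ 2 ^ 3 *s a 0 + (w' $ 1 * w' $ 2 ^ 2) *s a 1 + (w' $ 1 ^ 2 * w' $ 2) *s a 2 + w' $ 1 ^ 3 *s a 3
    = (c * w $ 2 ^ 3) *s a 0 + (c * (w $ 1 * w $ 2 ^ 2)) *s a 1 + (c * (w $ 1 ^ 2 * w $ 2)) *s a 2 + (c * w $ 1 ^ 3) *s a 3"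
    using c(2) by (simp add: cubic_expand vec.scale_right_distrib)
  note eqs = free_coeffs_eq[OF free this]
  show ?thesis
  proof (cases "w $ 2 = 0")
    case True
    then have "w' $ 2 = 0" using eqs(1) by simp
    moreover have "w $ 1 \<noteq> 0" "w' $ 1 \<noteq> 0" using w True calculation by (auto simp: vec2_nonzero_iff)
    ultimately show ?thesis using True w
      by (subst proj_pt_eq_iff) (auto simp: vec_eq_iff forall_2 intro!: exI[of _ "w' $ 1 / w $ 1"])
  next
    case False
    then have w2: "w' $ 2 \<noteq> 0" using eqs(1) c(1) by auto
    have "w' $ 2 ^ 2 * (w' $ 1 * w $ 2 ^ 3 - w $ 1 * w $ 2 ^ 2 * w' $ 2) = 0" using eqs(1,2) by algebra
    hence "w' $ 1 * w $ 2 ^ 3 = w $ 1 * w $ 2 ^ 2 * w' $ 2" using w2 by simp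
    hence "w' $ 1 * w $ 2 = w $ 1 * w' $ 2" using False by (simp add: power2_eq_square power3_eq_cube)
    then show ?thesis using w False w2
      by (subst proj_pt_eq_iff) (auto simp: vec_eq_iff forall_2 field_simps intro!: exI[of _ "w' $ 2 / w $ 2"])
  qed
qed

lemma bil_zero_on_span:
  assumes "v \<in> vec.span S" "\<And>y. y \<in> S \<Longrightarrow> bil J x y = 0"
  shows "bil J x v = 0"
proof -
  have "vec.subspace {v. bil J x v = 0}" by (rule vec.subspaceI) (auto simp: bil_simps)
  then have "vec.span S \<subseteq> {v. bil J x v = 0}" using assms(2) by (intro vec.span_minimal) auto
  then show ?thesis using assms(1) by blast
qed

text \<open>If the coefficients are independent, the partial derivatives of \<open>F\<close> are independent at every
  point, so at a smooth point they span the tangent space.\<close>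

lemma legendrian_coeffs_sufficient:
  assumes J: "symplectic J" and free: "free_coeffs a" and leg: "legendrian_coeffs J a"
  shows "sympl_legendrian J (image_curve a)"
  unfolding sympl_legendrian_def
proof (intro allI impI)
  fix x v assume sm: "smooth_point (image_curve a) x" and v: "v \<in> cone_tangent (image_curve a) x"
  note nz = cubic_nonzero[OF free]
  obtain w where w: "w \<noteq> 0" "x = cubic a w"
    using cone_image_curve[OF nz] sm unfolding smooth_point_def by blast
  note part = partials_in_cone_tangent[OF nz w(1)]
  have ind: "c = 0 \<and> d = 0" if "c *s cubic_d1 a w + d *s cubic_d2 a w = 0" for c d
  proof -
    have "(3 * d * w $ 2 ^ 2) *s a 0 + (c * w $ 2 ^ 2 + d * 2 * w $ 1 * w $ 2) *s a 1
      + (c * 2 * w $ 1 * w $ 2 + d * w $ 1 ^ 2) *s a 2 + (3 * c * w $ 1 ^ 2) *s a 3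
      = 0 *s a 0 + 0 *s a 1 + 0 *s a 2 + 0 *s a 3"
      using that by (simp add: cubic_d1_def cubic_d2_def vec_eq_iff algebra_simps)
    from free_coeffs_eq[OF free this] w(1) show ?thesis by (auto simp: vec2_nonzero_iff)
  qed
  have "cone_tangent (image_curve a) x \<subseteq> vec.span {cubic_d1 a w, cubic_d2 a w}"
    using part sm independent_pair[OF ind] unfolding w(2) smooth_point_def
    by (intro vec.card_ge_dim_independent) auto
  moreover have "bil J x y = 0" if "y \<in> {cubic_d1 a w, cubic_d2 a w}" for y
  proof -
    note swap = symplectic_self[OF J] symplectic_swap[OF J, of "a 1" "a 0"] symplectic_swap[OF J, of "a 2" "a 0"]
      symplectic_swap[OF J, of "a 3" "a 0"]
      symplectic_swap[OF J, of "a 2" "a 1"] symplectic_swap[OF J, of "a 3" "a 1"] symplectic_swap[OF J, of "a 3" "a 2"]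
    have "bil J x (cubic_d1 a w) = 0" "bil J x (cubic_d2 a w) = 0"
      using leg unfolding legendrian_coeffs_def w(2) cubic_expand cubic_d1_def cubic_d2_def bil_simps swap
      by (auto simp: algebra_simps power2_eq_square power3_eq_cube)
    then show ?thesis using that by auto
  qed
  ultimately show "bil J x v = 0" using v bil_zero_on_span by blast
qed

text \<open>The discriminant of the cubic polynomial \<open>a t\<^sup>3 + b t\<^sup>2 + c t + d\<close>.\<close>

definition disc3 :: "complex \<Rightarrow> complex \<Rightarrow> complex \<Rightarrow> complex \<Rightarrow> complex"
  where "disc3 a b c d = b\<^sup>2 * c\<^sup>2 - 4 * a * c ^ 3 - 4 * b ^ 3 * d - 27 * a\<^sup>2 * d\<^sup>2 + 18 * a * b * c * d"

lemma card_cubic_roots: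
  assumes "a \<noteq> 0" "disc3 a b c d \<noteq> 0"
  shows "card {t. a * t ^ 3 + b * t ^ 2 + c * t + d = 0} = 3"
proof -
  let ?p = "[:d, c, b, a:]"
  have "rsquarefree ?p" unfolding rsquarefree_roots
  proof (intro allI notI, elim conjE)
    fix t assume "poly ?p t = 0" "poly (pderiv ?p) t = 0"
    hence "a * t ^ 3 + b * t ^ 2 + c * t + d = 0" "3 * a * t ^ 2 + 2 * b * t + c = 0"
      by (simp_all add: pderiv_pCons power2_eq_square power3_eq_cube algebra_simps)
    hence "a * disc3 a b c d = 0" unfolding disc3_def by algebra
    with assms show False by simp
  qed
  from card_roots_rsquarefree[OF this] have "card {t. poly ?p t = 0} = 3"
    using assms(1) by (simp del: poly_pCons)
  moreover
  have eq: "poly ?p t = a * t ^ 3 + b * t ^ 2 + c * t + d" for t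
    by (simp add: power2_eq_square power3_eq_cube algebra_simps)
  ultimately show ?thesis unfolding eq by blast
qed

text \<open>The open set consists of the planes on which the binary cubic has nonzero discriminant and no
  root at infinity.\<close>

lemma curve_degree_free_cubic:
  assumes free: "free_coeffs a"
  shows "curve_degree (image_curve a) 3"
proof -
  define g where "g = (\<lambda>h. pairing (a 3) h * disc3 (pairing (a 3) h) (pairing (a 2) h) (pairing (a 1) h) (pairing (a 0) h))"
  define W where "W = {proj_pt h | h. h \<noteq> 0 \<and> g h \<noteq> 0}"
  have g: "g \<in> vec_polys"
    unfolding g_def disc3_def using vec_polys_pairing unfolding vec_polys_def by (intro poly_funs_intros) auto
  have "g (c *s h) = c ^ 5 * g h" for c h
    unfolding g_def disc3_def pairing_simps by algebra
  hence W_iff: "proj_pt h \<in> W \<longleftrightarrow> g h \<noteq> 0" if "h \<noteq> 0" for h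
    using that unfolding W_def by (auto simp: proj_pt_eq_iff)
  have zo: "zariski_open W" unfolding zariski_open_def
  proof
    show "W \<subseteq> CP" using proj_pt_in_CP by (auto simp: W_def)
    show "\<exists>F\<subseteq>vec_polys. \<forall>x. x \<noteq> 0 \<longrightarrow> (proj_pt x \<in> W) = (\<exists>f\<in>F. f x \<noteq> 0)"
      using g W_iff by (intro exI[of _ "{g}"]) auto
  qed
  have "W \<noteq> {}"
  proof -
    obtain h where "pairing h (a 0) = -1" "pairing h (a 1) = 0" "pairing h (a 2) = 0" "pairing h (a 3) = 1"
      using free unfolding free_coeffs_def by blast
    then have "g h \<noteq> 0" "h \<noteq> 0" by (auto simp: g_def disc3_def pairing_commute[of "a _"])
    then show ?thesis unfolding W_def by blast
  qed
  moreover have "finite (image_curve a \<inter> plane h) \<and> card (image_curve a \<inter> plane h) = 3"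
    if h: "h \<noteq> 0" "proj_pt h \<in> W" for h
  proof -
    have gh: "g h \<noteq> 0" using h W_iff by blast
    let ?f = "\<lambda>t. proj_pt (cubic a (aff t))"
    let ?R = "{t. pairing h (a 3) * t ^ 3 + pairing h (a 2) * t ^ 2 + pairing h (a 1) * t + pairing h (a 0) = 0}"
    have card: "card ?R = 3"
      using gh by (intro card_cubic_roots) (auto simp: g_def pairing_commute[of "a _"])
    have R: "t \<in> ?R \<longleftrightarrow> pairing h (cubic a (aff t)) = 0" for t
      by (simp add: cubic_expand pairing_simps algebra_simps)
    have "image_curve a \<inter> plane h = ?f ` ?R"
    proof (intro equalityI subsetI)
      fix p assume "p \<in> image_curve a \<inter> plane h"
      then obtain w where w: "w \<noteq> 0" "p = proj_pt (cubic a w)" "pairing h (cubic a w) = 0"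
        using in_plane_iff cubic_nonzero[OF free] by (auto simp: image_curve_def)
      have w2: "w $ 2 \<noteq> 0"
      proof
        assume "w $ 2 = 0"
        with w have "w $ 1 ^ 3 * pairing h (a 3) = 0" by (simp add: form_map_infinity pairing_simps)
        with gh have "w $ 1 = 0" by (auto simp: g_def pairing_commute[of "a _"])
        with \<open>w $ 2 = 0\<close> w(1) show False by (simp add: vec2_nonzero_iff)
      qed
      have eq: "cubic a w = w $ 2 ^ 3 *s cubic a (aff (w $ 1 / w $ 2))"
        using scale_aff[OF w2] form_map_scale by metis
      show "p \<in> ?f ` ?R"
      proof
        show "p = ?f (w $ 1 / w $ 2)" unfolding w(2) eq using w2 by (intro proj_pt_scale) simp
        show "w $ 1 / w $ 2 \<in> ?R" using w(3) w2 unfolding R eq by (simp add: pairing_simps)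
      qed
    next
      fix p assume "p \<in> ?f ` ?R"
      then obtain t where t: "p = ?f t" "pairing h (cubic a (aff t)) = 0" using R by blast
      then show "p \<in> image_curve a \<inter> plane h"
        using cubic_nonzero[OF free aff_simps(3)] by (auto simp: in_plane_iff image_curve_def intro!: exI[of _ "aff t"])
    qed
    moreover have "inj_on ?f ?R"
      using cubic_inj[OF free aff_simps(3) aff_simps(3)] proj_pt_aff_inj by (meson inj_onI)
    ultimately show ?thesis using card by (simp add: card_image card_ge_0_finite)
  qed
  ultimately show ?thesis unfolding curve_degree_def using zo by blast
qed

lemma rational_cubic_image_curve:
  assumes free: "free_coeffs a"
  shows "rational_cubic (image_curve a)"
  unfolding rational_cubic_def rational_curve_def
proof
  show "\<exists>m b. (\<forall>w. w \<noteq> 0 \<longrightarrow> form_map m b w \<noteq> 0) \<and> image_curve a = {proj_pt (form_map m b w) |w. w \<noteq> 0} \<and>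
    (\<exists>E. finite E \<and> (\<forall>w w'. w \<noteq> 0 \<longrightarrow> w' \<noteq> 0 \<longrightarrow> proj_pt w \<notin> E \<longrightarrow> proj_pt w' \<notin> E \<longrightarrow>
       proj_pt (form_map m b w) = proj_pt (form_map m b w') \<longrightarrow> proj_pt w = proj_pt w'))"
  proof (intro exI[of _ 3] exI[of _ a] conjI exI[of _ "{}"] allI impI)
    show "cubic a w \<noteq> 0" if "w \<noteq> 0" for w by (rule cubic_nonzero[OF free that])
    show "proj_pt w = proj_pt w'"
      if "w \<noteq> 0" "w' \<noteq> 0" "proj_pt (cubic a w) = proj_pt (cubic a w')" for w w'
      by (rule cubic_inj[OF free that])
  qed (simp_all add: image_curve_def)
  show "curve_degree (image_curve a) 3" by (rule curve_degree_free_cubic[OF free])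
qed

lemma rational_cubic_parametrization:
  assumes "rational_cubic C"
  obtains a where "\<And>w. w \<noteq> 0 \<Longrightarrow> cubic a w \<noteq> 0" "C = image_curve a"
proof -
  obtain m a E where *: "\<forall>w. w \<noteq> 0 \<longrightarrow> form_map m a w \<noteq> 0" "C = {proj_pt (form_map m a w) |w. w \<noteq> 0}"
    "finite E" "\<forall>w w'. w \<noteq> 0 \<longrightarrow> w' \<noteq> 0 \<longrightarrow> proj_pt w \<notin> E \<longrightarrow> proj_pt w' \<notin> E \<longrightarrow>
       proj_pt (form_map m a w) = proj_pt (form_map m a w') \<longrightarrow> proj_pt w = proj_pt w'"
    using assms unfolding rational_cubic_def rational_curve_def by blast
  have "3 = m"
    by (rule degree_of_parametrized_curve[of m a C E])
      (use * assms in \<open>auto simp: rational_cubic_def\<close>)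
  then show ?thesis using that[of a] * by (auto simp: image_curve_def)
qed

section \<open>Legendrian cubics through three points\<close>

text \<open>If \<open>m\<close> is the Pluecker matrix of \<open>u\<close> and \<open>v\<close>, this is the determinant with columns \<open>u\<close>, \<open>v\<close>, \<open>x\<close>, \<open>y\<close>,
  expanded along the first two columns.\<close>

definition bracket :: "complex^4^4 \<Rightarrow> complex^4 \<Rightarrow> complex^4 \<Rightarrow> complex"
  where "bracket m x y =
    m$1$2 * (x$3 * y$4 - x$4 * y$3) - m$1$3 * (x$2 * y$4 - x$4 * y$2) + m$1$4 * (x$2 * y$3 - x$3 * y$2)
    + m$2$3 * (x$1 * y$4 - x$4 * y$1) - m$2$4 * (x$1 * y$3 - x$3 * y$1) + m$3$4 * (x$1 * y$2 - x$2 * y$1)"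

abbreviation det4 :: "complex^4 \<Rightarrow> complex^4 \<Rightarrow> complex^4 \<Rightarrow> complex^4 \<Rightarrow> complex"
  where "det4 u v \<equiv> bracket (pluecker u v)"

lemma bracket_simps:
  "bracket m (x + x') y = bracket m x y + bracket m x' y"
  "bracket m x (y + y') = bracket m x y + bracket m x y'"
  "bracket m (x - x') y = bracket m x y - bracket m x' y"
  "bracket m x (y - y') = bracket m x y - bracket m x y'"
  "bracket m (c *s x) y = c * bracket m x y"
  "bracket m x (c *s y) = c * bracket m x y"
  by (simp_all add: bracket_def algebra_simps)

lemma bracket_self [simp]: "bracket m x x = 0"
  by (simp add: bracket_def algebra_simps)

lemma bracket_swap: "bracket m x y = - bracket m y x"
  by (simp add: bracket_def algebra_simps)

lemma bracket_scale_matrix: "(\<And>i j. m' $ i $ j = c * m $ i $ j) \<Longrightarrow> bracket m' x y = c * bracket m x y"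
  by (simp add: bracket_def algebra_simps)

lemma det4_repeated: "det4 u v u y = 0" "det4 u v v y = 0"
  by (simp_all add: bracket_def pluecker_def algebra_simps)

lemma det4_on_span:
  assumes "w \<in> vec.span {u, v}"
  shows "det4 u v x w = 0"
proof -
  have "vec.subspace {w. det4 u v x w = 0}"
    by (rule vec.subspaceI) (auto simp: bracket_simps, simp add: bracket_def)
  then have "vec.span {u, v} \<subseteq> {w. det4 u v x w = 0}"
    using det4_repeated bracket_swap[of "pluecker u v" x] by (intro vec.span_minimal) auto
  then show ?thesis using assms by blast
qed

lemma det4_cramer:
  "det4 u v x y *s w = det4 w v x y *s u + det4 u w x y *s v + det4 u v w y *s x + det4 u v x w *s y"
  by (simp add: vec_eq_iff forall_4 bracket_def pluecker_def algebra_simps)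

lemma in_span_by_det4:
  assumes "det4 u v x y \<noteq> 0" "det4 u v x w = 0" "det4 u v y w = 0"
  shows "w \<in> vec.span {u, v}"
proof -
  have "det4 u v w y = 0" using assms(3) bracket_swap by (metis neg_equal_0_iff_equal)
  hence "det4 u v x y *s w = det4 w v x y *s u + det4 u w x y *s v"
    using det4_cramer[of u v x y w] assms(2) by simp
  hence "inverse (det4 u v x y) *s (det4 u v x y *s w) \<in> vec.span {u, v}"
    by (metis insertI1 insertI2 vec.span_add vec.span_base vec.span_scale)
  then show ?thesis using assms(1) by simp
qed

definition pf :: "complex^4^4 \<Rightarrow> complex"
  where "pf J = J$1$2 * J$3$4 - J$1$3 * J$2$4 + J$1$4 * J$2$3"

text \<open>The 4-form \<open>B \<and> B\<close> is a multiple of the volume form. The identity is used to see that four vectors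
  are independent.\<close>

lemma pfaffian_identity:
  assumes "symplectic J"
  shows "pf J * det4 x y z w = bil J x y * bil J z w - bil J x z * bil J y w + bil J x w * bil J y z"
proof -
  have J: "J $ i $ j = bil J (axis j 1) (axis i 1)" for i j
    unfolding bil_def pairing_axis by (simp add: matrix_vector_mult_def axis_def if_distrib cong: if_cong)
  have skew: "J $ i $ j = - (J $ j $ i)" for i j
    unfolding J using symplectic_swap[OF assms] by blast
  have 0: "J $ i $ i = 0" for i unfolding J using symplectic_self[OF assms] .
  show ?thesis
    unfolding pf_def bracket_def pluecker_def bil_def pairing_def matrix_vector_mult_def sum_4 vec_lambda_beta
    unfolding skew[of 2 1] skew[of 3 1] skew[of 4 1] skew[of 3 2] skew[of 4 2] skew[of 4 3] 0
    by algebra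
qed

text \<open>The vectors \<open>X\<close> and \<open>Y\<close> represent two of the points, \<open>X + Y + N\<close> the third, and \<open>Z\<close> completes a basis.
  The normalization of \<open>B(Z, N)\<close> is the equation \<open>B(a\<^sub>1, a\<^sub>2) = - 3 B(a\<^sub>0, a\<^sub>3)\<close> for \<open>a\<^sub>1 = Z + s N\<close>,
  \<open>a\<^sub>2 = N - a\<^sub>1\<close>.\<close>

definition contact_frame :: "complex^4^4 \<Rightarrow> complex^4 \<Rightarrow> complex^4 \<Rightarrow> complex^4 \<Rightarrow> complex^4 \<Rightarrow> bool"
  where "contact_frame J X Y N Z \<longleftrightarrow> symplectic J \<and> bil J X Y \<noteq> 0 \<and> bil J X N = 0 \<and> bil J X Z = 0 \<and>
    bil J Y N = 0 \<and> bil J Y Z = 0 \<and> bil J Z N = - 3 * bil J X Y"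

definition frame_cubic ::
  "complex^4 \<Rightarrow> complex^4 \<Rightarrow> complex^4 \<Rightarrow> complex^4 \<Rightarrow> complex \<Rightarrow> nat \<Rightarrow> complex^4"
  where "frame_cubic X Y N Z s k =
    (if k = 0 then X else if k = 1 then Z + s *s N else if k = 2 then N - Z - s *s N else Y)"

context
  fixes J X Y N Z
  assumes fr: "contact_frame J X Y N Z"
begin

lemma frame_sympl: "symplectic J"
  using fr by (simp add: contact_frame_def)

lemma frame_bil:
  "bil J X Y \<noteq> 0" "bil J X N = 0" "bil J X Z = 0" "bil J Y N = 0" "bil J Y Z = 0" "bil J Z N = - 3 * bil J X Y"
  "bil J Y X = - bil J X Y" "bil J N X = 0" "bil J Z X = 0" "bil J N Y = 0" "bil J Z Y = 0" "bil J N Z = 3 * bil J X Y"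
  "bil J X X = 0" "bil J Y Y = 0" "bil J N N = 0" "bil J Z Z = 0"
  using fr symplectic_swap[OF frame_sympl, of Y X] symplectic_swap[OF frame_sympl, of N X]
    symplectic_swap[OF frame_sympl, of Z X] symplectic_swap[OF frame_sympl, of N Y]
    symplectic_swap[OF frame_sympl, of Z Y] symplectic_swap[OF frame_sympl, of N Z]
    symplectic_self[OF frame_sympl]
  unfolding contact_frame_def by auto

lemma frame_dual: "\<exists>h. pairing h X = dX \<and> pairing h Y = dY \<and> pairing h N = dN \<and> pairing h Z = dZ"
proof -
  let ?b = "bil J X Y"
  define h where "h = (- dX / ?b) *s (J *v Y) + (dY / ?b) *s (J *v X)
    + (dZ / (3 * ?b)) *s (J *v N) + (- dN / (3 * ?b)) *s (J *v Z)"
  have h: "pairing h v = (- dX / ?b) * bil J Y v + (dY / ?b) * bil J X v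
    + (dZ / (3 * ?b)) * bil J N v + (- dN / (3 * ?b)) * bil J Z v" for v
    by (simp add: h_def pairing_simps bil_def)
  show ?thesis using frame_bil(1) by (intro exI[of _ h]) (simp add: h frame_bil)
qed

lemma frame_coords_unique:
  assumes "x *s X + y *s Y + n *s N + z *s Z = x' *s X + y' *s Y + n' *s N + z' *s Z"
  shows "x = x'" "y = y'" "n = n'" "z = z'"
proof -
  have *: "x * a + y * b + n * c + z * d = x' * a + y' * b + n' * c + z' * d" for a b c d
    using frame_dual[of a b c d] arg_cong[OF assms, of "pairing _"] by (auto simp: pairing_simps)
  from *[of 1 0 0 0] *[of 0 1 0 0] *[of 0 0 1 0] *[of 0 0 0 1]
  show "x = x'" "y = y'" "n = n'" "z = z'" by simp_all
qed

lemma frame_expansion: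
  "v = (bil J v Y / bil J X Y) *s X + (bil J X v / bil J X Y) *s Y
     + (bil J Z v / bil J Z N) *s N + (bil J v N / bil J Z N) *s Z"
proof -
  define d where "d = v - ((bil J v Y / bil J X Y) *s X + (bil J X v / bil J X Y) *s Y
     + (bil J Z v / bil J Z N) *s N + (bil J v N / bil J Z N) *s Z)"
  have bZN: "bil J Z N \<noteq> 0" using frame_bil by simp
  have "bil J d X = 0" "bil J d Y = 0" "bil J d N = 0" "bil J d Z = 0"
    unfolding d_def bil_simps frame_bil using frame_bil(1) symplectic_swap[OF frame_sympl, of v]
    by (auto simp: frame_bil)
  note d0 = this
  have "pf J * det4 X Y N Z \<noteq> 0"
    unfolding pfaffian_identity[OF frame_sympl] by (simp add: frame_bil)
  hence det: "det4 X Y N Z \<noteq> 0" by auto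
  have "bil J d w = 0" for w
  proof -
    have "det4 X Y N Z * bil J d w = bil J d (det4 X Y N Z *s w)" by (simp add: bil_simps)
    also have "\<dots> = 0" unfolding det4_cramer[of X Y N Z w] by (simp add: bil_simps d0)
    finally show ?thesis using det by simp
  qed
  hence "d = 0" using frame_sympl unfolding symplectic_def by blast
  then show ?thesis unfolding d_def by (rule eq_iff_diff_eq_0[THEN iffD2])
qed

lemma frame_cubic_free: "free_coeffs (frame_cubic X Y N Z s)"
  unfolding free_coeffs_def
proof (intro allI)
  fix d0 d1 d2 d3
  obtain h where "pairing h X = d0" "pairing h Y = d3" "pairing h N = d1 + d2" "pairing h Z = d1 - s * (d1 + d2)"
    using frame_dual by blast
  then show "\<exists>h. pairing h (frame_cubic X Y N Z s 0) = d0 \<and> pairing h (frame_cubic X Y N Z s 1) = d1 \<and>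
      pairing h (frame_cubic X Y N Z s 2) = d2 \<and> pairing h (frame_cubic X Y N Z s 3) = d3"
    by (intro exI[of _ h]) (simp add: frame_cubic_def pairing_simps)
qed

lemma frame_cubic_legendrian: "legendrian_coeffs J (frame_cubic X Y N Z s)"
  by (simp add: legendrian_coeffs_def frame_cubic_def bil_simps frame_bil algebra_simps)

lemma cubic_frame_cubic:
  "cubic (frame_cubic X Y N Z s) (aff t)
    = 1 *s X + t ^ 3 *s Y + (s * (t - t\<^sup>2) + t\<^sup>2) *s N + (t - t\<^sup>2) *s Z"
  by (simp add: cubic_expand frame_cubic_def vec_eq_iff algebra_simps)

text \<open>The coordinates of \<open>F\<^sub>s(t)\<close> along \<open>X\<close>, \<open>Y\<close>, \<open>Z\<close> are \<open>1\<close>, \<open>t\<^sup>3\<close>, \<open>t - t\<^sup>2\<close>, whatever \<open>s\<close>. So a common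
  point of two members of the pencil comes from parameters with equal \<open>t\<^sup>3\<close> and equal \<open>t - t\<^sup>2\<close>. For
  \<open>t = 2\<close> these are equal only if the parameters are, and the coordinate along \<open>N\<close> then gives \<open>s\<close>.\<close>

lemma image_frame_cubic_inj:
  assumes "image_curve (frame_cubic X Y N Z s) = image_curve (frame_cubic X Y N Z s')"
  shows "s = s'"
proof -
  have "proj_pt (cubic (frame_cubic X Y N Z s') (aff 2)) \<in> image_curve (frame_cubic X Y N Z s)"
    unfolding assms unfolding image_curve_def using aff_simps(3) by blast
  then obtain w where w: "w \<noteq> 0" "proj_pt (cubic (frame_cubic X Y N Z s') (aff 2)) = proj_pt (cubic (frame_cubic X Y N Z s) w)"
    unfolding image_curve_def by blast
  then obtain c where c: "c \<noteq> 0" "cubic (frame_cubic X Y N Z s) w = c *s cubic (frame_cubic X Y N Z s') (aff 2)"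
    using proj_pt_eq_iff[OF cubic_nonzero[OF frame_cubic_free aff_simps(3)] cubic_nonzero[OF frame_cubic_free w(1)]]
    by blast
  have eq': "w $ 2 ^ 3 *s X + w $ 1 ^ 3 *s Y
      + (s * (w $ 1 * w $ 2 ^ 2) + (1 - s) * (w $ 1 ^ 2 * w $ 2)) *s N + (w $ 1 * w $ 2 ^ 2 - w $ 1 ^ 2 * w $ 2) *s Z
    = c *s X + (c * 8) *s Y + (c * (4 - 2 * s')) *s N + (c * (- 2)) *s Z"
    using c(2) unfolding cubic_frame_cubic
    by (simp add: cubic_expand frame_cubic_def vec_eq_iff algebra_simps)
  note e = frame_coords_unique[OF eq']
  have w2: "w $ 2 \<noteq> 0" using e(1) c(1) by auto
  define t where "t = w $ 1 / w $ 2"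
  have w1: "w $ 1 = t * w $ 2" using w2 by (simp add: t_def)
  have cc: "c = w $ 2 ^ 3" using e(1) by simp
  have "w $ 2 ^ 3 * (t ^ 3 - 8) = 0" "w $ 2 ^ 3 * (t - t\<^sup>2 + 2) = 0"
    "w $ 2 ^ 3 * (s * t + (1 - s) * t\<^sup>2 - 4 + 2 * s') = 0"
    using e(2-4) unfolding cc w1 by algebra+
  hence t: "t ^ 3 = 8" "t - t\<^sup>2 + 2 = 0" "s * t + (1 - s) * t\<^sup>2 - 4 + 2 * s' = 0" using w2 by auto
  have "t\<^sup>2 = t + 2" using t(2) by (simp add: algebra_simps)
  hence "3 * t + 2 = 8" using t(1) by algebra
  hence "t = 2" by simp
  then show ?thesis using t(3) by (simp add: algebra_simps)
qed

text \<open>The linear coordinates of the curve form a space of binary cubics that is either everything, and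
  then \<open>q = 1\<close> serves in the affine parameter, or a hyperplane. In the latter case the requirement that
  it contains \<open>w\<^sub>1 q\<close> and \<open>w\<^sub>2 q\<close> is a pair of linear equations for the three coefficients of \<open>q\<close>. The
  span of the coefficients contains \<open>X\<close>, \<open>Y\<close> and \<open>N\<close>, so the space is not smaller than a hyperplane.\<close>

lemma exists_nodal_projection:
  assumes a: "a 0 = x *s X" "a 3 = y *s Y" "a 0 + a 1 + a 2 + a 3 = X + Y + N" and xy: "x \<noteq> 0" "y \<noteq> 0"
  shows "\<exists>q0 q1 q2 hY hZ. (q0 \<noteq> 0 \<or> q1 \<noteq> 0 \<or> q2 \<noteq> 0) \<and>
    pairing hZ (a 0) = q0 \<and> pairing hZ (a 1) = q1 \<and> pairing hZ (a 2) = q2 \<and> pairing hZ (a 3) = 0 \<and>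
    pairing hY (a 0) = 0 \<and> pairing hY (a 1) = q0 \<and> pairing hY (a 2) = q1 \<and> pairing hY (a 3) = q2"
proof -
  obtain x1 y1 n1 z1 where a1: "a 1 = x1 *s X + y1 *s Y + n1 *s N + z1 *s Z"
    using frame_expansion[of "a 1"] by blast
  define A where "A = x1 / x + n1 * (1 - 1 / x)"
  define B where "B = y1 / y + n1 * (1 - 1 / y)"
  have realize: "\<exists>h. pairing h (a 0) = d0 \<and> pairing h (a 1) = d1 \<and> pairing h (a 2) = d2 \<and> pairing h (a 3) = d3"
    if "z1 \<noteq> 0 \<or> d1 = A * d0 + B * d3 + n1 * (d1 + d2)" for d0 d1 d2 d3
  proof -
    define n where "n = d0 + d1 + d2 + d3 - d0 / x - d3 / y"
    define z where "z = (d1 - x1 * (d0 / x) - y1 * (d3 / y) - n1 * n) / z1"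
    obtain h where h: "pairing h X = d0 / x" "pairing h Y = d3 / y" "pairing h N = n" "pairing h Z = z"
      using frame_dual by blast
    have 0: "pairing h (a 0) = d0" "pairing h (a 3) = d3" using a h xy by (simp_all add: pairing_simps)
    have sum: "pairing h (a 0) + pairing h (a 1) + pairing h (a 2) + pairing h (a 3) = d0 + d1 + d2 + d3"
      using arg_cong[OF a(3), of "pairing h"] by (simp add: pairing_simps h n_def)
    have 1: "pairing h (a 1) = d1"
    proof (cases "z1 = 0")
      case True
      then have "d1 = A * d0 + B * d3 + n1 * (d1 + d2)" using that by blast
      also have "\<dots> = x1 * (d0 / x) + y1 * (d3 / y) + n1 * n"
        by (simp add: A_def B_def n_def algebra_simps)
      finally show ?thesis using True by (simp add: a1 pairing_simps h)
    next
      case False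
      then show ?thesis by (simp add: a1 pairing_simps h z_def)
    qed
    show ?thesis using 0 1 sum by (intro exI[of _ h]) simp
  qed
  show ?thesis
  proof (cases "z1 = 0")
    case False
    then obtain hY hZ where
      "pairing hZ (a 0) = 1 \<and> pairing hZ (a 1) = 0 \<and> pairing hZ (a 2) = 0 \<and> pairing hZ (a 3) = 0"
      "pairing hY (a 0) = 0 \<and> pairing hY (a 1) = 1 \<and> pairing hY (a 2) = 0 \<and> pairing hY (a 3) = 0"
      using realize by meson
    then show ?thesis by (intro exI[of _ 1] exI[of _ 0] exI[of _ hY] exI[of _ hZ]) auto
  next
    case True
    \<comment> \<open>The rows \<open>(A, n1 - 1, n1)\<close> and \<open>(n1 - 1, n1, B)\<close> have their cross product in the kernel. If it
      vanishes, the rows are proportional, and any nonzero vector killed by the first one will do.\<close>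
    have "\<exists>q0 q1 q2. (q0 \<noteq> 0 \<or> q1 \<noteq> 0 \<or> q2 \<noteq> 0) \<and>
      q1 = A * q0 + B * 0 + n1 * (q1 + q2) \<and> q0 = A * 0 + B * q2 + n1 * (q0 + q1)"
    proof (cases "(n1 - 1) * B - n1\<^sup>2 = 0 \<and> n1 * (n1 - 1) - A * B = 0 \<and> A * n1 - (n1 - 1)\<^sup>2 = 0")
      case True
      have "n1 \<noteq> 0 \<or> 1 - n1 \<noteq> 0" by auto
      moreover have "n1 = A * 0 + B * 0 + n1 * (n1 + (1 - n1))" by algebra
      moreover have "0 = A * 0 + B * (1 - n1) + n1 * (0 + n1)" using True by algebra
      ultimately show ?thesis by blast
    next
      case False
      have "n1 * (n1 - 1) - A * B = A * ((n1 - 1) * B - n1\<^sup>2) + B * 0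
        + n1 * ((n1 * (n1 - 1) - A * B) + (A * n1 - (n1 - 1)\<^sup>2))" by algebra
      moreover have "(n1 - 1) * B - n1\<^sup>2 = A * 0 + B * (A * n1 - (n1 - 1)\<^sup>2)
        + n1 * (((n1 - 1) * B - n1\<^sup>2) + (n1 * (n1 - 1) - A * B))" by algebra
      ultimately show ?thesis using False by blast
    qed
    then obtain q0 q1 q2 where q: "q0 \<noteq> 0 \<or> q1 \<noteq> 0 \<or> q2 \<noteq> 0"
      "q1 = A * q0 + B * 0 + n1 * (q1 + q2)" "q0 = A * 0 + B * q2 + n1 * (q0 + q1)" by blast
    from realize[of q1 q0 0 q2] realize[of q0 0 q2 q1] q show ?thesis by blast
  qed
qed

text \<open>Pairing the equation for the third point with \<open>Y\<close> and \<open>X\<close> fixes the scale of the outer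
  coefficients; the pairing of \<open>a\<^sub>1\<close> with \<open>N\<close> then fixes its component along \<open>Z\<close>.\<close>

lemma legendrian_through_frame_points:
  assumes a: "a 0 = x *s X" "a 3 = y *s Y" "a 0 + a 1 + a 2 + a 3 = X + Y + N" and xy: "x \<noteq> 0" "y \<noteq> 0"
    and leg: "legendrian_coeffs J a"
  shows "\<exists>s. \<forall>k\<in>{0, 1, 2, 3}. a k = frame_cubic X Y N Z s k"
proof -
  have B: "bil J X (a 1) = 0" "bil J X (a 2) = 0" "bil J (a 1) Y = 0" "bil J (a 2) Y = 0"
    "bil J (a 1) (a 2) = - 3 * x * y * bil J X Y"
    using leg xy unfolding legendrian_coeffs_def a by (auto simp: bil_simps)
  have "x = 1"
    using arg_cong[OF a(3), of "\<lambda>v. bil J v Y"] frame_bil(1) by (simp add: a bil_simps B frame_bil del: One_nat_def)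
  moreover have "y = 1"
    using arg_cong[OF a(3), of "bil J X"] frame_bil(1) by (simp add: a bil_simps B frame_bil del: One_nat_def)
  ultimately have a03: "a 0 = X" "a 3 = Y" and a12: "a 2 = N - a 1" using a by (auto simp: algebra_simps)
  have "bil J (a 1) N = - 3 * bil J X Y"
    using B(5) \<open>x = 1\<close> \<open>y = 1\<close> unfolding a12 by (simp add: bil_simps symplectic_self[OF frame_sympl])
  hence "a 1 = Z + (bil J Z (a 1) / bil J Z N) *s N"
    using frame_expansion[of "a 1"] B frame_bil by simp
  then show ?thesis
    by (intro exI[of _ "bil J Z (a 1) / bil J Z N"]) (auto simp: frame_cubic_def a03 a12 algebra_simps)
qed

end

lemma cubic_cong: "(\<And>k. k \<in> {0, 1, 2, 3} \<Longrightarrow> a k = b k) \<Longrightarrow> cubic a = cubic b"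
  by (simp add: cubic_expand fun_eq_iff)

lemma cubic_substitution:
  "\<exists>b. \<forall>w. cubic b w = cubic a (w $ 1 *s A + w $ 2 *s D)"
proof -
  \<comment> \<open>The coefficients of the expanded form, obtained by collecting powers of \<open>w\<^sub>1\<close> and \<open>w\<^sub>2\<close>.\<close>
  define b where "b k = (if k = (0::nat) then
      D$2^3 *s a 0 + (D$1 * D$2^2) *s a 1 + (D$1^2 * D$2) *s a 2 + D$1^3 *s a 3
    else if k = 1 then (3 * A$2 * D$2^2) *s a 0 + (A$1 * D$2^2 + 2 * D$1 * A$2 * D$2) *s a 1
      + (2 * A$1 * D$1 * D$2 + D$1^2 * A$2) *s a 2 + (3 * A$1 * D$1^2) *s a 3
    else if k = 2 then (3 * A$2^2 * D$2) *s a 0 + (2 * A$1 * A$2 * D$2 + D$1 * A$2^2) *s a 1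
      + (A$1^2 * D$2 + 2 * A$1 * D$1 * A$2) *s a 2 + (3 * A$1^2 * D$1) *s a 3
    else A$2^3 *s a 0 + (A$1 * A$2^2) *s a 1 + (A$1^2 * A$2) *s a 2 + A$1^3 *s a 3)" for k
  have "cubic b w = cubic a (w $ 1 *s A + w $ 2 *s D)" for w
    unfolding cubic_expand b_def
    by (simp add: vec_eq_iff algebra_simps power2_eq_square power3_eq_cube)
  then show ?thesis by blast
qed

lemma image_curve_scale:
  assumes "c \<noteq> 0"
  shows "image_curve (\<lambda>k. c *s a k) = image_curve a" "cubic (\<lambda>k. c *s a k) w = c *s cubic a w"
proof -
  show eq: "cubic (\<lambda>k. c *s a k) w = c *s cubic a w" for w
    by (simp add: cubic_expand vec.scale_right_distrib mult.commute)
  show "image_curve (\<lambda>k. c *s a k) = image_curve a"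
    unfolding image_curve_def eq by (simp add: proj_pt_scale[OF assms])
qed

lemma vec2_basis:
  assumes "A $ 1 * D $ 2 \<noteq> A $ 2 * (D $ 1 :: complex)"
  obtains c d where "w = c *s A + d *s (D :: complex^2)"
proof
  define e where "e = A $ 1 * D $ 2 - A $ 2 * D $ 1"
  define c where "c = (w $ 1 * D $ 2 - w $ 2 * D $ 1) / e"
  define d where "d = (A $ 1 * w $ 2 - A $ 2 * w $ 1) / e"
  have e: "e \<noteq> 0" using assms by (simp add: e_def)
  have "c * e = w $ 1 * D $ 2 - w $ 2 * D $ 1" "d * e = A $ 1 * w $ 2 - A $ 2 * w $ 1"
    using e by (simp_all add: c_def d_def)
  hence "e * (w $ 1 - (c * A $ 1 + d * D $ 1)) = 0" "e * (w $ 2 - (c * A $ 2 + d * D $ 2)) = 0"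
    using e_def by algebra+
  hence "w $ 1 = c * A $ 1 + d * D $ 1" "w $ 2 = c * A $ 2 + d * D $ 2" using e by auto
  then show "w = c *s A + d *s D" by (simp only: vec_eq_iff forall_2 vector_add_component vector_smult_component)
qed

lemma vec2_dependent:
  assumes "A $ 1 * D $ 2 = A $ 2 * (D $ 1 :: complex)" "A \<noteq> 0" "D \<noteq> (0 :: complex^2)"
  obtains c where "c \<noteq> 0" "D = c *s A"
proof (cases "A $ 1 = 0")
  case True
  then have A2: "A $ 2 \<noteq> 0" using assms(2) by (simp add: vec2_nonzero_iff)
  then have "D $ 1 = 0" using assms(1) True by simp
  moreover have "D $ 2 \<noteq> 0" using assms(3) calculation by (simp add: vec2_nonzero_iff)
  ultimately show ?thesis using True A2 that[of "D $ 2 / A $ 2"] by (simp add: vec_eq_iff forall_2)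
next
  case False
  then have D2: "D $ 2 = D $ 1 / A $ 1 * A $ 2" using assms(1) by (simp add: field_simps)
  moreover have "D $ 1 \<noteq> 0" using assms(3) D2 by (auto simp: vec2_nonzero_iff)
  ultimately show ?thesis using False that[of "D $ 1 / A $ 1"] by (simp add: vec_eq_iff forall_2)
qed

lemma proj_pt_ne_of_bil:
  assumes "symplectic J" "bil J x y \<noteq> 0" shows "proj_pt x \<noteq> proj_pt y"
proof
  assume eq: "proj_pt x = proj_pt y"
  have "x \<noteq> 0" "y \<noteq> 0" using assms(2) by auto
  then obtain c where "y = c *s x" using proj_pt_eq_iff[OF \<open>x \<noteq> 0\<close> \<open>y \<noteq> 0\<close>] eq by blast
  then show False using assms symplectic_self by (simp add: bil_simps)
qed

text \<open>The group of the projective line is transitive on triples of distinct points, so the three given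
  points may be placed at \<open>t = 0\<close>, \<open>t = \<infinity>\<close> and \<open>t = 1\<close>.\<close>

lemma normalize_parametrization:
  assumes nz: "\<And>w. w \<noteq> 0 \<Longrightarrow> cubic a w \<noteq> 0"
    and in_C: "proj_pt X \<in> image_curve a" "proj_pt Y \<in> image_curve a" "proj_pt W \<in> image_curve a"
    and ne: "X \<noteq> 0" "Y \<noteq> 0" "W \<noteq> 0" "proj_pt X \<noteq> proj_pt Y" "proj_pt X \<noteq> proj_pt W" "proj_pt Y \<noteq> proj_pt W"
  obtains b x y where "x \<noteq> 0" "y \<noteq> 0" "b 0 = x *s X" "b 3 = y *s Y" "b 0 + b 1 + b 2 + b 3 = W"
    "image_curve b = image_curve a" "\<And>w. w \<noteq> 0 \<Longrightarrow> cubic b w \<noteq> 0"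
proof -
  have ex: "\<exists>w c. w \<noteq> 0 \<and> c \<noteq> 0 \<and> cubic a w = c *s V" if V: "proj_pt V \<in> image_curve a" "V \<noteq> 0" for V
  proof -
    obtain w where w: "w \<noteq> 0" "proj_pt V = proj_pt (cubic a w)" using V(1) by (auto simp: image_curve_def)
    then show ?thesis using proj_pt_eq_iff[OF V(2) nz[OF w(1)]] by blast
  qed
  obtain wX cX where X: "wX \<noteq> 0" "cX \<noteq> 0" "cubic a wX = cX *s X" using ex in_C ne by blast
  obtain wY cY where Y: "wY \<noteq> 0" "cY \<noteq> 0" "cubic a wY = cY *s Y" using ex in_C ne by blast
  obtain wW cW where W: "wW \<noteq> 0" "cW \<noteq> 0" "cubic a wW = cW *s W" using ex in_C ne by blast
  have same: "proj_pt V = proj_pt V'"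
    if "cubic a w = e *s V" "cubic a w' = e' *s V'" "w' = c *s w" "c \<noteq> 0" "e \<noteq> 0" "e' \<noteq> 0" for V V' w w' c e e'
  proof -
    have "e' *s V' = (c ^ 3 * e) *s V" using that by (metis form_map_scale vector_smult_assoc)
    then have "proj_pt (e' *s V') = proj_pt V" using that(4,5) by (simp add: proj_pt_scale)
    then show ?thesis using that(6) by (simp add: proj_pt_scale)
  qed
  have "wY $ 1 * wX $ 2 \<noteq> wY $ 2 * wX $ 1"
    using vec2_dependent[of wY wX] X Y same[of wY cY Y wX cX X] ne(4) by metis
  then obtain c d where cd: "wW = c *s wY + d *s wX" by (rule vec2_basis)
  have c: "c \<noteq> 0"
  proof
    assume "c = 0"
    then have "wW = d *s wX" "d \<noteq> 0" using cd W(1) by auto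
    then show False using same[of wX cX X wW cW W] X W ne(5) by metis
  qed
  have d: "d \<noteq> 0"
  proof
    assume "d = 0"
    then have "wW = c *s wY" using cd by simp
    then show False using same[of wY cY Y wW cW W] c Y W ne(6) by metis
  qed
  define A where "A = c *s wY"
  define D where "D = d *s wX"
  have AD: "A $ 1 * D $ 2 \<noteq> A $ 2 * D $ 1"
    using c d \<open>wY $ 1 * wX $ 2 \<noteq> wY $ 2 * wX $ 1\<close> by (simp add: A_def D_def)
  obtain b where b: "\<And>w. cubic b w = cubic a (w $ 1 *s A + w $ 2 *s D)"
    using cubic_substitution by blast
  have comb_nz: "w $ 1 *s A + w $ 2 *s D \<noteq> 0" if "w \<noteq> 0" for w :: "complex^2"
  proof
    assume "w $ 1 *s A + w $ 2 *s D = 0"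
    then have "w $ 1 * A $ 1 + w $ 2 * D $ 1 = 0" "w $ 1 * A $ 2 + w $ 2 * D $ 2 = 0"
      by (simp_all add: vec_eq_iff forall_2)
    then have "w $ 1 * (A $ 1 * D $ 2 - A $ 2 * D $ 1) = 0" "w $ 2 * (A $ 1 * D $ 2 - A $ 2 * D $ 1) = 0"
      by algebra+
    then show False using AD that by (simp add: vec2_nonzero_iff)
  qed
  have image: "image_curve b = image_curve a"
  proof (intro equalityI subsetI)
    fix p assume "p \<in> image_curve b"
    then show "p \<in> image_curve a" using comb_nz by (auto simp: image_curve_def b)
  next
    fix p assume "p \<in> image_curve a"
    then obtain w where w: "w \<noteq> 0" "p = proj_pt (cubic a w)" unfolding image_curve_def by blast
    obtain c' d' where cd': "w = c' *s A + d' *s D" using vec2_basis[OF AD] .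
    define w' :: "complex^2" where "w' = vector [c', d']"
    have "cubic b w' = cubic a w" by (simp add: b w'_def cd')
    moreover have "w' \<noteq> 0" using cd' w(1) by (auto simp: w'_def vec2_nonzero_iff)
    ultimately show "p \<in> image_curve b" using w(2) unfolding image_curve_def by (metis (mono_tags, lifting) mem_Collect_eq)
  qed
  have b0: "b 0 = cubic a D" using b[of "vector [0, 1]"] by (simp add: cubic_expand[of b])
  have b3: "b 3 = cubic a A" using b[of "vector [1, 0]"] by (simp add: cubic_expand[of b])
  have bW: "b 0 + b 1 + b 2 + b 3 = cubic a wW"
    using b[of "vector [1, 1]"] by (simp add: cubic_expand[of b] cd A_def D_def)
  define b' where "b' = (\<lambda>k. inverse cW *s b k)"
  show ?thesis
  proof
    show "inverse cW * d ^ 3 * cX \<noteq> 0" "inverse cW * c ^ 3 * cY \<noteq> 0" using W X Y c d by auto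
    show "b' 0 = (inverse cW * d ^ 3 * cX) *s X"
      unfolding b'_def b0 D_def form_map_scale X(3) by (simp add: mult.assoc)
    show "b' 3 = (inverse cW * c ^ 3 * cY) *s Y"
      unfolding b'_def b3 A_def form_map_scale Y(3) by (simp add: mult.assoc)
    have "b' 0 + b' 1 + b' 2 + b' 3 = inverse cW *s (b 0 + b 1 + b 2 + b 3)"
      by (simp add: b'_def vec.scale_right_distrib)
    also have "\<dots> = W" unfolding bW W(3) using W(2) by simp
    finally show "b' 0 + b' 1 + b' 2 + b' 3 = W" .
    show "image_curve b' = image_curve a" using image image_curve_scale(1)[of "inverse cW" b] W(2) by (simp add: b'_def)
    show "cubic b' w \<noteq> 0" if "w \<noteq> 0" for w
      using nz[OF comb_nz[OF that]] W(2) image_curve_scale(2)[of "inverse cW" b w] by (simp add: b'_def b)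
  qed
qed

text \<open>For \<open>t, t', t''\<close> the roots of the cubic \<open>K(t) = k3 t\<^sup>3 - k1 t\<^sup>2 + k1 t + k0\<close>, the curve belonging to
  \<open>t\<close> and \<open>t'\<close> would be the same, and \<open>L\<close> a secant of it, only if \<open>b t'' = a\<close> with the \<open>a\<close> and
  \<open>b\<close> below. The value is that of the homogenized cubic at \<open>(a, b)\<close>, that is, \<open>b\<^sup>3 K(a / b)\<close> if \<open>b \<noteq> 0\<close>.\<close>

definition secant_poly :: "complex \<Rightarrow> complex \<Rightarrow> complex \<Rightarrow> complex \<Rightarrow> complex"
  where "secant_poly k0 k1 k3 M =
    (let a = - k0 * (k3 + M); b = k3 * (M - k0) in k3 * a ^ 3 - k1 * a\<^sup>2 * b + k1 * a * b\<^sup>2 + k0 * b ^ 3)"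

text \<open>In the application \<open>k0, k1, k3, M\<close> are the brackets \<open>[N X], [N Z], [N Y], [X Y]\<close> with the line.
  The factors say that the cubic \<open>K\<close> does not have the roots \<open>0\<close>, \<open>\<infinity>\<close>, \<open>1\<close>, that its roots are distinct,
  and that they belong to distinct curves.\<close>

definition pencil_poly :: "complex \<Rightarrow> complex \<Rightarrow> complex \<Rightarrow> complex \<Rightarrow> complex"
  where "pencil_poly k0 k1 k3 M = k0 * k3 * (k0 + k3) * disc3 k3 (- k1) k1 k0 * secant_poly k0 k1 k3 M"

text \<open>The hypothesis on \<open>t\<close> and \<open>t'\<close> is the equality of the parameters \<open>s\<close> of the two curves. Divided by
  \<open>t - t'\<close>, it becomes a condition on the elementary symmetric functions of \<open>t\<close> and \<open>t'\<close>, which by Vieta is a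
  linear equation for the third root.\<close>

lemma distinct_parameters:
  assumes k3: "k3 \<noteq> 0" and res: "secant_poly k0 k1 k3 M \<noteq> 0"
    and t: "k3 * t ^ 3 - k1 * t\<^sup>2 + k1 * t + k0 = 0" "k3 * t' ^ 3 - k1 * t'\<^sup>2 + k1 * t' + k0 = 0"
    and s: "(M * t\<^sup>2 - k0 * t) * (1 - t') = (M * t'\<^sup>2 - k0 * t') * (1 - t)"
  shows "t = t'"
proof (rule ccontr)
  assume "t \<noteq> t'"
  then have ne: "t - t' \<noteq> 0" by simp
  have "(t - t') * (M * (t + t' - t * t') - k0) = 0" using s by algebra
  hence 1: "M * (t + t' - t * t') = k0" using ne by simp
  have "(t - t') * (k3 * (t\<^sup>2 + t * t' + t'\<^sup>2) - k1 * (t + t') + k1) = 0" using t by algebra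
  hence 2: "k3 * (t\<^sup>2 + t * t' + t'\<^sup>2) - k1 * (t + t') + k1 = 0" using ne by simp
  define t'' where "t'' = k1 / k3 - t - t'"
  have k1: "k1 = k3 * (t + t' + t'')" using k3 by (simp add: t''_def)
  have "k3 * (t * t' + (t + t') * t'' - (t + t' + t'')) = 0" using 2 unfolding k1 by algebra
  hence e: "t * t' + (t + t') * t'' = t + t' + t''" using k3 by simp
  have k0: "k0 = - k3 * (t * t' * t'')" using t(1) e unfolding k1 by algebra
  have a: "- k0 * (k3 + M) = k3 * (M - k0) * t''" using 1 e k0 by algebra
  have root: "k3 * t'' ^ 3 - k1 * t''\<^sup>2 + k1 * t'' + k0 = 0" using e k0 k1 by algebra
  have "secant_poly k0 k1 k3 M = (k3 * (M - k0)) ^ 3 * (k3 * t'' ^ 3 - k1 * t''\<^sup>2 + k1 * t'' + k0)"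
    unfolding secant_poly_def Let_def a by algebra
  then show False using res root by simp
qed

text \<open>The line is the intersection of the planes joining it to \<open>N\<close> and to \<open>X\<close>. The first one contains
  \<open>F\<^sub>s(t)\<close> if and only if \<open>t\<close> is a root of a cubic not involving \<open>s\<close>, and the second one then determines \<open>s\<close>.
  So the curves in question correspond to the three roots.\<close>

theorem three_legendrian_cubics:
  assumes fr: "contact_frame J X Y N Z"
    and gp: "pencil_poly (det4 u v N X) (det4 u v N Z) (det4 u v N Y) (det4 u v X Y) \<noteq> 0"
  shows "card {C. rational_cubic C \<and> sympl_legendrian J C \<and> proj_pt X \<in> C \<and> proj_pt Y \<in> C \<and>
    proj_pt (X + Y + N) \<in> C \<and> (\<exists>x\<in>C. x \<subseteq> vec.span {u, v})} = 3" (is "card ?S = 3")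
proof -
  define k0 k1 k3 M where k_def: "k0 = det4 u v N X" "k1 = det4 u v N Z" "k3 = det4 u v N Y" "M = det4 u v X Y"
  have k: "k0 \<noteq> 0" "k3 \<noteq> 0" "k0 + k3 \<noteq> 0" "disc3 k3 (- k1) k1 k0 \<noteq> 0" "secant_poly k0 k1 k3 M \<noteq> 0"
    using gp unfolding pencil_poly_def k_def by auto
  define T where "T = {t. k3 * t ^ 3 - k1 * t\<^sup>2 + k1 * t + k0 = 0}"
  have T_ne: "t \<noteq> 0" "t \<noteq> 1" if "t \<in> T" for t
    using that k by (auto simp: T_def add.commute)
  have cardT: "card T = 3" using card_cubic_roots[OF k(2,4)] by (simp add: T_def)
  define D where "D = det4 u v X N"
  have D: "D = - k0" unfolding D_def k_def by (rule bracket_swap)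
  define z where "z = det4 u v X Z"
  \<comment> \<open>The value of \<open>s\<close> for which \<open>F\<^sub>s(t)\<close> lies in the plane spanned by the line and \<open>X\<close>.\<close>
  define slope where "slope = (\<lambda>t. - (z * (1 - t) + D * t + M * t\<^sup>2) / (D * (1 - t)))"
  let ?F = "\<lambda>s. cubic (frame_cubic X Y N Z s)"
  let ?C = "\<lambda>s. image_curve (frame_cubic X Y N Z s)"
  let ?L = "vec.span {u, v}"
  have brN: "det4 u v N (?F s (aff t)) = k3 * t ^ 3 - k1 * t\<^sup>2 + k1 * t + k0" for s t
    unfolding cubic_frame_cubic[OF fr] bracket_simps bracket_self k_def by (simp add: algebra_simps)
  have brX: "det4 u v X (?F s (aff t)) = t * (z * (1 - t) + D * (s * (1 - t) + t) + M * t\<^sup>2)" for s t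
    unfolding cubic_frame_cubic[OF fr] bracket_simps bracket_self k_def z_def D_def
    by (simp add: algebra_simps power2_eq_square power3_eq_cube)
  have meets: "?F s (aff t) \<in> ?L \<longleftrightarrow> t \<in> T \<and> s = slope t" for s t
  proof
    assume "?F s (aff t) \<in> ?L"
    then have 0: "det4 u v N (?F s (aff t)) = 0" "det4 u v X (?F s (aff t)) = 0"
      by (auto intro: det4_on_span)
    then have t: "t \<in> T" unfolding brN T_def by simp
    with 0(2) have "z * (1 - t) + D * (s * (1 - t) + t) + M * t\<^sup>2 = 0" unfolding brX using T_ne by simp
    then have "s * (D * (1 - t)) = - (z * (1 - t) + D * t + M * t\<^sup>2)" by algebra
    moreover have ne: "D * (1 - t) \<noteq> 0" using D k(1) T_ne(2)[OF t] by simp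
    ultimately have "s = slope t" unfolding slope_def by (intro nonzero_eq_divide_eq[OF ne, THEN iffD2])
    with t show "t \<in> T \<and> s = slope t" ..
  next
    assume t: "t \<in> T \<and> s = slope t"
    then have "s * (D * (1 - t)) = - (z * (1 - t) + D * t + M * t\<^sup>2)"
      using T_ne(2) D k(1) by (simp add: slope_def)
    then have "z * (1 - t) + D * (s * (1 - t) + t) + M * t\<^sup>2 = 0" by algebra
    then have "det4 u v X (?F s (aff t)) = 0" unfolding brX by simp
    moreover have "det4 u v N (?F s (aff t)) = 0" unfolding brN using t by (simp add: T_def)
    ultimately show "?F s (aff t) \<in> ?L" using k(1) by (intro in_span_by_det4[of u v N X]) (auto simp: k_def)
  qed
  have slope_inj: "inj_on slope T"
  proof (rule inj_onI)
    fix t t' assume t: "t \<in> T" "t' \<in> T" "slope t = slope t'"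
    have "D * (1 - t) \<noteq> 0" "D * (1 - t') \<noteq> 0"
      using T_ne(2)[OF t(1)] T_ne(2)[OF t(2)] D k(1) by auto
    then have "- (z * (1 - t) + D * t + M * t\<^sup>2) * (D * (1 - t')) = - (z * (1 - t') + D * t' + M * t'\<^sup>2) * (D * (1 - t))"
      using t(3) unfolding slope_def by (subst (asm) frac_eq_eq)
    then have "D * ((M * t\<^sup>2 + D * t) * (1 - t') - (M * t'\<^sup>2 + D * t') * (1 - t)) = 0" by algebra
    then have "(M * t\<^sup>2 - k0 * t) * (1 - t') = (M * t'\<^sup>2 - k0 * t') * (1 - t)" using D k(1) by simp
    then show "t = t'" using distinct_parameters[OF k(2,5)] t(1,2) unfolding T_def by blast
  qed
  have XYN: "X \<noteq> 0" "Y \<noteq> 0" "X + Y + N \<noteq> 0" "proj_pt X \<noteq> proj_pt Y"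
    "proj_pt X \<noteq> proj_pt (X + Y + N)" "proj_pt Y \<noteq> proj_pt (X + Y + N)"
  proof -
    have b: "bil J X Y \<noteq> 0" "bil J X (X + Y + N) \<noteq> 0" "bil J Y (X + Y + N) \<noteq> 0"
      by (simp_all add: bil_simps frame_bil[OF fr])
    then show "X \<noteq> 0" "Y \<noteq> 0" "X + Y + N \<noteq> 0" by auto
    show "proj_pt X \<noteq> proj_pt Y" "proj_pt X \<noteq> proj_pt (X + Y + N)" "proj_pt Y \<noteq> proj_pt (X + Y + N)"
      using b proj_pt_ne_of_bil[OF frame_sympl[OF fr]] by blast+
  qed
  have "?S = ?C ` slope ` T"
  proof (intro equalityI subsetI)
    fix C assume "C \<in> ?C ` slope ` T"
    then obtain t where t: "t \<in> T" "C = ?C (slope t)" by blast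
    let ?s = "slope t"
    have free: "free_coeffs (frame_cubic X Y N Z ?s)" by (rule frame_cubic_free[OF fr])
    have in_C: "proj_pt (?F ?s w) \<in> C" if "w \<noteq> 0" for w using that t(2) by (auto simp: image_curve_def)
    have "?F ?s (aff 0) = X" "?F ?s (aff 1) = X + Y + N" "?F ?s (vector [1, 0]) = Y"
      by (simp_all add: cubic_expand frame_cubic_def)
    then have "proj_pt X \<in> C" "proj_pt (X + Y + N) \<in> C" "proj_pt Y \<in> C"
      using in_C[of "aff 0"] in_C[of "aff 1"] in_C[of "vector [1, 0]"] by (auto simp: vec2_nonzero_iff)
    moreover have "\<exists>x\<in>C. x \<subseteq> ?L"
    proof (rule bexI)
      show "proj_pt (?F ?s (aff t)) \<subseteq> ?L"
        unfolding proj_pt_def using meets t(1) by (intro vec.span_minimal) auto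
    qed (rule in_C, simp)
    moreover have "rational_cubic C" unfolding t(2) by (rule rational_cubic_image_curve[OF free])
    moreover have "sympl_legendrian J C" unfolding t(2)
      by (rule legendrian_coeffs_sufficient[OF frame_sympl[OF fr] free frame_cubic_legendrian[OF fr]])
    ultimately show "C \<in> ?S" by blast
  next
    fix C assume C: "C \<in> ?S"
    then obtain a where a: "\<And>w. w \<noteq> 0 \<Longrightarrow> cubic a w \<noteq> 0" "C = image_curve a"
      using rational_cubic_parametrization by blast
    have in_C: "proj_pt X \<in> image_curve a" "proj_pt Y \<in> image_curve a" "proj_pt (X + Y + N) \<in> image_curve a"
      using C a(2) by auto
    obtain b x y where b: "x \<noteq> 0" "y \<noteq> 0" "b 0 = x *s X" "b 3 = y *s Y" "b 0 + b 1 + b 2 + b 3 = X + Y + N"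
      "image_curve b = image_curve a" "\<And>w. w \<noteq> 0 \<Longrightarrow> cubic b w \<noteq> 0"
      by (rule normalize_parametrization[OF a(1) in_C XYN]) (assumption, rule that)
    obtain q0 q1 q2 hY hZ where q: "q0 \<noteq> 0 \<or> q1 \<noteq> 0 \<or> q2 \<noteq> 0"
      and hZ: "pairing hZ (b 0) = q0" "pairing hZ (b 1) = q1" "pairing hZ (b 2) = q2" "pairing hZ (b 3) = 0"
      and hY: "pairing hY (b 0) = 0" "pairing hY (b 1) = q0" "pairing hY (b 2) = q1" "pairing hY (b 3) = q2"
      using exists_nodal_projection[OF fr b(3-5,1,2)] by blast
    have "sympl_legendrian J (image_curve b)" using C b(6) a(2) by simp
    then have "legendrian_coeffs J b"
      by (rule legendrian_coeffs_necessary[OF frame_sympl[OF fr] _ b(7) hZ hY q])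
    then obtain s where s: "\<And>k. k \<in> {0, 1, 2, 3} \<Longrightarrow> b k = frame_cubic X Y N Z s k"
      using legendrian_through_frame_points[OF fr b(3-5,1,2)] by blast
    have F: "cubic b = ?F s" by (rule cubic_cong) (rule s)
    have Cs: "C = ?C s" using a(2) b(6) unfolding image_curve_def F by simp
    obtain p where p: "p \<in> C" "p \<subseteq> ?L" using C by blast
    then obtain w where w: "w \<noteq> 0" "p = proj_pt (?F s w)" unfolding Cs image_curve_def by blast
    have wL: "?F s w \<in> ?L" using p(2) proj_pt_self w(2) by blast
    have w2: "w $ 2 \<noteq> 0"
    proof
      assume w2: "w $ 2 = 0"
      then have "?F s w = w $ 1 ^ 3 *s Y" by (simp add: form_map_infinity frame_cubic_def)
      then have "w $ 1 ^ 3 * k3 = 0" using det4_on_span[OF wL, of N] by (simp add: bracket_simps k_def)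
      then show False using k(2) w(1) w2 by (simp add: vec2_nonzero_iff)
    qed
    define t where "t = w $ 1 / w $ 2"
    have "?F s w = w $ 2 ^ 3 *s ?F s (aff t)" using scale_aff[OF w2] form_map_scale by (metis t_def)
    then have "?F s (aff t) = inverse (w $ 2 ^ 3) *s ?F s w" using w2 by simp
    then have "?F s (aff t) \<in> ?L" using wL vec.span_scale by metis
    then show "C \<in> ?C ` slope ` T" using meets Cs by blast
  qed
  moreover have "inj_on ?C (slope ` T)"
    by (rule inj_onI) (rule image_frame_cubic_inj[OF fr])
  ultimately show ?thesis using cardT by (simp add: card_image slope_inj)
qed

text \<open>The component of \<open>v\<close> in the orthogonal complement of \<open>P\<close> and \<open>Q\<close>, multiplied by \<open>B(P, Q)\<close> to make it
  polynomial in \<open>P\<close>, \<open>Q\<close> and \<open>v\<close>.\<close>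

definition perp_part :: "complex^4^4 \<Rightarrow> complex^4 \<Rightarrow> complex^4 \<Rightarrow> complex^4 \<Rightarrow> complex^4"
  where "perp_part J P Q v = bil J P Q *s v - bil J v Q *s P - bil J P v *s Q"

text \<open>The frame belonging to representatives \<open>P, Q, R\<close> of the points, with an auxiliary vector \<open>e\<close> from which
  \<open>Z\<close> is obtained. The common factor clears the denominator \<open>B(Z, N)\<close>; with it the four vectors are
  polynomial in \<open>P, Q, R\<close> and homogeneous of the same multidegree \<open>(3, 3, 2)\<close>.\<close>

definition frame_scale :: "complex^4^4 \<Rightarrow> complex^4 \<Rightarrow> complex^4 \<Rightarrow> complex^4 \<Rightarrow> complex^4 \<Rightarrow> complex"
  where "frame_scale J e P Q R = bil J (perp_part J P Q e) (perp_part J P Q R)"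

definition frame_X where "frame_X J e P Q R = (frame_scale J e P Q R * bil J R Q) *s P"
definition frame_Y where "frame_Y J e P Q R = (frame_scale J e P Q R * bil J P R) *s Q"
definition frame_N where "frame_N J e P Q R = frame_scale J e P Q R *s perp_part J P Q R"
definition frame_Z where "frame_Z J e P Q R = (- 3 * bil J R Q * bil J P R * bil J P Q) *s perp_part J P Q e"

lemma bil_minus: "bil J (- x) y = - bil J x y" "bil J x (- y) = - bil J x y"
  using bil_scale_left[of J "-1" x y] bil_scale_right[of J x "-1" y] by simp_all

lemma perp_part_orthogonal:
  assumes "symplectic J" shows "bil J P (perp_part J P Q v) = 0" "bil J Q (perp_part J P Q v) = 0"
  using symplectic_self[OF assms] symplectic_swap[OF assms, of Q P] symplectic_swap[OF assms, of Q v]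
  by (simp_all add: perp_part_def bil_simps)

lemma frame_sum: "frame_X J e P Q R + frame_Y J e P Q R + frame_N J e P Q R
    = (frame_scale J e P Q R * bil J P Q) *s R"
  by (simp add: frame_X_def frame_Y_def frame_N_def perp_part_def vec_eq_iff algebra_simps)

lemma contact_frame_of_points:
  assumes J: "symplectic J" and "bil J (frame_X J e P Q R) (frame_Y J e P Q R) \<noteq> 0"
  shows "contact_frame J (frame_X J e P Q R) (frame_Y J e P Q R) (frame_N J e P Q R) (frame_Z J e P Q R)"
  using assms unfolding contact_frame_def
  by (auto simp: bil_minus frame_X_def frame_Y_def frame_N_def frame_Z_def bil_simps perp_part_orthogonal[OF J] frame_scale_def)

definition configuration_poly :: "complex^4^4 \<Rightarrow> complex^4 \<Rightarrow> complex^4 \<Rightarrow> complex^4 \<Rightarrow> complex^4 \<Rightarrow> complex^4^4 \<Rightarrow> complex"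
  where "configuration_poly J e P Q R m =
    (let X = frame_X J e P Q R; Y = frame_Y J e P Q R; N = frame_N J e P Q R; Z = frame_Z J e P Q R
     in bil J X Y * pencil_poly (bracket m N X) (bracket m N Z) (bracket m N Y) (bracket m X Y))"

lemma pencil_poly_scale:
  "pencil_poly (c * k0) (c * k1) (c * k3) (c * M) = c ^ 14 * pencil_poly k0 k1 k3 M"
proof -
  have "disc3 (c * k3) (- (c * k1)) (c * k1) (c * k0) = c ^ 4 * disc3 k3 (- k1) k1 k0"
    unfolding disc3_def by algebra
  moreover have "secant_poly (c * k0) (c * k1) (c * k3) (c * M) = c ^ 7 * secant_poly k0 k1 k3 M"
    unfolding secant_poly_def Let_def by algebra
  ultimately show ?thesis unfolding pencil_poly_def by algebra
qed

text \<open>As all frame vectors have the same multidegree, the brackets have the same multidegree too, and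
  \<open>pencil_poly\<close> is homogeneous of degree \<open>14\<close> in them.\<close>

lemma configuration_poly_scale:
  assumes m: "\<And>i j. m' $ i $ j = d * m $ i $ j"
  shows "\<exists>c. configuration_poly J e (cP *s P) (cQ *s Q) (cR *s R) m' = c * configuration_poly J e P Q R m"
proof -
  define th where "th = cP ^ 3 * cQ ^ 3 * cR ^ 2"
  have pR: "perp_part J (cP *s P) (cQ *s Q) (cR *s R) = (cP * cQ * cR) *s perp_part J P Q R"
    and pe: "perp_part J (cP *s P) (cQ *s Q) e = (cP * cQ) *s perp_part J P Q e"
    by (simp_all add: perp_part_def bil_simps vec_eq_iff algebra_simps)
  have sc: "frame_scale J e (cP *s P) (cQ *s Q) (cR *s R) = cP ^ 2 * cQ ^ 2 * cR * frame_scale J e P Q R"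
    unfolding frame_scale_def pR pe by (simp add: bil_simps power2_eq_square)
  have fr: "frame_X J e (cP *s P) (cQ *s Q) (cR *s R) = th *s frame_X J e P Q R"
    "frame_Y J e (cP *s P) (cQ *s Q) (cR *s R) = th *s frame_Y J e P Q R"
    "frame_N J e (cP *s P) (cQ *s Q) (cR *s R) = th *s frame_N J e P Q R"
    "frame_Z J e (cP *s P) (cQ *s Q) (cR *s R) = th *s frame_Z J e P Q R"
    unfolding frame_X_def frame_Y_def frame_N_def frame_Z_def sc pR pe bil_simps vector_smult_assoc th_def
    by (intro arg_cong2[where f = "(*s)"] refl; simp add: power2_eq_square power3_eq_cube mult_ac)+
  have br: "bracket m' (th *s V) (th *s W) = (d * th ^ 2) * bracket m V W" for V W
    unfolding bracket_scale_matrix[of m' d m, OF m] bracket_simps by (simp add: power2_eq_square)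
  show ?thesis
    unfolding configuration_poly_def Let_def fr br pencil_poly_scale bil_simps
    by (rule exI[of _ "th * th * (d * th\<^sup>2) ^ 14"]) (simp only: mult_ac)
qed

lemma pluecker_change_of_basis:
  assumes "vec.span {u, v} = vec.span {u', v'}"
  shows "\<exists>d. \<forall>i j. pluecker u' v' $ i $ j = d * pluecker u v $ i $ j"
proof -
  have comb: "\<exists>c d. w = c *s u + d *s v" if w: "w \<in> vec.span {u, v}" for w
  proof -
    obtain k where "w - k *s u \<in> vec.span {v}" using w unfolding vec.span_breakdown_eq[of w u] by blast
    then obtain d where "w - k *s u = d *s v" by (auto simp: vec.span_singleton)
    then have "w = k *s u + d *s v" by (metis diff_add_cancel add.commute)
    then show ?thesis by blast
  qed
  have "u' \<in> vec.span {u, v}" "v' \<in> vec.span {u, v}" unfolding assms by (simp_all add: vec.span_base)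
  with comb obtain c d c' d' where "u' = c *s u + d *s v" "v' = c' *s u + d' *s v" by metis
  then have "pluecker u' v' $ i $ j = (c * d' - d * c') * pluecker u v $ i $ j" for i j
    by (simp add: pluecker_def algebra_simps)
  then show ?thesis by blast
qed

lemma configuration_poly_well_defined:
  assumes "x \<noteq> 0" "y \<noteq> 0" "z \<noteq> 0" "x' \<noteq> 0" "y' \<noteq> 0" "z' \<noteq> 0"
    and "proj_pt x = proj_pt x'" "proj_pt y = proj_pt y'" "proj_pt z = proj_pt z'"
    and "vec.span {u, v} = vec.span {u', v'}"
    and "configuration_poly J e x' y' z' (pluecker u' v') \<noteq> 0"
  shows "configuration_poly J e x y z (pluecker u v) \<noteq> 0"
proof -
  obtain cx cy cz where "x' = cx *s x" "y' = cy *s y" "z' = cz *s z"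
    using assms proj_pt_eq_iff by metis
  moreover obtain d where d: "\<And>i j. pluecker u' v' $ i $ j = d * pluecker u v $ i $ j"
    using pluecker_change_of_basis[OF assms(10)] by blast
  ultimately show ?thesis using configuration_poly_scale[OF d, of J e cx x cy y cz z] assms(11) by auto
qed

definition poly_vec :: "((complex^4) \<times> (complex^4) \<times> (complex^4) \<times> (complex^4^4) \<Rightarrow> complex^4) \<Rightarrow> bool"
  where "poly_vec V \<longleftrightarrow> (\<forall>i. (\<lambda>p. V p $ i) \<in> param_polys)"

lemma param_polys_intros:
  "(\<lambda>p. c) \<in> param_polys"
  "f \<in> param_polys \<Longrightarrow> g \<in> param_polys \<Longrightarrow> (\<lambda>p. f p + g p) \<in> param_polys"
  "f \<in> param_polys \<Longrightarrow> g \<in> param_polys \<Longrightarrow> (\<lambda>p. f p * g p) \<in> param_polys"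
  "f \<in> param_polys \<Longrightarrow> g \<in> param_polys \<Longrightarrow> (\<lambda>p. f p - g p) \<in> param_polys"
  "f \<in> param_polys \<Longrightarrow> (\<lambda>p. - f p) \<in> param_polys"
  "f \<in> param_polys \<Longrightarrow> (\<lambda>p. f p ^ n) \<in> param_polys"
  "(\<And>i. i \<in> S \<Longrightarrow> h i \<in> param_polys) \<Longrightarrow> (\<lambda>p. \<Sum>i\<in>S. h i p) \<in> param_polys"
  unfolding param_polys_def by (intro poly_funs_intros; assumption)+

lemma poly_vec_coords:
  "poly_vec (\<lambda>(x, y, z, m). x)" "poly_vec (\<lambda>(x, y, z, m). y)" "poly_vec (\<lambda>(x, y, z, m). z)"
  unfolding poly_vec_def param_polys_def
  by (intro allI poly_funs.coord; auto simp: fun_eq_iff split: prod.splits)+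

lemma poly_vec_const: "poly_vec (\<lambda>p. e)"
  by (simp add: poly_vec_def param_polys_intros)

lemma poly_vec_diff: "poly_vec V \<Longrightarrow> poly_vec W \<Longrightarrow> poly_vec (\<lambda>p. V p - W p)"
  by (simp add: poly_vec_def param_polys_intros)

lemma poly_vec_scale: "f \<in> param_polys \<Longrightarrow> poly_vec V \<Longrightarrow> poly_vec (\<lambda>p. f p *s V p)"
  by (simp add: poly_vec_def param_polys_intros)

lemma bil_in_param_polys: "poly_vec V \<Longrightarrow> poly_vec W \<Longrightarrow> (\<lambda>p. bil J (V p) (W p)) \<in> param_polys"
  unfolding poly_vec_def bil_def pairing_def matrix_vector_mult_def vec_lambda_beta
  by (intro param_polys_intros) auto

lemma bracket_in_param_polys:
  assumes "poly_vec V" "poly_vec W"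
  shows "(\<lambda>p. bracket (snd (snd (snd p))) (V p) (W p)) \<in> param_polys"
proof -
  have m: "(\<lambda>p. snd (snd (snd p)) $ i $ j) \<in> param_polys" for i j
    unfolding param_polys_def by (intro poly_funs.coord) (auto simp: fun_eq_iff split: prod.splits)
  show ?thesis
    unfolding bracket_def using assms unfolding poly_vec_def by (intro param_polys_intros m) auto
qed

lemma configuration_poly_in_param_polys: "(\<lambda>(x, y, z, m). configuration_poly J e x y z m) \<in> param_polys"
proof -
  define P Q R where "P = (\<lambda>p :: (complex^4) \<times> (complex^4) \<times> (complex^4) \<times> (complex^4^4). fst p)"
    "Q = (\<lambda>p :: (complex^4) \<times> (complex^4) \<times> (complex^4) \<times> (complex^4^4). fst (snd p))"
    "R = (\<lambda>p :: (complex^4) \<times> (complex^4) \<times> (complex^4) \<times> (complex^4^4). fst (snd (snd p)))"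
  have PQR: "poly_vec P" "poly_vec Q" "poly_vec R"
    using poly_vec_coords unfolding P_Q_R_def by (simp_all add: case_prod_beta')
  note intros = PQR poly_vec_const poly_vec_diff poly_vec_scale bil_in_param_polys param_polys_intros bracket_in_param_polys
  have perp_part: "poly_vec (\<lambda>p. perp_part J (P p) (Q p) (V p))" if "poly_vec V" for V
    unfolding perp_part_def using that by (intro intros)
  have sc: "(\<lambda>p. frame_scale J e (P p) (Q p) (R p)) \<in> param_polys"
    unfolding frame_scale_def by (intro intros perp_part)
  have fr: "poly_vec (\<lambda>p. frame_X J e (P p) (Q p) (R p))" "poly_vec (\<lambda>p. frame_Y J e (P p) (Q p) (R p))"
    "poly_vec (\<lambda>p. frame_N J e (P p) (Q p) (R p))" "poly_vec (\<lambda>p. frame_Z J e (P p) (Q p) (R p))"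
    unfolding frame_X_def frame_Y_def frame_N_def frame_Z_def by (intro intros sc perp_part)+
  have "(\<lambda>p. configuration_poly J e (P p) (Q p) (R p) (snd (snd (snd p)))) \<in> param_polys"
    unfolding configuration_poly_def Let_def pencil_poly_def disc3_def secant_poly_def
    by (intro intros fr)
  then show ?thesis by (simp add: P_Q_R_def case_prod_beta')
qed

text \<open>Take \<open>P, Q\<close> with \<open>B(P, Q) = 1\<close> and \<open>n, n'\<close> orthogonal to them with \<open>B(n', n) = 1\<close>, the third point
  \<open>R = P + Q + n\<close>, and the line through \<open>P - Q\<close> and \<open>n'\<close>. Then \<open>k1\<close> and \<open>M\<close> vanish and \<open>k0 = k3 = D\<close>, so the
  cubic becomes \<open>D (t\<^sup>3 + 1)\<close>.\<close>

lemma exists_general_configuration: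
  assumes J: "symplectic J"
  shows "\<exists>e P Q R u v. P \<noteq> 0 \<and> Q \<noteq> 0 \<and> R \<noteq> 0 \<and> vec.span {u, v} \<in> proj_lines \<and>
    configuration_poly J e P Q R (pluecker u v) \<noteq> 0"
proof -
  define P :: "complex^4" where "P = axis 1 1"
  have "P \<noteq> 0" by (simp add: P_def axis_eq_0_iff)
  then obtain Q0 where Q0: "bil J P Q0 \<noteq> 0" using J unfolding symplectic_def by blast
  define Q where "Q = inverse (bil J P Q0) *s Q0"
  have PQ: "bil J P Q = 1" using Q0 by (simp add: Q_def bil_simps)
  have "\<exists>y. perp_part J P Q y \<noteq> 0"
  proof (rule ccontr)
    assume none: "\<not> ?thesis"
    have y: "y = bil J y Q *s P + bil J P y *s Q" for y
    proof (rule eq_iff_diff_eq_0[THEN iffD2])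
      have "y - (bil J y Q *s P + bil J P y *s Q) = perp_part J P Q y"
        unfolding perp_part_def PQ vector_smult_lid diff_diff_eq ..
      also have "\<dots> = 0" using none by blast
      finally show "y - (bil J y Q *s P + bil J P y *s Q) = 0" .
    qed
    have "UNIV \<subseteq> vec.span {P, Q}"
    proof
      fix y show "y \<in> vec.span {P, Q}"
      proof -
        obtain c d where "y = c *s P + d *s Q" using y by blast
        then show ?thesis by (simp add: vec.span_add vec.span_scale vec.span_base)
      qed
    qed
    then have "vec.dim (UNIV :: (complex^4) set) \<le> card {P, Q}" by (intro vec.dim_le_card) auto
    moreover have "card {P, Q} \<le> 2" by (simp add: card_insert_if)
    ultimately show False unfolding vec_dim_card by simp
  qed
  then obtain y where y: "perp_part J P Q y \<noteq> 0" by blast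
  define n where "n = perp_part J P Q y"
  have n: "bil J P n = 0" "bil J Q n = 0" unfolding n_def by (rule perp_part_orthogonal[OF J])+
  obtain y' where y': "bil J n y' \<noteq> 0" using J y unfolding symplectic_def n_def by blast
  \<comment> \<open>The sign makes \<open>B(n', n) = 1\<close>, hence \<open>B(n, n') = -1\<close>.\<close>
  define n' where "n' = (- inverse (bil J n y')) *s perp_part J P Q y'"
  have n': "bil J P n' = 0" "bil J Q n' = 0" unfolding n'_def bil_simps perp_part_orthogonal[OF J] by simp_all
  have nP: "bil J n P = 0" "bil J n Q = 0" using n symplectic_swap[OF J, of n] by auto
  have "bil J n (perp_part J P Q y') = bil J n y'" unfolding perp_part_def bil_simps nP PQ by simp
  then have nn': "bil J n n' = -1" unfolding n'_def bil_simps using y' by simp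
  have n'n: "bil J n' n = 1" using nn' symplectic_swap[OF J, of n' n] by simp
  have n'P: "bil J n' P = 0" "bil J n' Q = 0" "bil J Q P = -1"
    using n' PQ symplectic_swap[OF J, of n'] symplectic_swap[OF J, of Q P] by auto
  note vals = PQ n n' nP nn' n'n n'P symplectic_self[OF J]
  define R where "R = P + Q + n"
  define u where "u = P - Q"
  have fr: "frame_X J n' P Q R = P" "frame_Y J n' P Q R = Q" "frame_N J n' P Q R = n" "frame_Z J n' P Q R = (- 3) *s n'"
  proof -
    have "perp_part J P Q R = n" "perp_part J P Q n' = n'" "bil J R Q = 1" "bil J P R = 1"
      by (simp_all add: perp_part_def R_def bil_simps vals)
    then show "frame_X J n' P Q R = P" "frame_Y J n' P Q R = Q" "frame_N J n' P Q R = n" "frame_Z J n' P Q R = (- 3) *s n'"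
      by (simp_all add: frame_X_def frame_Y_def frame_N_def frame_Z_def frame_scale_def vals)
  qed
  define D where "D = det4 u n' n Q"
  have "pf J * D = 1"
    unfolding D_def pfaffian_identity[OF J] by (simp add: u_def bil_simps vals)
  then have D: "D \<noteq> 0" by auto
  have "u \<in> vec.span {u, n'}" "n' \<in> vec.span {u, n'}" by (simp_all add: vec.span_base)
  then have z: "det4 u n' x u = 0" "det4 u n' x n' = 0" for x by (auto intro: det4_on_span)
  have kX: "det4 u n' n P = D" using z(1)[of n] unfolding D_def u_def bracket_simps by simp
  have kM: "det4 u n' P Q = 0"
    using z(1)[of Q] bracket_swap[of "pluecker u n'" Q P] unfolding u_def[symmetric]
    by (simp add: u_def bracket_simps)
  have "configuration_poly J n' P Q R (pluecker u n') = pencil_poly D 0 D 0"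
    unfolding configuration_poly_def Let_def fr bracket_simps z kX kM PQ by (simp add: D_def)
  moreover have "pencil_poly D 0 D 0 = 108 * D ^ 14"
    unfolding pencil_poly_def disc3_def secant_poly_def Let_def
    by (simp add: eval_nat_numeral algebra_simps)
  ultimately have "configuration_poly J n' P Q R (pluecker u n') \<noteq> 0" using D by simp
  moreover have "vec.span {u, n'} \<in> proj_lines"
  proof -
    have ind: "c = 0 \<and> d = 0" if "c *s u + d *s n' = 0" for c d
    proof -
      have "bil J (c *s u + d *s n') Q = 0" "bil J (c *s u + d *s n') n = 0" unfolding that by simp_all
      then show ?thesis by (simp add: u_def bil_simps vals)
    qed
    show ?thesis unfolding proj_lines_def
      using independent_pair[OF ind] by (simp add: vec.subspace_span vec.dim_span vec.dim_eq_card_independent)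
  qed
  moreover have "P \<noteq> 0" "Q \<noteq> 0" using PQ by auto
  moreover have "R \<noteq> 0"
  proof
    assume "R = 0"
    then have "bil J P R = 0" by simp
    then show False by (simp add: R_def bil_simps vals)
  qed
  ultimately show ?thesis by blast
qed

section \<open>The count\<close>

theorem corollary6p3:
  fixes I :: "'i set" and A :: "'i \<Rightarrow> (complex^4) set set"
    and \<omega> :: "'i \<Rightarrow> complex^4 \<Rightarrow> complex^4"
  assumes "contact_form I A \<omega>"
  shows "\<exists>U. zariski_open_param U \<and> U \<noteq> {} \<and>
    (\<forall>p q r L. (p, q, r, L) \<in> U \<longrightarrow>
       card {C. rational_cubic C \<and> legendrian I A \<omega> C \<and>
                p \<in> C \<and> q \<in> C \<and> r \<in> C \<and> (\<exists>x\<in>C. x \<subseteq> L)} = 3)"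
proof -
  have cover: "(\<Union>i\<in>I. A i) = CP" using assms by (simp add: contact_form_def)
  obtain J where J: "symplectic J"
    and ker: "\<forall>i\<in>I. \<forall>x\<in>cone (A i). \<forall>v. pairing (\<omega> i x) v = 0 \<longleftrightarrow> bil J x v = 0"
    using contact_form_symplectic[OF assms] by blast
  obtain e P Q R u0 v0 where ex: "P \<noteq> 0" "Q \<noteq> 0" "R \<noteq> 0" "vec.span {u0, v0} \<in> proj_lines"
    "configuration_poly J e P Q R (pluecker u0 v0) \<noteq> 0"
    using exists_general_configuration[OF J] by blast
  define U where "U = {(proj_pt x, proj_pt y, proj_pt z, vec.span {u, v}) | x y z u v.
    x \<noteq> 0 \<and> y \<noteq> 0 \<and> z \<noteq> 0 \<and> vec.span {u, v} \<in> proj_lines \<and> configuration_poly J e x y z (pluecker u v) \<noteq> 0}"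
  have U_iff: "(proj_pt x, proj_pt y, proj_pt z, vec.span {u, v}) \<in> U \<longleftrightarrow> configuration_poly J e x y z (pluecker u v) \<noteq> 0"
    if nz: "x \<noteq> 0" "y \<noteq> 0" "z \<noteq> 0" "vec.span {u, v} \<in> proj_lines" for x y z u v
  proof
    assume "(proj_pt x, proj_pt y, proj_pt z, vec.span {u, v}) \<in> U"
    then obtain x' y' z' u' v' where "proj_pt x = proj_pt x'" "proj_pt y = proj_pt y'" "proj_pt z = proj_pt z'"
      "vec.span {u, v} = vec.span {u', v'}" "x' \<noteq> 0" "y' \<noteq> 0" "z' \<noteq> 0"
      "configuration_poly J e x' y' z' (pluecker u' v') \<noteq> 0"
      unfolding U_def by auto
    with nz show "configuration_poly J e x y z (pluecker u v) \<noteq> 0"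
      by (intro configuration_poly_well_defined[of x y z x' y' z' u v u' v' J e])
  next
    assume "configuration_poly J e x y z (pluecker u v) \<noteq> 0"
    then show "(proj_pt x, proj_pt y, proj_pt z, vec.span {u, v}) \<in> U"
      unfolding U_def using nz by blast
  qed
  have "zariski_open_param U" unfolding zariski_open_param_def
  proof
    show "U \<subseteq> CP \<times> CP \<times> CP \<times> proj_lines" unfolding U_def using proj_pt_in_CP by blast
    show "\<exists>F\<subseteq>param_polys. \<forall>x y z u v. x \<noteq> 0 \<longrightarrow> y \<noteq> 0 \<longrightarrow> z \<noteq> 0 \<longrightarrow> vec.span {u, v} \<in> proj_lines \<longrightarrow>
        ((proj_pt x, proj_pt y, proj_pt z, vec.span {u, v}) \<in> U) = (\<exists>f\<in>F. f (x, y, z, pluecker u v) \<noteq> 0)"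
      using configuration_poly_in_param_polys U_iff
      by (intro exI[of _ "{\<lambda>(x, y, z, m). configuration_poly J e x y z m}"]) simp
  qed
  moreover have "U \<noteq> {}" using U_iff[OF ex(1-4)] ex(5) by blast
  moreover have "card {C. rational_cubic C \<and> legendrian I A \<omega> C \<and> p \<in> C \<and> q \<in> C \<and> r \<in> C \<and> (\<exists>x\<in>C. x \<subseteq> L)} = 3"
    if "(p, q, r, L) \<in> U" for p q r L
  proof -
    obtain x y z u v where eq: "p = proj_pt x" "q = proj_pt y" "r = proj_pt z" "L = vec.span {u, v}"
      and c: "configuration_poly J e x y z (pluecker u v) \<noteq> 0"
      using \<open>(p, q, r, L) \<in> U\<close> unfolding U_def by blast
    define X Y N Z where XYNZ: "X = frame_X J e x y z" "Y = frame_Y J e x y z"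
      "N = frame_N J e x y z" "Z = frame_Z J e x y z"
    have c': "bil J X Y \<noteq> 0"
      "pencil_poly (det4 u v N X) (det4 u v N Z) (det4 u v N Y) (det4 u v X Y) \<noteq> 0"
      using c unfolding configuration_poly_def Let_def XYNZ by auto
    have fr: "contact_frame J X Y N Z"
      using contact_frame_of_points[OF J] c'(1) unfolding XYNZ by blast
    have factors: "frame_scale J e x y z \<noteq> 0" "bil J z y \<noteq> 0" "bil J x z \<noteq> 0" "bil J x y \<noteq> 0"
      using c'(1) by (auto simp: XYNZ frame_X_def frame_Y_def bil_simps)
    have pts: "proj_pt X = p" "proj_pt Y = q" "proj_pt (X + Y + N) = r"
      unfolding XYNZ frame_sum unfolding frame_X_def frame_Y_def eq using factors by (auto intro!: proj_pt_scale)
    show ?thesis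
      using three_legendrian_cubics[OF fr c'(2)] unfolding pts eq(4)[symmetric] legendrian_iff_sympl[OF cover ker] .
  qed
  ultimately show ?thesis by blast
qed

end
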